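(* Let $\nu>r>0$, $\sigma>0$, $T>0$, $K>0$, $\tau\in\mathbb{R}$ and $C_\tau\ge0$ be constants, and put $$J_\nu^{(\aleph_\tau)}:=\tfrac12\,(C_\tau\tau\nu-\sigma^2).$$ Suppose that the informed trader's risk-neutral stock price dynamics are given by $$dS_t^{(\aleph_\tau)}=\big(r-J_\nu^{(\aleph_\tau)}\big)S_t^{(\aleph_\tau)}\,dt+\sigma S_t^{(\aleph_\tau)}\,dB(t),\qquad t\in[0,T],$$ where $B$ is a standard Brownian motion and the initial value $S_0^{(\aleph_\tau)}>0$ is deterministic. Then for every $t\in[0,T)$ the trader's value $C^{(\aleph_\tau)}(S_t^{(\aleph_\tau)},t)$ of a European call contract with maturity price $C^{(\aleph_\tau)}(S_T^{(\aleph_\tau)},T)=\max(0,S_T^{(\aleph_\tau)}-K)$ is $$C^{(\aleph_\tau)}\big(S_t^{(\aleph_\tau)},t\big)=e^{-J_\nu^{(\aleph_\tau)}(T-t)}S_t^{(\aleph_\tau)}N(d_1)-Ke^{-r(T-t)}N(d_2),$$ where $$d_1=\frac{\ln\big(S_t^{(\aleph_\tau)}/K\big)+\big(r-J_\nu^{(\aleph_\tau)}+\frac{\sigma^2}{2}\big)(T-t)}{\sigma\sqrt{T-t}},\qquad d_2=d_1-\sigma\sqrt{T-t}.$$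
   Context: $N$ denotes the cumulative distribution function of the standard normal law. $r$ is the riskless rate, and $\nu$ is the market-perceived mean stock return. $\aleph_\tau$ is a label for a trader with information parameter $\tau$ ($\tau>0$ informed, $\tau=0$ uninformed, $\tau<0$ misinformed). The trader's value at time $t$ of a European contract with payoff $g(S_T^{(\aleph_\tau)})$ at maturity $T$ is the riskless-rate-discounted conditional expectation under the trader's risk-neutral dynamics: $e^{-r(T-t)}\,\mathbb{E}\big[g(S_T^{(\aleph_\tau)})\,\big|\,\mathcal{F}_t\big]$, where $(\mathcal{F}_t)$ is the filtration generated by $B$. *)

theory Defs
  imports "HOL-Probability.Probability"
begin

section \<open>Brownian motion and its filtration\<close>

locale standard_brownian_motion = prob_space M
  for M :: "'a measure" and B :: "real \<Rightarrow> 'a \<Rightarrow> real" +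
  assumes measurable_B: "\<And>t. 0 \<le> t \<Longrightarrow> B t \<in> borel_measurable M"
    and B_0: "AE \<omega> in M. B 0 \<omega> = 0"
    and indep_increments:
      "\<And>n ts. 0 \<le> ts 0 \<Longrightarrow> (\<And>i. i < n \<Longrightarrow> ts i < ts (Suc i)) \<Longrightarrow>
        indep_vars (\<lambda>_. borel) (\<lambda>i \<omega>. B (ts (Suc i)) \<omega> - B (ts i) \<omega>) {..<(n::nat)}"
    and normal_increments:
      "\<And>s t. 0 \<le> s \<Longrightarrow> s < t \<Longrightarrow>
        distributed M lborel (\<lambda>\<omega>. B t \<omega> - B s \<omega>) (normal_density 0 (sqrt (t - s)))"
    and continuous_paths: "AE \<omega> in M. continuous_on {0..} (\<lambda>t. B t \<omega>)"

definition natural_filtration ::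
  "'a measure \<Rightarrow> (real \<Rightarrow> 'a \<Rightarrow> real) \<Rightarrow> real \<Rightarrow> 'a measure" where
  "natural_filtration M B t =
    sigma (space M) {B s -` A \<inter> space M | s A. 0 \<le> s \<and> s \<le> t \<and> A \<in> sets borel}"

definition augmented :: "'a measure \<Rightarrow> (real \<Rightarrow> 'a measure) \<Rightarrow> real \<Rightarrow> 'a measure" where
  "augmented M F t = sigma (space M) (sets (F t) \<union> null_sets M)"


section \<open>The Ito integral\<close>

definition converges_in_probability ::
  "'a measure \<Rightarrow> (nat \<Rightarrow> 'a \<Rightarrow> real) \<Rightarrow> ('a \<Rightarrow> real) \<Rightarrow> bool" where
  "converges_in_probability M X Y \<longleftrightarrow>
    (\<forall>n. X n \<in> borel_measurable M) \<and> Y \<in> borel_measurable M \<and>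
    (\<forall>\<epsilon>>0. (\<lambda>n. measure M {\<omega> \<in> space M. \<epsilon> < \<bar>X n \<omega> - Y \<omega>\<bar>}) \<longlonglongrightarrow> 0)"

text \<open>
  A simple integrand is given by \<open>n\<close>, partition points \<open>ts 0 < \<dots> < ts n\<close> and coefficients
  \<open>\<xi> i\<close>, where \<open>\<xi> i\<close> is the value on the interval from \<open>ts i\<close> (excluded) to \<open>ts (i + 1)\<close>
  (included).
\<close>

definition simple_integrand ::
  "'a measure \<Rightarrow> (real \<Rightarrow> 'a measure) \<Rightarrow> nat \<Rightarrow> (nat \<Rightarrow> real) \<Rightarrow> (nat \<Rightarrow> 'a \<Rightarrow> real) \<Rightarrow> bool" where
  "simple_integrand M F n ts \<xi> \<longleftrightarrow>
    0 \<le> ts 0 \<and> (\<forall>i<n. ts i < ts (Suc i)) \<and>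
    (\<forall>i<n. \<xi> i \<in> borel_measurable (F (ts i)) \<and> (\<exists>c. \<forall>\<omega>\<in>space M. \<bar>\<xi> i \<omega>\<bar> \<le> c))"

definition simple_process ::
  "nat \<Rightarrow> (nat \<Rightarrow> real) \<Rightarrow> (nat \<Rightarrow> 'a \<Rightarrow> real) \<Rightarrow> real \<Rightarrow> 'a \<Rightarrow> real" where
  "simple_process n ts \<xi> s \<omega> = (\<Sum>i<n. \<xi> i \<omega> * indicator {ts i<..ts (Suc i)} s)"

definition simple_integral ::
  "(real \<Rightarrow> 'a \<Rightarrow> real) \<Rightarrow> nat \<Rightarrow> (nat \<Rightarrow> real) \<Rightarrow> (nat \<Rightarrow> 'a \<Rightarrow> real) \<Rightarrow> real \<Rightarrow> 'a \<Rightarrow> real" where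
  "simple_integral B n ts \<xi> t \<omega> =
    (\<Sum>i<n. \<xi> i \<omega> * (B (min (ts (Suc i)) t) \<omega> - B (min (ts i) t) \<omega>))"

definition progressively_measurable_upto ::
  "(real \<Rightarrow> 'a measure) \<Rightarrow> real \<Rightarrow> (real \<Rightarrow> 'a \<Rightarrow> real) \<Rightarrow> bool" where
  "progressively_measurable_upto F t H \<longleftrightarrow>
    (\<forall>u\<in>{0..t}. (\<lambda>(s, \<omega>). H s \<omega>) \<in> borel_measurable (restrict_space borel {0..u} \<Otimes>\<^sub>M F u))"

text \<open>
  \<open>I\<close> is a version of the Ito integral of \<open>H\<close> against \<open>B\<close> over \<open>[0, t]\<close>, for progressively
  measurable \<open>H\<close> whose square is almost surely integrable over \<open>[0, t]\<close>: the limit in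
  probability of the integrals of simple integrands \<open>H\<^sub>k\<close> for which the integral of
  \<open>(H\<^sub>k - H)\<^sup>2\<close> over \<open>[0, t]\<close> tends to 0 in probability. It is unique up to null sets, which is
  why this is a relation.
\<close>

definition is_ito_integral ::
  "'a measure \<Rightarrow> (real \<Rightarrow> 'a measure) \<Rightarrow> (real \<Rightarrow> 'a \<Rightarrow> real) \<Rightarrow>
    (real \<Rightarrow> 'a \<Rightarrow> real) \<Rightarrow> real \<Rightarrow> ('a \<Rightarrow> real) \<Rightarrow> bool" where
  "is_ito_integral M F B H t I \<longleftrightarrow>
    progressively_measurable_upto F t H \<and>
    (AE \<omega> in M. set_integrable lborel {0..t} (\<lambda>s. (H s \<omega>)\<^sup>2)) \<and>
    (\<exists>(n :: nat \<Rightarrow> nat) ts \<xi>.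
      (\<forall>k. simple_integrand M F (n k) (ts k) (\<xi> k)) \<and>
      converges_in_probability M
        (\<lambda>k \<omega>. LBINT s:{0..t}. (simple_process (n k) (ts k) (\<xi> k) s \<omega> - H s \<omega>)\<^sup>2) (\<lambda>_. 0) \<and>
      converges_in_probability M (\<lambda>k. simple_integral B (n k) (ts k) (\<xi> k) t) I)"


section \<open>Stochastic differential equations and valuation\<close>

text \<open>
  \<open>X\<close> is an adapted, almost surely continuous solution on \<open>[0, T]\<close> of
  \<open>dX = a(t, X) dt + b(t, X) dB\<close>, \<open>X 0 = x\<^sub>0\<close>, understood as an integral equation.
\<close>

definition sde_solution ::
  "'a measure \<Rightarrow> (real \<Rightarrow> 'a measure) \<Rightarrow> (real \<Rightarrow> 'a \<Rightarrow> real) \<Rightarrow> real \<Rightarrow>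
    (real \<Rightarrow> real \<Rightarrow> real) \<Rightarrow> (real \<Rightarrow> real \<Rightarrow> real) \<Rightarrow> real \<Rightarrow> (real \<Rightarrow> 'a \<Rightarrow> real) \<Rightarrow> bool" where
  "sde_solution M F B T a b x\<^sub>0 X \<longleftrightarrow>
    (\<forall>t\<in>{0..T}. X t \<in> borel_measurable (F t)) \<and>
    (AE \<omega> in M. continuous_on {0..T} (\<lambda>t. X t \<omega>)) \<and>
    (AE \<omega> in M. X 0 \<omega> = x\<^sub>0) \<and>
    (AE \<omega> in M. set_integrable lborel {0..T} (\<lambda>s. a s (X s \<omega>))) \<and>
    (\<forall>t\<in>{0..T}. \<exists>I. is_ito_integral M F B (\<lambda>s \<omega>. b s (X s \<omega>)) t I \<and>
      (AE \<omega> in M. X t \<omega> = X 0 \<omega> + (LBINT s:{0..t}. a s (X s \<omega>)) + I \<omega>))"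

definition european_value ::
  "'a measure \<Rightarrow> (real \<Rightarrow> 'a measure) \<Rightarrow> real \<Rightarrow> real \<Rightarrow> (real \<Rightarrow> real) \<Rightarrow>
    (real \<Rightarrow> 'a \<Rightarrow> real) \<Rightarrow> real \<Rightarrow> 'a \<Rightarrow> real" where
  "european_value M F r T g S t \<omega> =
    exp (- r * (T - t)) * real_cond_exp M (F t) (\<lambda>\<omega>'. g (S T \<omega>')) \<omega>"

definition std_normal_cdf :: "real \<Rightarrow> real" where
  "std_normal_cdf = cdf std_normal_distribution"

end

theory Submission
  imports Defs
begin

text \<open>
  The solution of the linear equation is identified by comparing it with an Euler scheme. Put
  \<open>Z\<^sub>t = exp (- (\<mu> - \<sigma>\<^sup>2 / 2) t - \<sigma> B\<^sub>t)\<close> with \<open>\<mu> = r - J\<close>. Simple integrands approximating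
  \<open>\<sigma> S\<close> drive a discrete process \<open>W\<close> that stays uniformly close to \<open>S\<close>, and the increments of
  \<open>W Z\<close> over a fine partition are, up to a vanishing drift, martingale differences of vanishing
  total variance. A maximal inequality for stopped sums, which needs no integrability of \<open>S\<close>,
  gives \<open>S Z = S\<^sub>0\<close> almost surely. Hence \<open>S\<^sub>T\<close> is \<open>S\<^sub>t\<close> times a lognormal variable independent
  of the past, and the conditional expectation is an explicit Gaussian integral.
\<close>

section \<open>Independence of Brownian increments from the past\<close>

text \<open>For each fixed time the integral equation provides only some version of an Ito integral,
  a limit in probability along a sequence that may change with the time. No path property of the
  integral and no moment of \<open>S\<close> is given. So the simple integrals must be close to the
  chosen versions at all mesh points at once. The mesh has to refine the partition of the simple
  integrand; that integrand is therefore fixed before the mesh, with an error bound uniform over all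
  finite sets of times.

  \<open>Z\<close> is the reciprocal of the expected exponential. Over a step of length d with
  increment b, the change of \<open>Z\<close> times the Euler factor 1 + \<mu> d + \<sigma> b
  differs from 1 by a variable whose mean and second moment are O(d^2); the term \<sigma>^2 / 2 in
  \<open>Z\<close> is what makes this true of the mean. Writing the drift as \<theta> \<sigma> S
  with \<theta> = \<mu> / \<sigma> lets one approximation of \<sigma> S drive both terms of the
  scheme.

  The equation lives on the augmented filtration and the value on the generated one, so increments
  must be independent of the past in both.\<close>

definition (in prob_space) indep_of :: "'a measure \<Rightarrow> ('a \<Rightarrow> real) \<Rightarrow> bool" where
  "indep_of G U \<longleftrightarrow> subalgebra M G \<and> random_variable borel U \<and>
    (\<forall>A\<in>sets G. \<forall>D\<in>sets borel.
      prob (A \<inter> (U -` D \<inter> space M)) = prob A * prob (U -` D \<inter> space M))"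

text \<open>Turns the product rule on events into \<open>indep_var\<close>, the form in which
  expectations of products factor. Preimages of Borel sets form intersection-stable families, so the
  rule passes to the generated sigma-algebras.\<close>

lemma (in prob_space) indep_of_indep_var:
  assumes "indep_of G U" and Y: "Y \<in> borel_measurable G"
  shows "indep_var borel Y borel U"
proof -
  have G: "subalgebra M G" and U: "random_variable borel U"
    and indep: "\<And>A D. A \<in> sets G \<Longrightarrow> D \<in> sets borel \<Longrightarrow>
      prob (A \<inter> (U -` D \<inter> space M)) = prob A * prob (U -` D \<inter> space M)"
    using assms by (auto simp: indep_of_def)
  have Y': "random_variable borel Y" and space: "space G = space M"
    using measurable_from_subalg[OF G Y] G by (auto simp: subalgebra_def)
  have stable: "Int_stable {V -` D \<inter> space M |D. D \<in> sets borel}" for V :: "'a \<Rightarrow> real"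
    unfolding Int_stable_def by (clarsimp, rule_tac x="D \<inter> Da" in exI) auto
  have "indep_set {Y -` D \<inter> space M |D. D \<in> sets borel} {U -` D \<inter> space M |D. D \<in> sets borel}"
    unfolding indep_sets2_eq
    using U Y' indep measurable_sets[OF Y] by (auto simp: measurable_sets space)
  then show ?thesis
    unfolding indep_var_eq using U Y' stable by (auto intro!: indep_set_sigma_sets)
qed

lemma (in prob_space) indep_of_compose:
  assumes "indep_of G U" and f: "f \<in> borel_measurable borel"
  shows "indep_of G (\<lambda>\<omega>. f (U \<omega>))"
  unfolding indep_of_def
proof (intro conjI ballI)
  fix A and D :: "real set" assume A: "A \<in> sets G" and D: "D \<in> sets borel"
  have "(\<lambda>\<omega>. f (U \<omega>)) -` D \<inter> space M = U -` (f -` D) \<inter> space M"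
    by auto
  moreover have "f -` D \<in> sets borel"
    using measurable_sets[OF f D] by simp
  ultimately show "prob (A \<inter> ((\<lambda>\<omega>. f (U \<omega>)) -` D \<inter> space M)) =
      prob A * prob ((\<lambda>\<omega>. f (U \<omega>)) -` D \<inter> space M)"
    using assms A by (simp add: indep_of_def)
qed (use assms in \<open>auto simp: indep_of_def\<close>)

section \<open>Augmentation of a filtration by the null sets\<close>

text \<open>Being almost everywhere equal to a set of \<open>F t\<close> holds for the generators, a
  null set being replaced by the empty set, and is preserved by complements and countable unions.
  This reduces statements on the augmented filtration to the raw one.\<close>

lemma augmented_AE_eq:
  assumes sub: "subalgebra M (F t)" and A: "A \<in> sets (augmented M F t)"
  obtains A' where "A' \<in> sets (F t)" "AE \<omega> in M. \<omega> \<in> A \<longleftrightarrow> \<omega> \<in> A'"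
proof -
  have space: "space (F t) = space M" and sets: "sets (F t) \<subseteq> sets M"
    using sub by (auto simp: subalgebra_def)
  have sub: "sets (F t) \<union> null_sets M \<subseteq> Pow (space M)"
    using sets sets.sets_into_space by blast
  have "A \<in> sigma_sets (space M) (sets (F t) \<union> null_sets M)"
    using A sub by (simp add: augmented_def)
  then have "\<exists>A'\<in>sets (F t). AE \<omega> in M. \<omega> \<in> A \<longleftrightarrow> \<omega> \<in> A'"
  proof induction
    case (Basic a)
    then show ?case
    proof
      assume "a \<in> null_sets M"
      then show ?thesis
        by (intro bexI[of _ "{}"]) (auto simp: AE_not_in)
    qed auto
  next
    case Empty
    then show ?case
      by (intro bexI[of _ "{}"]) auto
  next
    case (Compl a)
    then obtain A' where "A' \<in> sets (F t)" "AE \<omega> in M. \<omega> \<in> a \<longleftrightarrow> \<omega> \<in> A'"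
      by blast
    then show ?case
      by (intro bexI[of _ "space M - A'"]) (auto simp flip: space)
  next
    case (Union a)
    then have "\<forall>i. \<exists>A'. A' \<in> sets (F t) \<and> (AE \<omega> in M. \<omega> \<in> a i \<longleftrightarrow> \<omega> \<in> A')"
      by blast
    then obtain A' where A': "\<And>i. A' i \<in> sets (F t)" "\<And>i. AE \<omega> in M. \<omega> \<in> a i \<longleftrightarrow> \<omega> \<in> A' i"
      by metis
    have "AE \<omega> in M. \<forall>i. \<omega> \<in> a i \<longleftrightarrow> \<omega> \<in> A' i"
      using A'(2) by (simp add: AE_all_countable)
    then have "AE \<omega> in M. \<omega> \<in> (\<Union>i. a i) \<longleftrightarrow> \<omega> \<in> (\<Union>i. A' i)"
      by eventually_elim auto
    moreover have "(\<Union>i. A' i) \<in> sets (F t)"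
      using A'(1) by auto
    ultimately show ?case
      by blast
  qed
  then show ?thesis
    using that by blast
qed

lemma subalgebra_augmented:
  assumes "subalgebra M (F t)"
  shows "subalgebra M (augmented M F t)" and "sets (F t) \<subseteq> sets (augmented M F t)"
proof -
  have sets: "sets (F t) \<union> null_sets M \<subseteq> sets M"
    using assms by (auto simp: subalgebra_def)
  then have "sets (F t) \<union> null_sets M \<subseteq> Pow (space M)"
    using sets.space_closed[of M] by (rule order_trans)
  then have eq: "sets (augmented M F t) = sigma_sets (space M) (sets (F t) \<union> null_sets M)"
    by (simp add: augmented_def)
  show "subalgebra M (augmented M F t)"
    unfolding subalgebra_def eq
    using sets.sigma_sets_subset[OF sets] by (simp add: augmented_def space_measure_of_conv)
  show "sets (F t) \<subseteq> sets (augmented M F t)"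
    unfolding eq by auto
qed

lemma augmented_mono:
  assumes "subalgebra M (F s)" "subalgebra M (F t)" "sets (F s) \<subseteq> sets (F t)"
  shows "sets (augmented M F s) \<subseteq> sets (augmented M F t)"
proof -
  have "sets (F s) \<union> null_sets M \<subseteq> sets M" "sets (F t) \<union> null_sets M \<subseteq> sets M"
    using assms by (auto simp: subalgebra_def)
  then have "sets (F s) \<union> null_sets M \<subseteq> Pow (space M)" "sets (F t) \<union> null_sets M \<subseteq> Pow (space M)"
    using sets.space_closed[of M] by (blast intro: order_trans)+
  then show ?thesis
    using assms(3) unfolding augmented_def
    by (simp only: sets_measure_of) (intro sigma_sets_subseteq Un_mono order_refl)
qed

lemma finite_set_as_partition:
  fixes P :: "real set"
  assumes "finite P" "P \<noteq> {}"
  obtains n p where "p ` {..n::nat} = P" "p 0 = Min P" "p n = Max P" "\<And>i. i < n \<Longrightarrow> p i < p (Suc i)"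
proof -
  define xs where "xs = sorted_list_of_set P"
  define n where "n = length xs - 1"
  have xs: "set xs = P" "sorted_wrt (<) xs" "xs \<noteq> []"
    using assms by (auto simp: xs_def)
  have len: "length xs = Suc n"
    using xs(3) by (cases xs) (auto simp: n_def)
  have inc: "xs ! i < xs ! Suc i" if "i < n" for i
    using xs(2) that len by (simp add: sorted_wrt_nth_less)
  have img: "(!) xs ` {..n} = P"
    using xs(1) len by (auto simp: set_conv_nth image_def less_Suc_eq_le) 
  have le: "xs ! i \<le> xs ! j" if "i \<le> j" "j \<le> n" for i j
    using xs(2) that len by (simp add: sorted_nth_mono strict_sorted_imp_sorted)
  have "xs ! 0 = Min P"
    using le[of 0] img assms by (intro Min_eqI[symmetric]) auto
  moreover have "xs ! n = Max P"
    using le[of _ n] img assms by (intro Max_eqI[symmetric]) auto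
  ultimately show ?thesis
    using that[of "(!) xs" n] img inc by blast
qed

section \<open>The filtration generated by a Brownian motion\<close>

lemma space_natural_filtration [simp]: "space (natural_filtration M B t) = space M"
  by (simp add: natural_filtration_def space_measure_of_conv)

lemma sets_natural_filtration:
  "sets (natural_filtration M B t) =
    sigma_sets (space M) {B s -` A \<inter> space M | s A. 0 \<le> s \<and> s \<le> t \<and> A \<in> sets borel}"
  unfolding natural_filtration_def by (rule sets_measure_of) auto

lemma natural_filtration_mono:
  "s \<le> t \<Longrightarrow> sets (natural_filtration M B s) \<subseteq> sets (natural_filtration M B t)"
  unfolding sets_natural_filtration by (rule sigma_sets_subseteq) force

lemma measurable_natural_filtration:
  "0 \<le> s \<Longrightarrow> s \<le> t \<Longrightarrow> B s \<in> borel_measurable (natural_filtration M B t)"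
  by (auto simp: measurable_def sets_natural_filtration intro!: sigma_sets.Basic)

context standard_brownian_motion
begin

abbreviation "\<F> \<equiv> natural_filtration M B"
abbreviation "\<G> \<equiv> augmented M \<F>"

lemma subalgebra_F: "subalgebra M (\<F> t)"
  unfolding subalgebra_def sets_natural_filtration
  by (intro conjI sets.sigma_sets_subset) (auto intro: measurable_sets[OF measurable_B])

lemma subalgebra_G: "subalgebra M (\<G> t)" and F_subset_G: "sets (\<F> t) \<subseteq> sets (\<G> t)"
  by (simp_all add: subalgebra_augmented subalgebra_F)

lemma space_G [simp]: "space (\<G> t) = space M"
  using subalgebra_G by (auto simp: subalgebra_def)

lemma G_mono: "s \<le> t \<Longrightarrow> sets (\<G> s) \<subseteq> sets (\<G> t)"
  by (intro augmented_mono subalgebra_F natural_filtration_mono)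

lemma B_measurable_G: "0 \<le> s \<Longrightarrow> s \<le> t \<Longrightarrow> B s \<in> borel_measurable (\<G> t)"
  using measurable_natural_filtration[of s t B M] F_subset_G[of t] by (auto simp: measurable_def)

lemma measurable_G_mono: "f \<in> measurable (\<G> s) N \<Longrightarrow> s \<le> t \<Longrightarrow> f \<in> measurable (\<G> t) N"
  using G_mono[of s t] by (auto simp: measurable_def)

lemma measurable_G_M: "f \<in> measurable (\<G> s) N \<Longrightarrow> f \<in> measurable M N"
  using measurable_from_subalg subalgebra_G by blast


text \<open>With 0 and \<open>s\<close> added to the sampling times, each \<open>B i - B 0\<close>
  is a partial sum of increments up to \<open>s\<close>, while \<open>B t - B s\<close> is the next
  increment. Independence of disjoint blocks of increments then gives the product rule.\<close>

lemma indep_cylinder: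
  assumes s: "0 \<le> s" "s < t" and I: "finite I" "I \<subseteq> {0..s}"
    and A: "\<And>i. i \<in> I \<Longrightarrow> A i \<in> sets borel" and D: "D \<in> sets borel"
  shows "prob ({\<omega> \<in> space M. \<forall>i\<in>I. B i \<omega> \<in> A i} \<inter> ((\<lambda>\<omega>. B t \<omega> - B s \<omega>) -` D \<inter> space M)) =
    \<P>(\<omega> in M. \<forall>i\<in>I. B i \<omega> \<in> A i) * prob ((\<lambda>\<omega>. B t \<omega> - B s \<omega>) -` D \<inter> space M)"
proof -
  let ?C = "{\<omega> \<in> space M. \<forall>i\<in>I. B i \<omega> \<in> A i}"
  define P where "P = I \<union> {0, s}"
  have P: "finite P" "P \<noteq> {}"
    using I by (auto simp: P_def)
  have "Min P = 0" "Max P = s"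
    using P I s by (intro Min_eqI Max_eqI; force simp: P_def)+
  then obtain n p where p: "p ` {..n::nat} = P" "p 0 = 0" "p n = s" "\<And>i. i < n \<Longrightarrow> p i < p (Suc i)"
    using finite_set_as_partition[of P] P by metis
  \<comment> \<open>\<open>q\<close> appends \<open>t\<close> behind the last point
    \<open>p n = s\<close>, so increment number \<open>n\<close> is \<open>B t - B s\<close> and the
    increments below \<open>n\<close> carry the past.\<close>
  define q where "q i = (if i \<le> n then p i else t)" for i
  have "indep_vars (\<lambda>_. borel) (\<lambda>i \<omega>. B (q (Suc i)) \<omega> - B (q i) \<omega>) {..<Suc n}"
  proof (rule indep_increments)
    show "q i < q (Suc i)" if "i < Suc n" for i
      using that p s by (cases "i = n") (auto simp: q_def)
  qed (simp add: q_def p)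
  from indep_var_restrict[OF this, of "{..<n}" "{n}"]
  have ind: "indep_var (PiM {..<n} (\<lambda>_. borel)) (\<lambda>\<omega>. \<lambda>i\<in>{..<n}. B (q (Suc i)) \<omega> - B (q i) \<omega>)
      (PiM {n} (\<lambda>_. borel)) (\<lambda>\<omega>. \<lambda>i\<in>{n}. B (q (Suc i)) \<omega> - B (q i) \<omega>)"
    by auto
  obtain idx where idx: "\<And>i. i \<in> I \<Longrightarrow> idx i \<le> n \<and> p (idx i) = i"
  proof -
    have "\<forall>i\<in>I. i \<in> p ` {..n}"
      using p(1) by (auto simp: P_def)
    then have "\<forall>i\<in>I. \<exists>j\<le>n. p j = i"
      by auto
    then show thesis using that by metis
  qed
  define E where "E = {x \<in> space (PiM {..<n} (\<lambda>_. borel)). \<forall>i\<in>I. (\<Sum>j<idx i. x j) \<in> A i}"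
  have E: "E \<in> sets (PiM {..<n} (\<lambda>_. borel :: real measure))"
  proof -
    have "(\<lambda>x. \<Sum>j<idx i. x j) \<in> borel_measurable (PiM {..<n} (\<lambda>_. borel :: real measure))" if "i \<in> I" for i
      using idx[OF that] by (intro borel_measurable_sum measurable_component_singleton) auto
    then show ?thesis
      unfolding E_def using A I(1)
      by (intro sets.sets_Collect_finite_All) (auto simp: measurable_sets_Collect)
  qed
  \<comment> \<open>\<open>B 0\<close> vanishes only almost surely, so the sums of increments
    describe this event rather than the cylinder itself; the two are exchanged at the end, up to a
    null set.\<close>
  define E' where "E' = {\<omega> \<in> space M. \<forall>i\<in>I. B i \<omega> - B 0 \<omega> \<in> A i}"
  define D' where "D' = (\<lambda>\<omega>. B t \<omega> - B s \<omega>) -` D \<inter> space M"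
  have tel: "(\<Sum>j<m. B (q (Suc j)) \<omega> - B (q j) \<omega>) = B (q m) \<omega> - B (q 0) \<omega>" for m \<omega>
    by (rule sum_lessThan_telescope)
  define X where "X \<omega> = (\<lambda>i\<in>{..<n}. B (q (Suc i)) \<omega> - B (q i) \<omega>)" for \<omega>
  define Y where "Y \<omega> = (\<lambda>i\<in>{n}. B (q (Suc i)) \<omega> - B (q i) \<omega>)" for \<omega>
  define D'' where "D'' = {x \<in> space (PiM {n} (\<lambda>_. borel :: real measure)). x n \<in> D}"
  have D'': "D'' \<in> sets (PiM {n} (\<lambda>_. borel :: real measure))"
  proof -
    have "(\<lambda>x. x n) \<in> borel_measurable (PiM {n} (\<lambda>_. borel :: real measure))"
      by (rule measurable_component_singleton) simp
    then have "(\<lambda>x. x n) -` D \<inter> space (PiM {n} (\<lambda>_. borel :: real measure)) \<in> sets (PiM {n} (\<lambda>_. borel :: real measure))"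
      using D by (rule measurable_sets)
    moreover have "D'' = (\<lambda>x. x n) -` D \<inter> space (PiM {n} (\<lambda>_. borel :: real measure))"
      unfolding D''_def by blast
    ultimately show ?thesis
      by (simp only:)
  qed
  have "prob ((\<lambda>\<omega>. (X \<omega>, Y \<omega>)) -` (E \<times> D'') \<inter> space M) = prob (X -` E \<inter> space M) * prob (Y -` D'' \<inter> space M)"
    using ind unfolding X_def[symmetric] Y_def[symmetric] by (rule indep_varD) (use E D'' in auto)
  also have "(\<lambda>\<omega>. (X \<omega>, Y \<omega>)) -` (E \<times> D'') \<inter> space M = (X -` E \<inter> space M) \<inter> (Y -` D'' \<inter> space M)"
    by auto
  also have "X -` E \<inter> space M = E'"
  proof -
    have *: "(\<Sum>j<idx i. X \<omega> j) = B i \<omega> - B 0 \<omega>" if "i \<in> I" for i \<omega>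
    proof -
      have "(\<Sum>j<idx i. X \<omega> j) = (\<Sum>j<idx i. B (q (Suc j)) \<omega> - B (q j) \<omega>)"
        using idx[OF that] by (intro sum.cong) (auto simp: X_def)
      also have "\<dots> = B i \<omega> - B 0 \<omega>"
        unfolding tel using idx[OF that] p(2) by (simp add: q_def)
      finally show ?thesis .
    qed
    moreover have "X \<omega> \<in> space (PiM {..<n} (\<lambda>_. borel))" for \<omega>
      by (auto simp: X_def space_PiM)
    ultimately show ?thesis
      by (auto simp: E_def E'_def)
  qed
  also have "Y -` D'' \<inter> space M = D'"
    by (auto simp: D''_def D'_def Y_def space_PiM q_def p)
  finally have eq: "prob (E' \<inter> D') = prob E' * prob D'" .
  have B_meas: "B i \<in> borel_measurable M" if "i \<in> I \<or> i = 0 \<or> i = s \<or> i = t" for i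
    using that I s by (intro measurable_B) auto
  have D'_sets: "D' \<in> events"
    unfolding D'_def using D B_meas by (intro measurable_sets[of _ _ borel]) auto
  have E'_sets: "E' \<in> events"
    unfolding E'_def using A I(1) B_meas
    by (intro sets.sets_Collect_finite_All) (auto intro!: measurable_sets_Collect)
  have C_sets: "?C \<in> events"
    using A I(1) B_meas
    by (intro sets.sets_Collect_finite_All) (auto intro!: measurable_sets_Collect)
  have AE: "AE \<omega> in M. \<omega> \<in> ?C \<longleftrightarrow> \<omega> \<in> E'"
    using B_0 by eventually_elim (auto simp: E'_def)
  have "prob ?C = prob E'"
    using AE E'_sets C_sets by (intro finite_measure_eq_AE) auto
  moreover have "prob (?C \<inter> D') = prob (E' \<inter> D')"
    using AE E'_sets C_sets D'_sets by (intro finite_measure_eq_AE) auto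
  ultimately show ?thesis
    using eq by (simp add: D'_def)
qed

text \<open>Cylinders over finitely many times up to \<open>s\<close> form an intersection-stable
  generator of \<open>\<F> s\<close>, so the product rule for them extends to the whole
  sigma-algebra.\<close>

lemma indep_increment_F:
  assumes s: "0 \<le> s" "s < t" and E: "E \<in> sets (\<F> s)" and D: "D \<in> sets borel"
  shows "prob (E \<inter> ((\<lambda>\<omega>. B t \<omega> - B s \<omega>) -` D \<inter> space M)) =
    prob E * prob ((\<lambda>\<omega>. B t \<omega> - B s \<omega>) -` D \<inter> space M)"
proof -
  define C where "C = {{\<omega> \<in> space M. \<forall>i\<in>I. B i \<omega> \<in> A i} | I A. finite I \<and> I \<subseteq> {0..s} \<and> (\<forall>i. A i \<in> sets (borel :: real measure))}"
  define \<D> where "\<D> = {(\<lambda>\<omega>. B t \<omega> - B s \<omega>) -` D \<inter> space M | D. D \<in> sets borel}"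
  have B_meas: "B i \<in> borel_measurable M" if "i \<in> {0..s} \<or> i = s \<or> i = t" for i
    using that s by (intro measurable_B) auto
  have inc: "(\<lambda>\<omega>. B t \<omega> - B s \<omega>) \<in> borel_measurable M"
    using B_meas by auto
  have C_sub: "C \<subseteq> events"
  proof safe
    fix a assume "a \<in> C"
    then obtain I A where I: "finite I" "I \<subseteq> {0..s}" "\<And>i. A i \<in> sets (borel :: real measure)"
      and a: "a = {\<omega> \<in> space M. \<forall>i\<in>I. B i \<omega> \<in> A i}"
      unfolding C_def by blast
    show "a \<in> events"
      unfolding a
    proof (rule sets.sets_Collect_finite_All[OF _ I(1)])
      fix i assume "i \<in> I"
      then have "B i \<in> borel_measurable M"
        using B_meas[of i] I(2) by blast
      then have "B i -` A i \<inter> space M \<in> events"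
        using I(3) by (rule measurable_sets)
      moreover have "{\<omega> \<in> space M. B i \<omega> \<in> A i} = B i -` A i \<inter> space M"
        by blast
      ultimately show "{\<omega> \<in> space M. B i \<omega> \<in> A i} \<in> events"
        by (simp only:)
    qed
  qed
  have "indep_set C \<D>"
    unfolding indep_sets2_eq
  proof safe
    show "\<And>x. x \<in> C \<Longrightarrow> x \<in> events" using C_sub by auto
    show "\<And>x. x \<in> \<D> \<Longrightarrow> x \<in> events" using inc by (auto simp: \<D>_def measurable_sets)
    show "prob (a \<inter> b) = prob a * prob b" if "a \<in> C" "b \<in> \<D>" for a b
      using that indep_cylinder[OF s] unfolding C_def \<D>_def by auto
  qed
  moreover have "Int_stable C"
    unfolding Int_stable_def
  proof safe
    fix a b assume "a \<in> C" "b \<in> C"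
    then obtain I A J A' where I: "finite I" "I \<subseteq> {0..s}" "\<And>i. A i \<in> sets borel" "a = {\<omega> \<in> space M. \<forall>i\<in>I. B i \<omega> \<in> A i}"
      and J: "finite J" "J \<subseteq> {0..s}" "\<And>i. A' i \<in> sets borel" "b = {\<omega> \<in> space M. \<forall>i\<in>J. B i \<omega> \<in> A' i}"
      unfolding C_def by blast
    \<comment> \<open>A time that occurs in only one of the two index sets gets the whole line from
      the other, so that the intersection is again a cylinder, over
      \<open>I \<union> J\<close>.\<close>
    define A'' where "A'' i = (if i \<in> I then A i else UNIV) \<inter> (if i \<in> J then A' i else UNIV)" for i
    have "a \<inter> b = {\<omega> \<in> space M. \<forall>i\<in>I \<union> J. B i \<omega> \<in> A'' i}"
      unfolding I(4) J(4) A''_def by (fastforce split: if_splits)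
    moreover have "\<forall>i. A'' i \<in> sets borel"
      unfolding A''_def using I(3) J(3) by simp
    moreover have "finite (I \<union> J)" "I \<union> J \<subseteq> {0..s}"
      using I(1,2) J(1,2) by simp_all
    ultimately show "a \<inter> b \<in> C"
      unfolding C_def mem_Collect_eq by (intro exI[of _ "I \<union> J"] exI[of _ A'']) simp
  qed
  moreover have "Int_stable \<D>"
    unfolding Int_stable_def \<D>_def by (clarsimp, rule_tac x="D \<inter> Da" in exI) auto
  ultimately have "indep_set (sigma_sets (space M) C) (sigma_sets (space M) \<D>)"
    by (rule indep_set_sigma_sets)
  moreover have "sets (\<F> s) \<subseteq> sigma_sets (space M) C"
    unfolding sets_natural_filtration
  proof (rule sigma_sets_mono, safe)
    fix i and A :: "real set" assume "0 \<le> i" "i \<le> s" "A \<in> sets borel"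
    then have "B i -` A \<inter> space M \<in> C"
      unfolding C_def by (auto intro!: exI[of _ "{i}"] exI[of _ "\<lambda>_. A"])
    then show "B i -` A \<inter> space M \<in> sigma_sets (space M) C"
      by auto
  qed
  moreover have "(\<lambda>\<omega>. B t \<omega> - B s \<omega>) -` D \<inter> space M \<in> sigma_sets (space M) \<D>"
    using D by (auto simp: \<D>_def)
  ultimately show ?thesis
    using E by (intro indep_setD[where A="sigma_sets _ _" and B="sigma_sets _ _"]) auto
qed

text \<open>An event of the augmented sigma-algebra differs from a raw one by a null set, which
  neither side of the product rule notices.\<close>

lemma indep_increment_G:
  assumes s: "0 \<le> s" "s < t"
  shows "indep_of (\<G> s) (\<lambda>\<omega>. B t \<omega> - B s \<omega>)"
  unfolding indep_of_def
proof (intro conjI ballI subalgebra_G)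
  show inc: "(\<lambda>\<omega>. B t \<omega> - B s \<omega>) \<in> borel_measurable M"
    using s by (intro borel_measurable_diff measurable_B) auto
  fix E and D :: "real set" assume "E \<in> sets (\<G> s)" and D: "D \<in> sets borel"
  then obtain E' where E': "E' \<in> sets (\<F> s)" "AE \<omega> in M. \<omega> \<in> E \<longleftrightarrow> \<omega> \<in> E'"
    using augmented_AE_eq[of M \<F> s E] subalgebra_F by metis
  let ?D = "(\<lambda>\<omega>. B t \<omega> - B s \<omega>) -` D \<inter> space M"
  have sets: "E \<in> events" "E' \<in> events" "?D \<in> events"
    using \<open>E \<in> sets (\<G> s)\<close> E' subalgebra_F subalgebra_G inc D by (auto simp: subalgebra_def)
  have "prob E = prob E'"
    using E'(2) sets by (intro finite_measure_eq_AE) auto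
  moreover have "prob (E \<inter> ?D) =
      prob (E' \<inter> ?D)"
    using E'(2) sets by (intro finite_measure_eq_AE) auto
  ultimately show "prob (E \<inter> ?D) =
      prob E * prob ?D"
    using indep_increment_F[OF s E'(1) D] by simp
qed

end

section \<open>Inequalities for sums of stopped noise\<close>

lemma (in prob_space) finite_exists_events:
  fixes f :: "'i \<Rightarrow> 'a \<Rightarrow> real"
  assumes I: "finite I" and f: "\<And>i. i \<in> I \<Longrightarrow> f i \<in> borel_measurable M"
  shows "{\<omega> \<in> space M. \<exists>i\<in>I. \<epsilon> < \<bar>f i \<omega>\<bar>} \<in> events"
    and "\<P>(\<omega> in M. \<exists>i\<in>I. \<epsilon> < \<bar>f i \<omega>\<bar>) \<le> (\<Sum>i\<in>I. \<P>(\<omega> in M. \<epsilon> < \<bar>f i \<omega>\<bar>))"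
proof -
  have ev: "{\<omega> \<in> space M. \<epsilon> < \<bar>f i \<omega>\<bar>} \<in> events" if "i \<in> I" for i
    using f[OF that] by measurable
  have eq: "{\<omega> \<in> space M. \<exists>i\<in>I. \<epsilon> < \<bar>f i \<omega>\<bar>} = (\<Union>i\<in>I. {\<omega> \<in> space M. \<epsilon> < \<bar>f i \<omega>\<bar>})"
    by auto
  show "{\<omega> \<in> space M. \<exists>i\<in>I. \<epsilon> < \<bar>f i \<omega>\<bar>} \<in> events"
    unfolding eq using I ev by (rule sets.finite_UN)
  show "\<P>(\<omega> in M. \<exists>i\<in>I. \<epsilon> < \<bar>f i \<omega>\<bar>) \<le> (\<Sum>i\<in>I. \<P>(\<omega> in M. \<epsilon> < \<bar>f i \<omega>\<bar>))"
    unfolding eq using I ev by (intro finite_measure_subadditive_finite) auto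
qed

lemma (in prob_space) exists_le_events:
  fixes f :: "nat \<Rightarrow> 'a \<Rightarrow> real"
  assumes "\<And>i. i \<le> m \<Longrightarrow> f i \<in> borel_measurable M"
  shows "{\<omega> \<in> space M. \<exists>i\<le>m. \<epsilon> < \<bar>f i \<omega>\<bar>} \<in> events"
  using finite_exists_events(1)[of "{..m}" f \<epsilon>] assms by (simp add: Bex_def)

text \<open>Carries triangle-inequality arguments over to probabilities. The implication may fail on
  a null set because it is also applied where it rests on the continuity of paths.\<close>

lemma (in prob_space) prob_mono2_AE:
  assumes "AE \<omega> in M. P \<omega> \<longrightarrow> Q \<omega> \<or> R \<omega>"
    and ev: "{\<omega> \<in> space M. Q \<omega>} \<in> events" "{\<omega> \<in> space M. R \<omega>} \<in> events"
  shows "\<P>(\<omega> in M. P \<omega>) \<le> \<P>(\<omega> in M. Q \<omega>) + \<P>(\<omega> in M. R \<omega>)"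
proof -
  have "\<P>(\<omega> in M. P \<omega>) \<le> prob ({\<omega> \<in> space M. Q \<omega>} \<union> {\<omega> \<in> space M. R \<omega>})"
    using assms by (intro finite_measure_mono_AE) auto
  also have "\<dots> \<le> \<P>(\<omega> in M. Q \<omega>) + \<P>(\<omega> in M. R \<omega>)"
    using ev by (rule measure_Un_le)
  finally show ?thesis .
qed

lemma (in prob_space) integrable_if_square_integrable:
  fixes f :: "'a \<Rightarrow> real"
  assumes f: "f \<in> borel_measurable M" and "integrable M (\<lambda>x. (f x)\<^sup>2)"
  shows "integrable M f"
proof (rule Bochner_Integration.integrable_bound)
  show "integrable M (\<lambda>x. 1 + (f x)\<^sup>2)"
    using assms by simp
  have "\<bar>y\<bar> \<le> 1 + y\<^sup>2" for y :: real
    using sum_squares_bound[of 1 "\<bar>y\<bar>"] abs_ge_zero[of y] by (simp del: abs_ge_zero)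
  then show "AE x in M. norm (f x) \<le> norm (1 + (f x)\<^sup>2)"
    by (auto simp: abs_of_nonneg)
qed (use f in simp)

text \<open>
  The coefficients are stopped as soon as the predictable quadratic variation would exceed \<open>\<delta>\<close>
  or the sum has exceeded \<open>\<epsilon>\<close>. The stopped coefficients are bounded, so the stopped sum is a
  square integrable martingale.
\<close>

lemma (in prob_space) martingale_sum_maximal_inequality:
  fixes U \<eta> :: "nat \<Rightarrow> 'a \<Rightarrow> real" and v :: "nat \<Rightarrow> real"
  assumes G: "\<And>i. i \<le> n \<Longrightarrow> subalgebra M (G i)" "\<And>i j. i \<le> j \<Longrightarrow> j \<le> n \<Longrightarrow> sets (G i) \<subseteq> sets (G j)"
    and U: "\<And>i. i < n \<Longrightarrow> U i \<in> borel_measurable (G (Suc i))"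
      "\<And>i. i < n \<Longrightarrow> indep_of (G i) (U i)"
      "\<And>i. i < n \<Longrightarrow> integrable M (\<lambda>\<omega>. (U i \<omega>)\<^sup>2)"
      "\<And>i. i < n \<Longrightarrow> expectation (U i) = 0"
      "\<And>i. i < n \<Longrightarrow> expectation (\<lambda>\<omega>. (U i \<omega>)\<^sup>2) \<le> v i"
    and v: "\<And>i. i < n \<Longrightarrow> 0 < v i"
    and \<eta>: "\<And>i. i < n \<Longrightarrow> \<eta> i \<in> borel_measurable (G i)"
    and "0 < \<epsilon>" "0 \<le> \<delta>"
  shows "\<P>(\<omega> in M. \<exists>i\<le>n. \<epsilon> < \<bar>\<Sum>j<i. \<eta> j \<omega> * U j \<omega>\<bar>) \<le>
    \<P>(\<omega> in M. \<delta> < (\<Sum>j<n. (\<eta> j \<omega>)\<^sup>2 * v j)) + \<delta> / \<epsilon>\<^sup>2"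
proof -
  \<comment> \<open>\<open>S j\<close> involves coefficients up to \<open>j\<close> but noise only
    below \<open>j\<close>: the choice between \<open>\<eta> j\<close> and 0 is made before
    \<open>U j\<close> enters.\<close>
  define S where "S j \<omega> \<longleftrightarrow> (\<Sum>l\<le>j. (\<eta> l \<omega>)\<^sup>2 * v l) \<le> \<delta> \<and> (\<forall>m\<le>j. \<bar>\<Sum>l<m. \<eta> l \<omega> * U l \<omega>\<bar> \<le> \<epsilon>)" for j \<omega>
  define a where "a j \<omega> = (if S j \<omega> then \<eta> j \<omega> else 0)" for j \<omega>
  define X where "X m \<omega> = (\<Sum>j<m. a j \<omega> * U j \<omega>)" for m \<omega>
  have lift: "f \<in> borel_measurable (G j)" if "f \<in> borel_measurable (G i)" "i \<le> j" "j \<le> n"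
    for i j and f :: "'a \<Rightarrow> real"
    using that G(1)[of i] G(1)[of j] G(2)[of i j] by (auto simp: measurable_def subalgebra_def)
  have to_M: "f \<in> borel_measurable M" if "f \<in> borel_measurable (G i)" "i \<le> n" for i and f :: "'a \<Rightarrow> real"
    using that measurable_from_subalg[OF G(1)] by blast
  have \<eta>': "\<eta> l \<in> borel_measurable (G j)" if "l \<le> j" "l < n" "j \<le> n" for l j
    using lift[OF \<eta>] that by blast
  have U': "U l \<in> borel_measurable (G j)" if "l < j" "j \<le> n" for l j
    using lift[OF U(1), of l j] that by auto
  have S_meas: "Measurable.pred (G j) (S j)" if "j < n" for j
  proof -
    have [measurable]: "(\<lambda>\<omega>. \<Sum>l\<le>j. (\<eta> l \<omega>)\<^sup>2 * v l) \<in> borel_measurable (G j)"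
      using that by (intro borel_measurable_sum borel_measurable_times borel_measurable_power \<eta>') auto
    have [measurable]: "(\<lambda>\<omega>. if m \<le> j then \<Sum>l<m. \<eta> l \<omega> * U l \<omega> else 0) \<in> borel_measurable (G j)" for m
      using that by (cases "m \<le> j") (auto intro!: borel_measurable_sum borel_measurable_times \<eta>' U')
    \<comment> \<open>The bounded quantifier becomes one over all \<open>m\<close>, with default
      value 0, for which the bound holds because 0 < \<epsilon>. In this form \<open>S j\<close> is
      a countable conjunction of measurable predicates.\<close>
    have "S j = (\<lambda>\<omega>. (\<Sum>l\<le>j. (\<eta> l \<omega>)\<^sup>2 * v l) \<le> \<delta> \<and>
        (\<forall>m. \<bar>if m \<le> j then \<Sum>l<m. \<eta> l \<omega> * U l \<omega> else 0\<bar> \<le> \<epsilon>))"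
      using \<open>0 < \<epsilon>\<close> by (auto simp: S_def fun_eq_iff)
    moreover have "Measurable.pred (G j) \<dots>"
      by measurable
    ultimately show ?thesis
      by (simp only:)
  qed
  have a_meas: "a j \<in> borel_measurable (G j)" if "j < n" for j
    unfolding a_def using S_meas[OF that] \<eta>[OF that] by measurable
  have X_meas: "X m \<in> borel_measurable (G m)" if "m \<le> n" for m
    unfolding X_def[abs_def]
  proof (intro borel_measurable_sum borel_measurable_times)
    fix j assume "j \<in> {..<m}"
    then show "a j \<in> borel_measurable (G m)" "U j \<in> borel_measurable (G m)"
      using that lift[OF a_meas, of j m] U' by auto
  qed
  have U_M: "U j \<in> borel_measurable M" if "j < n" for j
    by (rule to_M[OF U(1)[OF that]]) (use that in simp)
  \<comment> \<open>Stopping bounds each coefficient by a constant, since its own term belongs to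
    the sum that is kept below \<delta>. All integrability needed for the stopped sum comes from
    here.\<close>
  have a_bound: "(a j \<omega>)\<^sup>2 \<le> \<delta> / v j" if "j < n" for j \<omega>
  proof (cases "S j \<omega>")
    case True
    have "(\<eta> j \<omega>)\<^sup>2 * v j \<le> (\<Sum>l\<le>j. (\<eta> l \<omega>)\<^sup>2 * v l)"
    proof (rule member_le_sum[of j "{..j}" "\<lambda>l. (\<eta> l \<omega>)\<^sup>2 * v l"])
      fix l assume "l \<in> {..j} - {j}"
      then have "0 < v l"
        using that by (intro v) simp
      then show "0 \<le> (\<eta> l \<omega>)\<^sup>2 * v l"
        by simp
    qed simp_all
    also have "\<dots> \<le> \<delta>"
      using True by (simp add: S_def)
    finally show ?thesis
      using True v[OF that] by (simp add: a_def field_simps)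
  next
    case False
    then show ?thesis
      using v[OF that] \<open>0 \<le> \<delta>\<close> by (simp add: a_def)
  qed
  have a2_int: "integrable M (\<lambda>\<omega>. (a j \<omega>)\<^sup>2)" if "j < n" for j
    using to_M[OF a_meas] that a_bound[OF that]
    by (intro integrable_const_bound[of _ "\<delta> / v j"]) auto
  have X2: "integrable M (\<lambda>\<omega>. (X m \<omega>)\<^sup>2) \<and>
      expectation (\<lambda>\<omega>. (X m \<omega>)\<^sup>2) \<le> (\<Sum>j<m. expectation (\<lambda>\<omega>. (a j \<omega>)\<^sup>2 * v j))" if "m \<le> n" for m
    using that
  proof (induction m)
    case 0
    then show ?case
      by (simp add: X_def)
  next
    case (Suc m)
    then have m: "m < n" "m \<le> n" and IH: "integrable M (\<lambda>\<omega>. (X m \<omega>)\<^sup>2)"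
      "expectation (\<lambda>\<omega>. (X m \<omega>)\<^sup>2) \<le> (\<Sum>j<m. expectation (\<lambda>\<omega>. (a j \<omega>)\<^sup>2 * v j))"
      by auto
    have X_M: "X m \<in> borel_measurable M" and a_M: "a m \<in> borel_measurable M"
      using to_M[OF X_meas, of m] to_M[OF a_meas, of m] m by simp_all
    have X_int: "integrable M (X m)"
      using X_M IH(1) by (rule integrable_if_square_integrable)
    have U_int: "integrable M (U m)"
      using U_M[OF m(1)] U(3)[OF m(1)] by (rule integrable_if_square_integrable)
    have Xa_int: "integrable M (\<lambda>\<omega>. X m \<omega> * a m \<omega>)"
    proof (rule Bochner_Integration.integrable_bound)
      show "integrable M (\<lambda>\<omega>. X m \<omega> * sqrt (\<delta> / v m))"
        using X_int by simp
      have "\<bar>a m \<omega>\<bar> \<le> sqrt (\<delta> / v m)" for \<omega>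
        using a_bound[OF m(1), of \<omega>] real_le_rsqrt[of "\<bar>a m \<omega>\<bar>"] by simp
      then show "AE \<omega> in M. norm (X m \<omega> * a m \<omega>) \<le> norm (X m \<omega> * sqrt (\<delta> / v m))"
        unfolding real_norm_def abs_mult
        by (intro AE_I2 mult_left_mono abs_ge_zero) (blast intro: order_trans[OF _ abs_ge_self])
    qed (use X_M a_M in simp)
    have ind1: "indep_var borel (\<lambda>\<omega>. X m \<omega> * a m \<omega>) borel (U m)"
      using X_meas[OF m(2)] a_meas[OF m(1)] by (intro indep_of_indep_var[OF U(2)[OF m(1)]]) simp
    have ind2: "indep_var borel (\<lambda>\<omega>. (a m \<omega>)\<^sup>2) borel (\<lambda>\<omega>. (U m \<omega>)\<^sup>2)"
      using a_meas[OF m(1)]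
      by (intro indep_of_indep_var[OF indep_of_compose[OF U(2)[OF m(1)], of "\<lambda>x. x\<^sup>2"]]) simp_all
    \<comment> \<open>The cross term has mean zero: \<open>X m * a m\<close> is known at index
      \<open>m\<close>, and \<open>U m\<close> is centred and independent of that
      information.\<close>
    have eq: "(X (Suc m) \<omega>)\<^sup>2 = (X m \<omega>)\<^sup>2 + 2 * ((X m \<omega> * a m \<omega>) * U m \<omega>) + (a m \<omega>)\<^sup>2 * (U m \<omega>)\<^sup>2" for \<omega>
      by (simp add: X_def power2_sum power_mult_distrib algebra_simps)
    have int1: "integrable M (\<lambda>\<omega>. (X m \<omega> * a m \<omega>) * U m \<omega>)"
      using ind1 Xa_int U_int by (rule indep_var_integrable)
    have int2: "integrable M (\<lambda>\<omega>. (a m \<omega>)\<^sup>2 * (U m \<omega>)\<^sup>2)"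
      using ind2 a2_int[OF m(1)] U(3)[OF m(1)] by (rule indep_var_integrable)
    have "expectation (\<lambda>\<omega>. (X (Suc m) \<omega>)\<^sup>2) =
        expectation (\<lambda>\<omega>. (X m \<omega>)\<^sup>2) + 2 * expectation (\<lambda>\<omega>. (X m \<omega> * a m \<omega>) * U m \<omega>) +
        expectation (\<lambda>\<omega>. (a m \<omega>)\<^sup>2 * (U m \<omega>)\<^sup>2)"
      unfolding eq using IH(1) int1 int2 by simp
    also have "expectation (\<lambda>\<omega>. (X m \<omega> * a m \<omega>) * U m \<omega>) = 0"
      using indep_var_lebesgue_integral[OF ind1 Xa_int U_int] U(4)[OF m(1)] by simp
    also have "expectation (\<lambda>\<omega>. (a m \<omega>)\<^sup>2 * (U m \<omega>)\<^sup>2) =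
        expectation (\<lambda>\<omega>. (a m \<omega>)\<^sup>2) * expectation (\<lambda>\<omega>. (U m \<omega>)\<^sup>2)"
      by (rule indep_var_lebesgue_integral[OF ind2 a2_int[OF m(1)] U(3)[OF m(1)]])
    also have "\<dots> \<le> expectation (\<lambda>\<omega>. (a m \<omega>)\<^sup>2) * v m"
      using U(5)[OF m(1)] by (intro mult_left_mono integral_nonneg) auto
    finally have "expectation (\<lambda>\<omega>. (X (Suc m) \<omega>)\<^sup>2) \<le>
        (\<Sum>j<Suc m. expectation (\<lambda>\<omega>. (a j \<omega>)\<^sup>2 * v j))"
      using IH(2) by simp
    moreover have "integrable M (\<lambda>\<omega>. (X (Suc m) \<omega>)\<^sup>2)"
      unfolding eq using IH(1) int1 int2 by simp
    ultimately show ?case by blast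
  qed
  have pointwise: "(\<Sum>j<m. (a j \<omega>)\<^sup>2 * v j) \<le> \<delta>" if "m \<le> n" for m \<omega>
    using that
  proof (induction m)
    case (Suc m)
    show ?case
    proof (cases "S m \<omega>")
      case True
      have "(\<Sum>j<Suc m. (a j \<omega>)\<^sup>2 * v j) \<le> (\<Sum>j\<le>m. (\<eta> j \<omega>)\<^sup>2 * v j)"
        unfolding lessThan_Suc_atMost using Suc.prems v
        by (intro sum_mono) (auto simp: a_def less_imp_le)
      also have "\<dots> \<le> \<delta>"
        using True by (simp add: S_def)
      finally show ?thesis .
    qed (use Suc in \<open>simp add: a_def\<close>)
  qed (use \<open>0 \<le> \<delta>\<close> in simp)
  have "expectation (\<lambda>\<omega>. (X n \<omega>)\<^sup>2) \<le> (\<Sum>j<n. expectation (\<lambda>\<omega>. (a j \<omega>)\<^sup>2 * v j))"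
    using X2 by simp
  also have "\<dots> = expectation (\<lambda>\<omega>. \<Sum>j<n. (a j \<omega>)\<^sup>2 * v j)"
    by (intro Bochner_Integration.integral_sum[symmetric] integrable_mult_left a2_int) simp
  also have "\<dots> \<le> \<delta>"
    using pointwise[of n]
    by (intro integral_le_const Bochner_Integration.integrable_sum integrable_mult_left a2_int AE_I2) simp_all
  finally have EX: "expectation (\<lambda>\<omega>. (X n \<omega>)\<^sup>2) \<le> \<delta>" .
  have X_M: "X n \<in> borel_measurable M"
    using to_M[OF X_meas[of n]] by simp
  have Q_M: "(\<lambda>\<omega>. \<Sum>j<n. (\<eta> j \<omega>)\<^sup>2 * v j) \<in> borel_measurable M"
    by (intro borel_measurable_sum borel_measurable_times borel_measurable_power borel_measurable_const to_M[OF \<eta>]) simp_all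
  have sets: "{\<omega> \<in> space M. \<delta> < (\<Sum>j<n. (\<eta> j \<omega>)\<^sup>2 * v j)} \<in> events" "{\<omega> \<in> space M. \<epsilon> \<le> \<bar>X n \<omega>\<bar>} \<in> events"
    using Q_M X_M by measurable
  have "\<epsilon> \<le> \<bar>X n \<omega>\<bar>" if "(\<Sum>j<n. (\<eta> j \<omega>)\<^sup>2 * v j) \<le> \<delta>" "i \<le> n" "\<epsilon> < \<bar>\<Sum>j<i. \<eta> j \<omega> * U j \<omega>\<bar>" for i \<omega>
  proof -
    \<comment> \<open>\<open>k\<close> is the first index at which the unstopped sum exceeds
      \<epsilon>. The rule \<open>S\<close> holds before \<open>k\<close> and fails from
      \<open>k\<close> on, so \<open>X n\<close> is frozen at the value reached at \<open>k\<close>.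
      A bound on the final value thus controls the maximum.\<close>
    define k where "k = (LEAST i. \<epsilon> < \<bar>\<Sum>j<i. \<eta> j \<omega> * U j \<omega>\<bar>)"
    have k: "\<epsilon> < \<bar>\<Sum>j<k. \<eta> j \<omega> * U j \<omega>\<bar>" and "k \<le> i"
      unfolding k_def using that(3) by (rule LeastI, rule Least_le)
    have before: "\<bar>\<Sum>j<m. \<eta> j \<omega> * U j \<omega>\<bar> \<le> \<epsilon>" if "m < k" for m
      using not_less_Least[OF that[unfolded k_def]] by simp
    have "S j \<omega>" if "j < k" for j
    proof -
      have "(\<Sum>l\<le>j. (\<eta> l \<omega>)\<^sup>2 * v l) \<le> (\<Sum>l<n. (\<eta> l \<omega>)\<^sup>2 * v l)"
        using \<open>j < k\<close> \<open>k \<le> i\<close> \<open>i \<le> n\<close> v by (intro sum_mono2) (auto simp: less_imp_le)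
      then show ?thesis
        using \<open>j < k\<close> before \<open>(\<Sum>j<n. (\<eta> j \<omega>)\<^sup>2 * v j) \<le> \<delta>\<close> by (auto simp: S_def)
    qed
    moreover have "\<not> S j \<omega>" if "k \<le> j" for j
      using k that by (force simp: S_def)
    ultimately have "X n \<omega> = (\<Sum>j<n. if j < k then \<eta> j \<omega> * U j \<omega> else 0)"
      unfolding X_def by (intro sum.cong) (auto simp: a_def not_less)
    also have "\<dots> = (\<Sum>j\<in>{..<n} \<inter> {..<k}. \<eta> j \<omega> * U j \<omega>)"
      by (subst sum.inter_restrict) auto
    also have "{..<n} \<inter> {..<k} = {..<k}"
      using \<open>k \<le> i\<close> \<open>i \<le> n\<close> by auto
    finally show ?thesis
      using k by simp
  qed
  then have "{\<omega> \<in> space M. \<exists>i\<le>n. \<epsilon> < \<bar>\<Sum>j<i. \<eta> j \<omega> * U j \<omega>\<bar>} \<subseteq>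
      {\<omega> \<in> space M. \<delta> < (\<Sum>j<n. (\<eta> j \<omega>)\<^sup>2 * v j)} \<union> {\<omega> \<in> space M. \<epsilon> \<le> \<bar>X n \<omega>\<bar>}"
    by (auto simp: not_less[symmetric])
  then have "\<P>(\<omega> in M. \<exists>i\<le>n. \<epsilon> < \<bar>\<Sum>j<i. \<eta> j \<omega> * U j \<omega>\<bar>) \<le>
      prob ({\<omega> \<in> space M. \<delta> < (\<Sum>j<n. (\<eta> j \<omega>)\<^sup>2 * v j)} \<union> {\<omega> \<in> space M. \<epsilon> \<le> \<bar>X n \<omega>\<bar>})"
    using sets by (intro finite_measure_mono) auto
  also have "\<dots> \<le> \<P>(\<omega> in M. \<delta> < (\<Sum>j<n. (\<eta> j \<omega>)\<^sup>2 * v j)) + \<P>(\<omega> in M. \<epsilon> \<le> \<bar>X n \<omega>\<bar>)"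
    using sets by (rule measure_Un_le)
  also have "\<P>(\<omega> in M. \<epsilon> \<le> \<bar>X n \<omega>\<bar>) \<le> expectation (\<lambda>\<omega>. (X n \<omega>)\<^sup>2) / \<epsilon>\<^sup>2"
    using X_M X2[of n] \<open>0 < \<epsilon>\<close> by (intro second_moment_method) simp_all
  also have "\<dots> \<le> \<delta> / \<epsilon>\<^sup>2"
    using EX by (simp add: divide_right_mono)
  finally show ?thesis by simp
qed

text \<open>Centring splits the sum in two. The centred part falls under the maximal inequality and
  the sum of means under Cauchy-Schwarz, each against \<epsilon> / 2; \<open>small\<close> is the
  condition that Cauchy-Schwarz leaves. The probability of a large quadratic sum is paid once for
  each part, which gives the factor 2, and the 4 comes from halving \<epsilon>.\<close>

lemma (in prob_space) noise_sum_inequality: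
  fixes U \<eta> :: "nat \<Rightarrow> 'a \<Rightarrow> real" and d :: "nat \<Rightarrow> real"
  assumes G: "\<And>i. i \<le> n \<Longrightarrow> subalgebra M (G i)" "\<And>i j. i \<le> j \<Longrightarrow> j \<le> n \<Longrightarrow> sets (G i) \<subseteq> sets (G j)"
    and U: "\<And>i. i < n \<Longrightarrow> U i \<in> borel_measurable (G (Suc i))"
      "\<And>i. i < n \<Longrightarrow> indep_of (G i) (U i)"
      "\<And>i. i < n \<Longrightarrow> integrable M (\<lambda>\<omega>. (U i \<omega>)\<^sup>2)"
      "\<And>i. i < n \<Longrightarrow> \<bar>expectation (U i)\<bar> \<le> c * d i"
      "\<And>i. i < n \<Longrightarrow> expectation (\<lambda>\<omega>. (U i \<omega>)\<^sup>2) \<le> c * d i"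
    and d: "\<And>i. i < n \<Longrightarrow> 0 < d i" and "0 < c"
    and \<eta>: "\<And>i. i < n \<Longrightarrow> \<eta> i \<in> borel_measurable (G i)"
    and "0 < \<epsilon>" "0 \<le> \<delta>" and small: "c * sqrt (\<delta> * (\<Sum>j<n. d j)) \<le> \<epsilon> / 2"
  shows "\<P>(\<omega> in M. \<epsilon> < \<bar>\<Sum>j<n. \<eta> j \<omega> * U j \<omega>\<bar>) \<le>
    2 * \<P>(\<omega> in M. \<delta> < (\<Sum>j<n. (\<eta> j \<omega>)\<^sup>2 * d j)) + 4 * c * \<delta> / \<epsilon>\<^sup>2"
proof -
  define V where "V i \<omega> = U i \<omega> - expectation (U i)" for i \<omega>
  have U_M: "U i \<in> borel_measurable M" if "i < n" for i
    by (rule measurable_from_subalg[OF G(1) U(1)[OF that]]) (use that in simp)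
  have U_int: "integrable M (U i)" if "i < n" for i
    using U_M[OF that] U(3)[OF that] by (rule integrable_if_square_integrable)
  define P1 where "P1 = {\<omega> \<in> space M. \<delta> < (\<Sum>j<n. (\<eta> j \<omega>)\<^sup>2 * d j)}"
  define P2 where "P2 = {\<omega> \<in> space M. \<exists>i\<le>n. \<epsilon> / 2 < \<bar>\<Sum>j<i. \<eta> j \<omega> * V j \<omega>\<bar>}"
  have \<eta>_M: "\<eta> i \<in> borel_measurable M" if "i < n" for i
    by (rule measurable_from_subalg[OF G(1) \<eta>[OF that]]) (use that in simp)
  have P1: "P1 \<in> events"
  proof -
    have "(\<lambda>\<omega>. \<Sum>j<n. (\<eta> j \<omega>)\<^sup>2 * d j) \<in> borel_measurable M"
      by (intro borel_measurable_sum borel_measurable_times borel_measurable_power borel_measurable_const \<eta>_M) simp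
    then show ?thesis unfolding P1_def by measurable
  qed
  have P2: "P2 \<in> events"
    unfolding P2_def V_def
    by (intro exists_le_events borel_measurable_sum borel_measurable_times borel_measurable_diff
        borel_measurable_const \<eta>_M U_M) simp_all
  have sum_c: "(\<Sum>j<n. (\<eta> j \<omega>)\<^sup>2 * (c * d j)) = c * (\<Sum>j<n. (\<eta> j \<omega>)\<^sup>2 * d j)" for \<omega>
    by (simp add: sum_distrib_left mult_ac)
  \<comment> \<open>With weights \<open>c * d j\<close> both sides of the quadratic condition scale
    by \<open>c\<close>, so the threshold \<open>c * \<delta>\<close> describes the event
    \<open>P1\<close>.\<close>
  have "prob P2 \<le> \<P>(\<omega> in M. c * \<delta> < (\<Sum>j<n. (\<eta> j \<omega>)\<^sup>2 * (c * d j))) + c * \<delta> / (\<epsilon> / 2)\<^sup>2"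
    unfolding P2_def
  proof (rule martingale_sum_maximal_inequality[OF G])
    fix i assume i: "i < n"
    show "V i \<in> borel_measurable (G (Suc i))"
      unfolding V_def using U(1)[OF i] by simp
    show "indep_of (G i) (V i)"
      unfolding V_def using U(2)[OF i] by (intro indep_of_compose[where f="\<lambda>x. x - expectation (U i)"]) auto
    show "integrable M (\<lambda>\<omega>. (V i \<omega>)\<^sup>2)"
      unfolding V_def power2_diff using U(3)[OF i] U_int[OF i] by simp
    show "expectation (V i) = 0"
      unfolding V_def using U_int[OF i] by (simp add: prob_space)
    have "expectation (\<lambda>\<omega>. (V i \<omega>)\<^sup>2) = expectation (\<lambda>\<omega>. (U i \<omega>)\<^sup>2) - (expectation (U i))\<^sup>2"
      unfolding V_def using U(3)[OF i] U_int[OF i] by (simp add: variance_eq)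
    then show "expectation (\<lambda>\<omega>. (V i \<omega>)\<^sup>2) \<le> c * d i"
      using U(5)[OF i] zero_le_power2[of "expectation (U i)"] by linarith
    show "0 < c * d i"
      using d[OF i] \<open>0 < c\<close> by simp
  qed (use \<eta> \<open>0 < \<epsilon>\<close> \<open>0 \<le> \<delta>\<close> \<open>0 < c\<close> in auto)
  also have "{\<omega> \<in> space M. c * \<delta> < (\<Sum>j<n. (\<eta> j \<omega>)\<^sup>2 * (c * d j))} = P1"
    unfolding P1_def sum_c using \<open>0 < c\<close> by simp
  finally have P2_le: "prob P2 \<le> prob P1 + 4 * c * \<delta> / \<epsilon>\<^sup>2"
    by (simp add: power_divide mult_ac)
  have "\<omega> \<in> P1 \<union> P2" if \<omega>: "\<omega> \<in> space M" "\<epsilon> < \<bar>\<Sum>j<n. \<eta> j \<omega> * U j \<omega>\<bar>" for \<omega>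
  proof (rule ccontr)
    assume "\<omega> \<notin> P1 \<union> P2"
    then have Q: "(\<Sum>j<n. (\<eta> j \<omega>)\<^sup>2 * d j) \<le> \<delta>" and V: "\<bar>\<Sum>j<n. \<eta> j \<omega> * V j \<omega>\<bar> \<le> \<epsilon> / 2"
      using \<omega>(1) by (auto simp: P1_def P2_def not_less)
    have "\<bar>\<Sum>j<n. \<eta> j \<omega> * expectation (U j)\<bar> \<le> (\<Sum>j<n. \<bar>\<eta> j \<omega>\<bar> * (c * d j))"
      using U(4) by (intro order_trans[OF sum_abs] sum_mono) (auto simp: abs_mult intro!: mult_left_mono)
    \<comment> \<open>Splitting \<open>d j\<close> into two square roots prepares Cauchy-Schwarz:
      one factor yields the quadratic sum of \<eta>, the other the total length.\<close>
    also have "\<dots> = c * (\<Sum>j<n. (\<bar>\<eta> j \<omega>\<bar> * sqrt (d j)) * sqrt (d j))"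
      unfolding sum_distrib_left using d by (intro sum.cong) (auto simp: mult_ac less_imp_le)
    also have "(\<Sum>j<n. (\<bar>\<eta> j \<omega>\<bar> * sqrt (d j)) * sqrt (d j)) \<le>
        sqrt ((\<Sum>j<n. (\<bar>\<eta> j \<omega>\<bar> * sqrt (d j))\<^sup>2) * (\<Sum>j<n. (sqrt (d j))\<^sup>2))"
      by (intro real_le_rsqrt Cauchy_Schwarz_ineq_sum)
    also have "(\<Sum>j<n. (\<bar>\<eta> j \<omega>\<bar> * sqrt (d j))\<^sup>2) = (\<Sum>j<n. (\<eta> j \<omega>)\<^sup>2 * d j)"
      using d by (intro sum.cong) (auto simp: power_mult_distrib less_imp_le)
    also have "(\<Sum>j<n. (sqrt (d j))\<^sup>2) = (\<Sum>j<n. d j)"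
      using d by (intro sum.cong) (auto simp: less_imp_le)
    also have "sqrt ((\<Sum>j<n. (\<eta> j \<omega>)\<^sup>2 * d j) * (\<Sum>j<n. d j)) \<le> sqrt (\<delta> * (\<Sum>j<n. d j))"
      using Q d by (intro real_sqrt_le_mono mult_right_mono sum_nonneg) (auto simp: less_imp_le)
    finally have "\<bar>\<Sum>j<n. \<eta> j \<omega> * expectation (U j)\<bar> \<le> \<epsilon> / 2"
      using \<open>0 < c\<close> small by (simp add: mult_left_mono)
    moreover have "(\<Sum>j<n. \<eta> j \<omega> * U j \<omega>) = (\<Sum>j<n. \<eta> j \<omega> * V j \<omega>) + (\<Sum>j<n. \<eta> j \<omega> * expectation (U j))"
      by (simp add: V_def algebra_simps flip: sum.distrib)
    ultimately show False
      using V \<omega>(2) by linarith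
  qed
  then have "\<P>(\<omega> in M. \<epsilon> < \<bar>\<Sum>j<n. \<eta> j \<omega> * U j \<omega>\<bar>) \<le> prob (P1 \<union> P2)"
    using P1 P2 by (intro finite_measure_mono) auto
  also have "\<dots> \<le> prob P1 + prob P2"
    using P1 P2 by (rule measure_Un_le)
  finally show ?thesis
    using P2_le by (simp add: P1_def)
qed

section \<open>Gaussian moments\<close>

text \<open>Completing the square: an exponential factor shifts the mean of a Gaussian density and
  leaves a constant. This tilt yields both the moments of the noise and the asset term of the call
  price.\<close>

lemma normal_density_mult_exp:
  assumes "0 < s"
  shows "normal_density 0 s x * exp (a * x) = exp (a\<^sup>2 * s\<^sup>2 / 2) * normal_density (a * s\<^sup>2) s x"
proof -
  have "- (x - 0)\<^sup>2 / (2 * s\<^sup>2) + a * x = a\<^sup>2 * s\<^sup>2 / 2 + - (x - a * s\<^sup>2)\<^sup>2 / (2 * s\<^sup>2)"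
    using assms by (simp add: field_simps power2_eq_square)
  then have "exp (- (x - 0)\<^sup>2 / (2 * s\<^sup>2)) * exp (a * x) =
      exp (a\<^sup>2 * s\<^sup>2 / 2) * exp (- (x - a * s\<^sup>2)\<^sup>2 / (2 * s\<^sup>2))"
    by (simp only: exp_add[symmetric])
  then show ?thesis
    by (simp add: normal_density_def)
qed

text \<open>The quadratic is expanded in powers of \<open>x - m\<close>, whose integrals against the
  density are 1, 0 and \<open>s\<^sup>2\<close>.\<close>

lemma has_bochner_integral_normal_quadratic:
  assumes "0 < s"
  shows "has_bochner_integral lborel (\<lambda>x. normal_density m s x * (c0 + c1 * x + c2 * x\<^sup>2))
    (c0 + c1 * m + c2 * (s\<^sup>2 + m\<^sup>2))"
proof -
  have 0: "has_bochner_integral lborel (\<lambda>x. normal_density m s x) 1"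
    using normal_moment_even[OF assms, of m 0] by simp
  have 1: "has_bochner_integral lborel (\<lambda>x. normal_density m s x * (x - m)) 0"
    using normal_moment_odd[OF assms, of m 0] by simp
  have 2: "has_bochner_integral lborel (\<lambda>x. normal_density m s x * (x - m)\<^sup>2) (s\<^sup>2)"
    using normal_moment_even[OF assms, of m 1] assms by (simp add: power2_eq_square)
  have "has_bochner_integral lborel (\<lambda>x. normal_density m s x * (c0 + c1 * m + c2 * m\<^sup>2) +
      normal_density m s x * (x - m) * (c1 + 2 * c2 * m) + normal_density m s x * (x - m)\<^sup>2 * c2)
      (1 * (c0 + c1 * m + c2 * m\<^sup>2) + 0 * (c1 + 2 * c2 * m) + s\<^sup>2 * c2)"
    by (intro has_bochner_integral_add has_bochner_integral_mult_left 0 1 2)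
  then show ?thesis
    by (rule has_bochner_integral_cong[THEN iffD1, rotated -1])
      (simp_all add: power2_eq_square algebra_simps)
qed

lemma has_bochner_integral_normal_exp_quadratic:
  assumes "0 < s"
  shows "has_bochner_integral lborel (\<lambda>x. normal_density 0 s x * (exp (a * x) * (c0 + c1 * x + c2 * x\<^sup>2)))
    (exp (a\<^sup>2 * s\<^sup>2 / 2) * (c0 + c1 * (a * s\<^sup>2) + c2 * (s\<^sup>2 + (a * s\<^sup>2)\<^sup>2)))"
proof -
  have "normal_density 0 s x * (exp (a * x) * (c0 + c1 * x + c2 * x\<^sup>2)) =
      exp (a\<^sup>2 * s\<^sup>2 / 2) * (normal_density (a * s\<^sup>2) s x * (c0 + c1 * x + c2 * x\<^sup>2))" for x
    using normal_density_mult_exp[OF assms, of x a] by (simp only: mult.assoc[symmetric])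
  then show ?thesis
    by (simp only:) (intro has_bochner_integral_mult_right has_bochner_integral_normal_quadratic[OF assms])
qed

text \<open>Every moment of the one-step noise has this shape, an exponential of the increment times
  a polynomial of degree at most two, and so is available in closed form.\<close>

lemma (in prob_space)
  assumes X: "distributed M lborel X (normal_density 0 s)" and s: "0 < s"
  shows integrable_normal_exp_quadratic:
      "integrable M (\<lambda>\<omega>. exp (a * X \<omega>) * (c0 + c1 * X \<omega> + c2 * (X \<omega>)\<^sup>2))"
    and expectation_normal_exp_quadratic:
      "expectation (\<lambda>\<omega>. exp (a * X \<omega>) * (c0 + c1 * X \<omega> + c2 * (X \<omega>)\<^sup>2)) =
        exp (a\<^sup>2 * s\<^sup>2 / 2) * (c0 + c1 * (a * s\<^sup>2) + c2 * (s\<^sup>2 + (a * s\<^sup>2)\<^sup>2))"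
proof -
  define g where "g x = exp (a * x) * (c0 + c1 * x + c2 * x\<^sup>2)" for x :: real
  have g: "g \<in> borel_measurable lborel"
    unfolding g_def by measurable
  have hbi: "has_bochner_integral lborel (\<lambda>x. normal_density 0 s x * g x)
      (exp (a\<^sup>2 * s\<^sup>2 / 2) * (c0 + c1 * (a * s\<^sup>2) + c2 * (s\<^sup>2 + (a * s\<^sup>2)\<^sup>2)))"
    unfolding g_def by (rule has_bochner_integral_normal_exp_quadratic[OF s])
  have "integrable M (\<lambda>\<omega>. g (X \<omega>))"
    using distributed_integrable[OF X g] hbi by (auto dest: integrable.intros)
  then show "integrable M (\<lambda>\<omega>. exp (a * X \<omega>) * (c0 + c1 * X \<omega> + c2 * (X \<omega>)\<^sup>2))"
    by (simp only: g_def)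
  have "expectation (\<lambda>\<omega>. g (X \<omega>)) = exp (a\<^sup>2 * s\<^sup>2 / 2) * (c0 + c1 * (a * s\<^sup>2) + c2 * (s\<^sup>2 + (a * s\<^sup>2)\<^sup>2))"
    using distributed_integral[OF X g] hbi by (auto dest: has_bochner_integral_integral_eq)
  then show "expectation (\<lambda>\<omega>. exp (a * X \<omega>) * (c0 + c1 * X \<omega> + c2 * (X \<omega>)\<^sup>2)) =
        exp (a\<^sup>2 * s\<^sup>2 / 2) * (c0 + c1 * (a * s\<^sup>2) + c2 * (s\<^sup>2 + (a * s\<^sup>2)\<^sup>2))"
    by (simp only: g_def)
qed

section \<open>Second-order estimates for the exponential function\<close>

lemma exp_le_exp_abs:
  fixes b x :: real
  assumes "0 \<le> x" "x \<le> 1"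
  shows "exp (b * x) \<le> exp \<bar>b\<bar>"
proof -
  have "b * x \<le> \<bar>b\<bar> * 1"
    using mult_left_mono[OF assms(2), of "\<bar>b\<bar>"] mult_right_mono[OF abs_ge_self[of b] assms(1)] by linarith
  then show ?thesis by simp
qed

text \<open>For the upper bound, \<open>1 - y \<le> exp (- y)\<close> multiplied by
  \<open>exp y\<close> gives \<open>exp y - 1 - y \<le> y * (exp y - 1)\<close>; the last factor is
  then estimated separately for each sign of \<open>y\<close>.\<close>

lemma exp_minus_linear_bounds:
  fixes y :: real
  shows "0 \<le> exp y - 1 - y" "exp y - 1 - y \<le> y\<^sup>2 * exp \<bar>y\<bar>"
proof -
  show "0 \<le> exp y - 1 - y"
    using exp_ge_add_one_self[of y] by linarith
  have "exp y * (1 - y) \<le> 1"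
    using mult_left_mono[OF exp_ge_add_one_self[of "-y"], of "exp y"] by (simp add: exp_minus_inverse)
  then have le: "exp y - 1 - y \<le> y * (exp y - 1)"
    by (simp add: algebra_simps)
  show "exp y - 1 - y \<le> y\<^sup>2 * exp \<bar>y\<bar>"
  proof (cases "0 \<le> y")
    case True
    have "exp y - 1 \<le> y * exp y"
      using \<open>exp y * (1 - y) \<le> 1\<close> by (simp add: algebra_simps)
    then have "y * (exp y - 1) \<le> y * (y * exp y)"
      using True by (rule mult_left_mono)
    then show ?thesis
      using le True by (simp add: power2_eq_square)
  next
    case False
    have "y * (exp y - 1) \<le> y * y"
    proof (rule mult_left_mono_neg)
      show "y \<le> exp y - 1"
        using exp_ge_add_one_self[of y] by linarith
    qed (use False in simp)
    also have "\<dots> \<le> y\<^sup>2 * exp \<bar>y\<bar>"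
      by (simp add: power2_eq_square mult_le_cancel_left1)
    finally show ?thesis
      using le by linarith
  qed
qed

text \<open>The linear terms of \<open>exp (- b * x)\<close> and \<open>1 + b * x\<close> cancel,
  and on the unit interval what remains is at most a multiple of x^2.\<close>

lemma exp_times_quadratic_bound:
  fixes b g :: real
  obtains c where "0 < c" "\<And>x. 0 \<le> x \<Longrightarrow> x \<le> 1 \<Longrightarrow> \<bar>exp (- b * x) * (1 + b * x + g * x\<^sup>2) - 1\<bar> \<le> c * x\<^sup>2"
proof
  \<comment> \<open>The summands bound the three terms left after writing
    \<open>exp (- b * x)\<close> as \<open>1 - b * x + R\<close>; the final 1 makes \<open>c\<close>
    positive.\<close>
  define c where "c = b\<^sup>2 + b\<^sup>2 * exp \<bar>b\<bar> * (1 + \<bar>b\<bar>) + \<bar>g\<bar> * exp \<bar>b\<bar> + 1"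
  show "0 < c"
    unfolding c_def by (intro add_nonneg_pos add_nonneg_nonneg mult_nonneg_nonneg) auto
  fix x :: real assume x: "0 \<le> x" "x \<le> 1"
  define R where "R = exp (- b * x) - 1 - (- b * x)"
  have "0 \<le> R"
    using exp_minus_linear_bounds(1)[of "- b * x"] by (simp only: R_def)
  have "R \<le> (- b * x)\<^sup>2 * exp \<bar>- b * x\<bar>"
    using exp_minus_linear_bounds(2)[of "- b * x"] by (simp only: R_def)
  also have "\<dots> \<le> (- b * x)\<^sup>2 * exp \<bar>b\<bar>"
    using x exp_le_exp_abs[of x "\<bar>b\<bar>"] by (intro mult_left_mono) (auto simp: abs_mult)
  finally have R: "R \<le> x\<^sup>2 * (b\<^sup>2 * exp \<bar>b\<bar>)"
    by (simp add: power_mult_distrib mult_ac)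
  have "\<bar>1 + b * x\<bar> \<le> 1 + \<bar>b\<bar>"
    using x mult_left_le[of x "\<bar>b\<bar>"] abs_triangle_ineq[of 1 "b * x"] by (simp add: abs_mult)
  then have "\<bar>R * (1 + b * x)\<bar> \<le> (x\<^sup>2 * (b\<^sup>2 * exp \<bar>b\<bar>)) * (1 + \<bar>b\<bar>)"
    unfolding abs_mult using R \<open>0 \<le> R\<close> by (intro mult_mono) auto
  moreover have "\<bar>g * x\<^sup>2 * exp (- b * x)\<bar> \<le> \<bar>g\<bar> * x\<^sup>2 * exp \<bar>b\<bar>"
    unfolding abs_mult using x exp_le_exp_abs[of x "- b"] by (intro mult_mono) auto
  moreover have "exp (- b * x) * (1 + b * x + g * x\<^sup>2) - 1 =
      - (b\<^sup>2 * x\<^sup>2) + R * (1 + b * x) + g * x\<^sup>2 * exp (- b * x)"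
    by (simp add: R_def algebra_simps power2_eq_square)
  moreover have "\<bar>b\<^sup>2 * x\<^sup>2\<bar> = b\<^sup>2 * x\<^sup>2"
    by simp
  ultimately have "\<bar>exp (- b * x) * (1 + b * x + g * x\<^sup>2) - 1\<bar> \<le>
      b\<^sup>2 * x\<^sup>2 + (x\<^sup>2 * (b\<^sup>2 * exp \<bar>b\<bar>)) * (1 + \<bar>b\<bar>) + \<bar>g\<bar> * x\<^sup>2 * exp \<bar>b\<bar>"
    by linarith
  also have "\<dots> \<le> c * x\<^sup>2"
    by (simp add: c_def algebra_simps)
  finally show "\<bar>exp (- b * x) * (1 + b * x + g * x\<^sup>2) - 1\<bar> \<le> c * x\<^sup>2" .
qed

text \<open>\<open>\<rho> d x\<close> is the factor by which \<open>Z\<close> changes over a step of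
  length \<open>d\<close> with Brownian increment \<open>x\<close>. The weighted Euler factor
  \<open>1 + \<mu> * d + \<sigma> * X\<close> has its first-order deviation from 1 cancelled and
  gets bounds of order d^2; the weighted driving term \<open>\<theta> * d + X\<close> gets bounds of
  order \<open>d\<close>.\<close>

lemma (in prob_space) one_step_noise_bounds:
  fixes \<mu> \<sigma> \<theta> :: real
  defines "\<rho> \<equiv> \<lambda>d x. exp (- (\<mu> - \<sigma>\<^sup>2 / 2) * d - \<sigma> * x)"
  obtains c where "0 < c"
    "\<And>d X. 0 < d \<Longrightarrow> d \<le> 1 \<Longrightarrow> distributed M lborel X (normal_density 0 (sqrt d)) \<Longrightarrow>
      integrable M (\<lambda>\<omega>. (\<rho> d (X \<omega>) * (\<theta> * d + X \<omega>))\<^sup>2) \<and>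
      \<bar>expectation (\<lambda>\<omega>. \<rho> d (X \<omega>) * (\<theta> * d + X \<omega>))\<bar> \<le> c * d \<and>
      expectation (\<lambda>\<omega>. (\<rho> d (X \<omega>) * (\<theta> * d + X \<omega>))\<^sup>2) \<le> c * d"
    "\<And>d X. 0 < d \<Longrightarrow> d \<le> 1 \<Longrightarrow> distributed M lborel X (normal_density 0 (sqrt d)) \<Longrightarrow>
      integrable M (\<lambda>\<omega>. (\<rho> d (X \<omega>) * (1 + \<mu> * d + \<sigma> * X \<omega>) - 1)\<^sup>2) \<and>
      \<bar>expectation (\<lambda>\<omega>. \<rho> d (X \<omega>) * (1 + \<mu> * d + \<sigma> * X \<omega>) - 1)\<bar> \<le> c * d\<^sup>2 \<and>
      expectation (\<lambda>\<omega>. (\<rho> d (X \<omega>) * (1 + \<mu> * d + \<sigma> * X \<omega>) - 1)\<^sup>2) \<le> c * d\<^sup>2"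
proof -
  \<comment> \<open>Weighting by \<rho> shifts the mean of \<open>X\<close> to
    \<open>- \<sigma> * d\<close>, weighting by its square to \<open>- 2 * \<sigma> * d\<close>. The
    expectations of the two weights are \<open>exp (- b1 * d)\<close> and
    \<open>exp (- b2 * d)\<close>. Under the shifted laws the Euler factor has mean
    \<open>1 + b1 * d\<close> and its square has mean \<open>1 + b2 * d + g2 * d\<^sup>2\<close>, so
    the linear terms cancel in both products.\<close>
  define b1 where "b1 = \<mu> - \<sigma>\<^sup>2"
  define b2 where "b2 = 2 * \<mu> - 3 * \<sigma>\<^sup>2"
  define g2 where "g2 = (\<mu> - 2 * \<sigma>\<^sup>2)\<^sup>2"
  obtain c1 where c1: "0 < c1" "\<And>x. 0 \<le> x \<Longrightarrow> x \<le> 1 \<Longrightarrow> \<bar>exp (- b1 * x) * (1 + b1 * x + 0 * x\<^sup>2) - 1\<bar> \<le> c1 * x\<^sup>2"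
    using exp_times_quadratic_bound[of b1 0] by blast
  obtain c2 where c2: "0 < c2" "\<And>x. 0 \<le> x \<Longrightarrow> x \<le> 1 \<Longrightarrow> \<bar>exp (- b2 * x) * (1 + b2 * x + g2 * x\<^sup>2) - 1\<bar> \<le> c2 * x\<^sup>2"
    using exp_times_quadratic_bound[of b2 g2] by blast
  \<comment> \<open>The part \<open>2 * c1 + c2\<close> comes from
    \<open>(y - 1)\<^sup>2 = (y\<^sup>2 - 1) - 2 * (y - 1)\<close>, whose two terms have means of
    order d^2.\<close>
  define c where "c = exp \<bar>b1\<bar> * \<bar>\<theta> - \<sigma>\<bar> + exp \<bar>b2\<bar> * (1 + (\<theta> - 2 * \<sigma>)\<^sup>2) + 2 * c1 + c2"
  show thesis
  proof
    show "0 < c"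
      unfolding c_def using c1(1) c2(1) by (intro add_nonneg_pos add_nonneg_nonneg mult_nonneg_nonneg) auto
    fix d X assume d: "0 < d" "d \<le> 1" and X: "distributed M lborel X (normal_density 0 (sqrt d))"
    let ?U = "\<lambda>\<omega>. \<rho> d (X \<omega>) * (\<theta> * d + X \<omega>)" and ?V = "\<lambda>\<omega>. \<rho> d (X \<omega>) * (1 + \<mu> * d + \<sigma> * X \<omega>) - 1"
    have sd: "0 < sqrt d" and sq: "(sqrt d)\<^sup>2 = d"
      using d by auto
    note int = integrable_normal_exp_quadratic[OF X sd] and ex = expectation_normal_exp_quadratic[OF X sd, unfolded sq]
    have exC: "expectation (\<lambda>\<omega>. k * (exp (a * X \<omega>) * (c0 + c1 * X \<omega> + c2 * (X \<omega>)\<^sup>2))) =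
        (k * exp (a\<^sup>2 * d / 2)) * (c0 + c1 * (a * d) + c2 * (d + (a * d)\<^sup>2))" for k a c0 c1 c2
      unfolding integral_mult_right_zero ex by (simp only: mult.assoc)
    have \<rho>: "\<rho> d x = exp (- (\<mu> - \<sigma>\<^sup>2 / 2) * d) * exp (- \<sigma> * x)" for x
      by (simp add: \<rho>_def flip: exp_add)
    have \<rho>2: "(\<rho> d x)\<^sup>2 = exp (- 2 * (\<mu> - \<sigma>\<^sup>2 / 2) * d) * exp (- 2 * \<sigma> * x)" for x
      unfolding \<rho> power_mult_distrib exp_double[symmetric] by (simp add: mult_ac)
    have e1: "exp (- (\<mu> - \<sigma>\<^sup>2 / 2) * d) * exp ((- \<sigma>)\<^sup>2 * d / 2) = exp (- b1 * d)"
      by (simp add: b1_def algebra_simps flip: exp_add)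
    have e2: "exp (- 2 * (\<mu> - \<sigma>\<^sup>2 / 2) * d) * exp ((- 2 * \<sigma>)\<^sup>2 * d / 2) = exp (- b2 * d)"
      by (simp add: b2_def algebra_simps power2_eq_square flip: exp_add)
    have U: "\<rho> d x * (\<theta> * d + x) = exp (- (\<mu> - \<sigma>\<^sup>2 / 2) * d) * (exp (- \<sigma> * x) * (\<theta> * d + 1 * x + 0 * x\<^sup>2))" for x
      unfolding \<rho> by (simp add: mult_ac)
    have U2: "(\<rho> d x * (\<theta> * d + x))\<^sup>2 = exp (- 2 * (\<mu> - \<sigma>\<^sup>2 / 2) * d) *
        (exp (- 2 * \<sigma> * x) * ((\<theta> * d)\<^sup>2 + (2 * \<theta> * d) * x + 1 * x\<^sup>2))" for x
      unfolding power_mult_distrib[of "\<rho> d x"] \<rho>2 by (simp add: power2_sum mult.assoc)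
    have V: "\<rho> d x * (1 + \<mu> * d + \<sigma> * x) = exp (- (\<mu> - \<sigma>\<^sup>2 / 2) * d) *
        (exp (- \<sigma> * x) * ((1 + \<mu> * d) + \<sigma> * x + 0 * x\<^sup>2))" for x
      unfolding \<rho> by (simp add: mult_ac)
    have V2: "(\<rho> d x * (1 + \<mu> * d + \<sigma> * x))\<^sup>2 = exp (- 2 * (\<mu> - \<sigma>\<^sup>2 / 2) * d) *
        (exp (- 2 * \<sigma> * x) * ((1 + \<mu> * d)\<^sup>2 + (2 * (1 + \<mu> * d) * \<sigma>) * x + \<sigma>\<^sup>2 * x\<^sup>2))" for x
      unfolding power_mult_distrib[of "\<rho> d x"] \<rho>2
      by (simp add: power2_sum[of "1 + \<mu> * d"] power_mult_distrib mult.assoc)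
    have EU: "expectation (\<lambda>\<omega>. ?U \<omega>) = exp (- b1 * d) * ((\<theta> - \<sigma>) * d)"
      unfolding U exC e1 by (simp add: algebra_simps)
    have EU2: "expectation (\<lambda>\<omega>. (?U \<omega>)\<^sup>2) = exp (- b2 * d) * ((1 + (\<theta> - 2 * \<sigma>)\<^sup>2 * d) * d)"
      unfolding U2 exC e2 by
        (simp add: algebra_simps power2_eq_square)
    have EV: "expectation (\<lambda>\<omega>. \<rho> d (X \<omega>) * (1 + \<mu> * d + \<sigma> * X \<omega>)) = exp (- b1 * d) * (1 + b1 * d + 0 * d\<^sup>2)"
      unfolding V exC e1 by
        (simp add: b1_def algebra_simps power2_eq_square)
    have EV2: "expectation (\<lambda>\<omega>. (\<rho> d (X \<omega>) * (1 + \<mu> * d + \<sigma> * X \<omega>))\<^sup>2) = exp (- b2 * d) * (1 + b2 * d + g2 * d\<^sup>2)"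
      unfolding V2 exC e2 by
        (simp add: b2_def g2_def algebra_simps power2_eq_square)
    have iU2: "integrable M (\<lambda>\<omega>. (?U \<omega>)\<^sup>2)"
      unfolding U2 by (intro integrable_mult_right int)
    have iV: "integrable M (\<lambda>\<omega>. \<rho> d (X \<omega>) * (1 + \<mu> * d + \<sigma> * X \<omega>))"
      unfolding V by (intro integrable_mult_right int)
    have iV2: "integrable M (\<lambda>\<omega>. (\<rho> d (X \<omega>) * (1 + \<mu> * d + \<sigma> * X \<omega>))\<^sup>2)"
      unfolding V2 by (intro integrable_mult_right int)
    have exp1: "exp (- b1 * d) \<le> exp \<bar>b1\<bar>" and exp2: "exp (- b2 * d) \<le> exp \<bar>b2\<bar>"
      using exp_le_exp_abs[of d "- b1"] exp_le_exp_abs[of d "- b2"] d by auto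
    have cA: "exp \<bar>b1\<bar> * \<bar>\<theta> - \<sigma>\<bar> \<le> c" and cB: "exp \<bar>b2\<bar> * (1 + (\<theta> - 2 * \<sigma>)\<^sup>2) \<le> c"
      and cC: "c1 \<le> c" and cD: "2 * c1 + c2 \<le> c"
      using c1(1) c2(1) by (simp_all add: c_def add_nonneg_nonneg)
    have "\<bar>exp (- b1 * d) * ((\<theta> - \<sigma>) * d)\<bar> \<le> (exp \<bar>b1\<bar> * \<bar>\<theta> - \<sigma>\<bar>) * d"
      using mult_right_mono[OF exp1, of "\<bar>\<theta> - \<sigma>\<bar> * d"] d by (simp add: abs_mult mult.assoc)
    also have "\<dots> \<le> c * d"
      using cA d by (intro mult_right_mono) auto
    finally have 1: "\<bar>expectation (\<lambda>\<omega>. ?U \<omega>)\<bar> \<le> c * d"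
      unfolding EU .
    have "exp (- b2 * d) * ((1 + (\<theta> - 2 * \<sigma>)\<^sup>2 * d) * d) \<le> exp \<bar>b2\<bar> * ((1 + (\<theta> - 2 * \<sigma>)\<^sup>2 * 1) * d)"
      using exp2 d by (intro mult_mono mult_right_mono add_left_mono mult_left_mono) auto
    also have "\<dots> \<le> c * d"
      using mult_right_mono[OF cB, of d] d by (simp add: mult.assoc)
    finally have 2: "expectation (\<lambda>\<omega>. (?U \<omega>)\<^sup>2) \<le> c * d"
      unfolding EU2 .
    show "integrable M (\<lambda>\<omega>. (?U \<omega>)\<^sup>2) \<and>
      \<bar>expectation (\<lambda>\<omega>. ?U \<omega>)\<bar> \<le> c * d \<and>
      expectation (\<lambda>\<omega>. (?U \<omega>)\<^sup>2) \<le> c * d"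
      using iU2 1 2 by blast
    have eq: "(y - 1)\<^sup>2 = y\<^sup>2 - 2 * y + 1" for y :: real
      by (simp add: power2_eq_square algebra_simps)
    have iW: "integrable M (\<lambda>\<omega>. (?V \<omega>)\<^sup>2)"
      unfolding eq using iV iV2 by simp
    have A1: "\<bar>exp (- b1 * d) * (1 + b1 * d + 0 * d\<^sup>2) - 1\<bar> \<le> c1 * d\<^sup>2"
      and A2: "\<bar>exp (- b2 * d) * (1 + b2 * d + g2 * d\<^sup>2) - 1\<bar> \<le> c2 * d\<^sup>2"
      using c1(2)[of d] c2(2)[of d] d by auto
    have EW: "expectation (\<lambda>\<omega>. ?V \<omega>) =
        exp (- b1 * d) * (1 + b1 * d + 0 * d\<^sup>2) - 1"
      unfolding EV[symmetric] using iV by (simp add: prob_space)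
    have EW2: "expectation (\<lambda>\<omega>. (?V \<omega>)\<^sup>2) =
        (exp (- b2 * d) * (1 + b2 * d + g2 * d\<^sup>2) - 1) - 2 * (exp (- b1 * d) * (1 + b1 * d + 0 * d\<^sup>2) - 1)"
      unfolding EV[symmetric] EV2[symmetric] eq using iV iV2 by (simp add: prob_space)
    have le: "y - 2 * x \<le> 2 * p + q" if "\<bar>x\<bar> \<le> p" "\<bar>y\<bar> \<le> q" for x y p q :: real
      using that by linarith
    have "expectation (\<lambda>\<omega>. (?V \<omega>)\<^sup>2) \<le> (2 * c1 + c2) * d\<^sup>2"
      using le[OF A1 A2] unfolding EW2 by (simp add: algebra_simps)
    then have "expectation (\<lambda>\<omega>. (?V \<omega>)\<^sup>2) \<le> c * d\<^sup>2"
      using mult_right_mono[OF cD, of "d\<^sup>2"] by simp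
    moreover have "\<bar>expectation (\<lambda>\<omega>. ?V \<omega>)\<bar> \<le> c * d\<^sup>2"
      unfolding EW using A1 mult_right_mono[OF cC, of "d\<^sup>2"] by simp
    ultimately show "integrable M (\<lambda>\<omega>. (?V \<omega>)\<^sup>2) \<and>
      \<bar>expectation (\<lambda>\<omega>. ?V \<omega>)\<bar> \<le> c * d\<^sup>2 \<and>
      expectation (\<lambda>\<omega>. (?V \<omega>)\<^sup>2) \<le> c * d\<^sup>2"
      using iW by blast
  qed
qed

section \<open>Partitions and paths\<close>

text \<open>A continuous path on a compact interval is bounded and uniformly continuous, so the
  events \<open>E N\<close> increase to almost the whole space. They are expressed through rational
  times to be measurable. Outside a small event this makes the bound and the modulus of continuity
  deterministic, with a single integer for both.\<close>

lemma (in prob_space) continuous_paths_uniform: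
  fixes X :: "real \<Rightarrow> 'a \<Rightarrow> real"
  assumes X: "\<And>s. 0 \<le> s \<Longrightarrow> s \<le> u \<Longrightarrow> X s \<in> borel_measurable M"
    and cont: "AE \<omega> in M. continuous_on {0..u} (\<lambda>s. X s \<omega>)"
    and "0 < \<epsilon>" "0 < \<eta>"
  obtains A and N :: nat where "A \<in> events" "prob (space M - A) \<le> \<eta>"
    "\<And>\<omega> s. \<omega> \<in> A \<Longrightarrow> s \<in> {0..u} \<Longrightarrow> \<bar>X s \<omega>\<bar> \<le> N"
    "\<And>\<omega> s s'. \<omega> \<in> A \<Longrightarrow> s \<in> {0..u} \<Longrightarrow> s' \<in> {0..u} \<Longrightarrow> \<bar>s - s'\<bar> < 1 / Suc N \<Longrightarrow> \<bar>X s \<omega> - X s' \<omega>\<bar> \<le> \<epsilon>"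
proof -
  define D where "D = \<rat> \<inter> {0..u}"
  have D: "countable D"
    unfolding D_def using countable_rat by blast
  define E where "E N = {\<omega> \<in> space M. \<forall>q\<in>D. \<bar>X q \<omega>\<bar> \<le> real N \<and>
    (\<forall>q'\<in>D. \<bar>q - q'\<bar> < 1 / Suc N \<longrightarrow> \<bar>X q \<omega> - X q' \<omega>\<bar> \<le> \<epsilon>)}" for N
  have XD: "X q \<in> borel_measurable M" if "q \<in> D" for q
    using that by (intro X) (auto simp: D_def)
  have E: "E N \<in> events" for N
  proof -
    have 1: "{\<omega> \<in> space M. \<bar>q - q'\<bar> < 1 / Suc N \<longrightarrow> \<bar>X q \<omega> - X q' \<omega>\<bar> \<le> \<epsilon>} \<in> events" if "q \<in> D" "q' \<in> D" for q q'
      using XD[OF that(1)] XD[OF that(2)] by measurable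
    have 2: "{\<omega> \<in> space M. \<bar>X q \<omega>\<bar> \<le> real N} \<in> events" if "q \<in> D" for q
      using XD[OF that] by measurable
    show ?thesis
      unfolding E_def
    proof (rule sets.sets_Collect_countable_All'[OF _ D])
      fix q assume q: "q \<in> D"
      have "{\<omega> \<in> space M. \<forall>q'\<in>D. \<bar>q - q'\<bar> < 1 / Suc N \<longrightarrow> \<bar>X q \<omega> - X q' \<omega>\<bar> \<le> \<epsilon>} \<in> events"
        by (rule sets.sets_Collect_countable_All'[OF _ D]) (rule 1[OF q])
      then show "{\<omega> \<in> space M. \<bar>X q \<omega>\<bar> \<le> real N \<and>
          (\<forall>q'\<in>D. \<bar>q - q'\<bar> < 1 / Suc N \<longrightarrow> \<bar>X q \<omega> - X q' \<omega>\<bar> \<le> \<epsilon>)} \<in> events"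
        using 2[OF q] by (rule sets.sets_Collect_conj)
    qed
  qed
  have inc: "incseq E"
  proof (rule incseq_SucI, rule subsetI)
    fix N \<omega> assume \<omega>: "\<omega> \<in> E N"
    have le: "1 / real (Suc (Suc N)) \<le> 1 / real (Suc N)"
      by (simp add: frac_le)
    show "\<omega> \<in> E (Suc N)"
      unfolding E_def
    proof (intro CollectI conjI ballI impI)
      show "\<omega> \<in> space M"
        using \<omega> by (simp add: E_def)
      fix q assume q: "q \<in> D"
      then have "\<bar>X q \<omega>\<bar> \<le> real N"
        using \<omega> by (simp add: E_def)
      then show "\<bar>X q \<omega>\<bar> \<le> real (Suc N)"
        by simp
      fix q' assume q': "q' \<in> D" and "\<bar>q - q'\<bar> < 1 / real (Suc (Suc N))"
      then have "\<bar>q - q'\<bar> < 1 / real (Suc N)"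
        using le by linarith
      then show "\<bar>X q \<omega> - X q' \<omega>\<bar> \<le> \<epsilon>"
        using \<omega> q q' by (simp add: E_def)
    qed
  qed
  obtain N0 where N0: "N0 \<in> null_sets M" "{\<omega> \<in> space M. \<not> continuous_on {0..u} (\<lambda>s. X s \<omega>)} \<subseteq> N0"
    using cont by (auto elim!: AE_E simp: null_sets_def)
  have cover: "space M - N0 \<subseteq> (\<Union>N. E N)"
  proof
    fix \<omega> assume \<omega>: "\<omega> \<in> space M - N0"
    then have c: "continuous_on {0..u} (\<lambda>s. X s \<omega>)"
      using N0 by blast
    then have "compact ((\<lambda>s. X s \<omega>) ` {0..u})"
      by (rule compact_continuous_image) simp
    then obtain b where b: "\<And>s. s \<in> {0..u} \<Longrightarrow> \<bar>X s \<omega>\<bar> \<le> b"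
      using compact_imp_bounded[THEN bounded_iff[THEN iffD1]] by (metis imageI real_norm_def)
    have "uniformly_continuous_on {0..u} (\<lambda>s. X s \<omega>)"
      by (rule compact_uniformly_continuous[OF c]) simp
    then obtain d where d: "0 < d" "\<And>s s'. s \<in> {0..u} \<Longrightarrow> s' \<in> {0..u} \<Longrightarrow> dist s' s < d \<Longrightarrow> dist (X s' \<omega>) (X s \<omega>) < \<epsilon>"
      unfolding uniformly_continuous_on_def using \<open>0 < \<epsilon>\<close> by meson
    obtain n1 :: nat where n1: "b \<le> n1"
      using real_arch_simple by blast
    obtain n2 :: nat where n2: "1 / Suc n2 < d"
      using d(1) reals_Archimedean[of d] by (auto simp: inverse_eq_divide)
    define N where "N = max n1 n2"
    have N: "b \<le> N" "1 / Suc N < d"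
    proof -
      show "b \<le> N" using n1 by (simp add: N_def)
      have "1 / real (Suc N) \<le> 1 / real (Suc n2)"
        by (intro divide_left_mono) (auto simp: N_def)
      then show "1 / Suc N < d" using n2 by linarith
    qed
    have "\<omega> \<in> E N"
      unfolding E_def
    proof (intro CollectI conjI ballI impI)
      fix q assume q: "q \<in> D"
      then show "\<bar>X q \<omega>\<bar> \<le> real N"
        using b[of q] N(1) by (auto simp: D_def)
      fix q' assume q': "q' \<in> D" "\<bar>q - q'\<bar> < 1 / real (Suc N)"
      then show "\<bar>X q \<omega> - X q' \<omega>\<bar> \<le> \<epsilon>"
        using d(2)[of q' q] q N(2) by (auto simp: D_def dist_real_def)
    qed (use \<omega> in simp)
    then show "\<omega> \<in> (\<Union>N. E N)"
      by blast
  qed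
  have "prob (\<Union>N. E N) = 1"
  proof -
    have "prob (space M - N0) = 1"
      using N0(1) by (simp add: prob_compl null_setsD2 measure_eq_0_null_sets)
    moreover have "prob (space M - N0) \<le> prob (\<Union>N. E N)"
      using cover E by (intro finite_measure_mono) auto
    ultimately show ?thesis
      using prob_le_1[of "\<Union>N. E N"] by linarith
  qed
  then have "(\<lambda>N. prob (E N)) \<longlonglongrightarrow> 1"
    using finite_Lim_measure_incseq[of E] E inc by auto
  then have "eventually (\<lambda>N. 1 - \<eta> < prob (E N)) sequentially"
    using \<open>0 < \<eta>\<close> by (intro order_tendstoD) auto
  then obtain N where N: "1 - \<eta> < prob (E N)"
    by (auto simp: eventually_sequentially)
  \<comment> \<open>\<open>E N\<close> speaks of rational times only. Removing the null set that
    contains all discontinuous paths lets its bounds extend to every time.\<close>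
  define A where "A = E N - N0"
  have A: "A \<in> events"
    using E N0(1) by (auto simp: A_def)
  have dense: "\<exists>q. (\<forall>k. q k \<in> D) \<and> q \<longlonglongrightarrow> s" if s: "s \<in> {0..u}" for s
  proof (intro exI conjI allI)
    \<comment> \<open>Rounding down keeps the rational approximations inside the interval even if
      \<open>u\<close> is irrational and \<open>s = u\<close>.\<close>
    define q where "q k = real_of_int \<lfloor>s * real (Suc k)\<rfloor> / real (Suc k)" for k
    have le: "q k \<le> s" for k
      unfolding q_def by (simp add: divide_le_eq del: of_nat_Suc)
    have ge: "s - 1 / real (Suc k) \<le> q k" for k
    proof -
      have "s * real (Suc k) - 1 \<le> real_of_int \<lfloor>s * real (Suc k)\<rfloor>"
        by linarith
      then have "(s * real (Suc k) - 1) / real (Suc k) \<le> q k"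
        unfolding q_def by (intro divide_right_mono) auto
      then show ?thesis
        by (simp add: diff_divide_distrib del: of_nat_Suc)
    qed
    have "0 \<le> q k" for k
      using s by (simp add: q_def)
    then show "q k \<in> D" for k
      using le[of k] s by (auto simp: D_def q_def intro!: Rats_divide order_trans[OF le])
    show "q \<longlonglongrightarrow> s"
    proof (rule real_tendsto_sandwich)
      show "(\<lambda>k. s - 1 / real (Suc k)) \<longlonglongrightarrow> s"
        using tendsto_diff[OF tendsto_const LIMSEQ_inverse_real_of_nat, of s] by (simp add: inverse_eq_divide)
      show "eventually (\<lambda>k. s - 1 / real (Suc k) \<le> q k) sequentially"
        using ge by (intro always_eventually allI)
      show "eventually (\<lambda>k. q k \<le> s) sequentially"
        using le by (intro always_eventually allI)
    qed simp
  qed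
  have contA: "(\<lambda>k. X (q k) \<omega>) \<longlonglongrightarrow> X s \<omega>"
    if "\<omega> \<in> A" "s \<in> {0..u}" "\<forall>k. q k \<in> D" "q \<longlonglongrightarrow> s" for \<omega> s q
  proof -
    have "continuous_on {0..u} (\<lambda>s. X s \<omega>)"
      using that(1) N0(2) by (auto simp: A_def E_def)
    moreover have "\<forall>k. q k \<in> {0..u}"
      using that(3) by (simp add: D_def)
    ultimately show ?thesis
      using that(2,4) by (auto elim!: continuous_on_tendsto_compose)
  qed
  show thesis
  proof (rule that[of A N])
    show "A \<in> events" by (rule A)
    have "prob A = prob (E N)"
      unfolding A_def using N0(1) E by (intro measure_Diff_null_set)
    then show "prob (space M - A) \<le> \<eta>"
      using N A by (simp add: prob_compl)
  next
    fix \<omega> s assume \<omega>: "\<omega> \<in> A" "s \<in> {0..u}"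
    obtain q where q: "\<forall>k. q k \<in> D" "q \<longlonglongrightarrow> s"
      using dense \<omega>(2) by blast
    show "\<bar>X s \<omega>\<bar> \<le> N"
    proof (rule LIMSEQ_le_const2)
      show "(\<lambda>k. \<bar>X (q k) \<omega>\<bar>) \<longlonglongrightarrow> \<bar>X s \<omega>\<bar>"
        by (intro tendsto_rabs contA \<omega> q)
      show "\<exists>n. \<forall>k\<ge>n. \<bar>X (q k) \<omega>\<bar> \<le> N"
        using \<omega>(1) q(1) by (auto simp: A_def E_def)
    qed
  next
    fix \<omega> s s' assume \<omega>: "\<omega> \<in> A" "s \<in> {0..u}" "s' \<in> {0..u}" "\<bar>s - s'\<bar> < 1 / Suc N"
    obtain q q' where q: "\<forall>k. q k \<in> D" "q \<longlonglongrightarrow> s" and q': "\<forall>k. q' k \<in> D" "q' \<longlonglongrightarrow> s'"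
      using dense \<omega>(2,3) by meson
    have "(\<lambda>k. \<bar>q k - q' k\<bar>) \<longlonglongrightarrow> \<bar>s - s'\<bar>"
      by (intro tendsto_rabs tendsto_diff q q')
    then have ev: "eventually (\<lambda>k. \<bar>q k - q' k\<bar> < 1 / Suc N) sequentially"
      using \<omega>(4) by (rule order_tendstoD)
    show "\<bar>X s \<omega> - X s' \<omega>\<bar> \<le> \<epsilon>"
    proof (rule tendsto_upperbound)
      show "(\<lambda>k. \<bar>X (q k) \<omega> - X (q' k) \<omega>\<bar>) \<longlonglongrightarrow> \<bar>X s \<omega> - X s' \<omega>\<bar>"
        by (intro tendsto_rabs tendsto_diff contA \<omega> q q')
      show "eventually (\<lambda>k. \<bar>X (q k) \<omega> - X (q' k) \<omega>\<bar> \<le> \<epsilon>) sequentially"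
        using ev by eventually_elim (use \<omega>(1) q(1) q'(1) in \<open>auto simp: A_def E_def\<close>)
    qed simp
  qed
qed

section \<open>Refinements of partitions, and simple integrands on them\<close>

text \<open>No point of \<open>ts\<close> lies strictly inside a cell of \<open>p\<close>. Compared
  with inclusion of the point sets, this leaves room for points of \<open>ts\<close> beyond
  \<open>p m\<close>.\<close>

definition refines :: "nat \<Rightarrow> (nat \<Rightarrow> real) \<Rightarrow> nat \<Rightarrow> (nat \<Rightarrow> real) \<Rightarrow> bool" where
  "refines m p n ts \<longleftrightarrow> p 0 = 0 \<and> (\<forall>i<m. p i < p (Suc i)) \<and>
    (\<forall>i<m. \<forall>a\<le>n. ts a \<le> p i \<or> p (Suc i) \<le> ts a)"

lemma refines_mono: "refines m p n ts \<Longrightarrow> i \<le> j \<Longrightarrow> j \<le> m \<Longrightarrow> p i \<le> p j"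
proof (induction j)
  case (Suc j)
  then show ?case
    by (cases "i = Suc j") (auto simp: refines_def less_eq_Suc_le intro: order_trans less_imp_le)
qed simp

lemma refines_nonneg: "refines m p n ts \<Longrightarrow> i \<le> m \<Longrightarrow> 0 \<le> p i"
  using refines_mono[of m p n ts 0 i] by (simp add: refines_def)

lemma exists_refinement:
  assumes "finite P" "P \<subseteq> {0..u}" "0 \<le> u"
  obtains m p where "refines m p n ts" "refines m p n' ts'" "p m = u" "P \<subseteq> p ` {..m}"
proof -
  \<comment> \<open>Points of \<open>ts\<close> and \<open>ts'\<close> above \<open>u\<close> or
    below 0 are left out; no cell reaches them, so they cannot cut one.\<close>
  define Q where "Q = P \<union> {0, u} \<union> {s. s \<in> ts ` {..n} \<union> ts' ` {..n'} \<and> 0 \<le> s \<and> s \<le> u}"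
  have Q: "finite Q" "Q \<noteq> {}" "Q \<subseteq> {0..u}" "0 \<in> Q" "u \<in> Q"
    using assms by (auto simp: Q_def)
  have "Min Q = 0" "Max Q = u"
    using Q by (intro Min_eqI Max_eqI; force)+
  then obtain m p where p: "p ` {..m} = Q" "p 0 = 0" "p m = u" "\<And>i. i < m \<Longrightarrow> p i < p (Suc i)"
    using finite_set_as_partition[OF Q(1,2)] by metis
  have mono: "p i \<le> p j" if "i \<le> j" "j \<le> m" for i j
    using that
  proof (induction j)
    case (Suc j)
    then show ?case
      using p(4)[of j] by (cases "i = Suc j") auto
  qed simp
  have gap: "s \<le> p i \<or> p (Suc i) \<le> s" if "i < m" "s \<in> ts ` {..n} \<union> ts' ` {..n'}" for i s
  proof (rule ccontr)
    assume "\<not> (s \<le> p i \<or> p (Suc i) \<le> s)"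
    then have s: "p i < s" "s < p (Suc i)" by auto
    have "0 \<le> p i" "p (Suc i) \<le> u"
      using mono[of 0 i] mono[of "Suc i" m] that(1) p(2,3) by auto
    then have "s \<in> Q"
      using s that(2) by (auto simp: Q_def)
    then obtain j where "j \<le> m" "s = p j"
      using p(1) by (metis atMost_iff imageE)
    then show False
      using s mono[of j i] mono[of "Suc i" j] that(1) by (cases "j \<le> i") auto
  qed
  show thesis
  proof (rule that[of m p])
    show "refines m p n ts" "refines m p n' ts'"
      unfolding refines_def using p(2,4) gap by blast+
    show "P \<subseteq> p ` {..m}"
      unfolding p(1) by (auto simp: Q_def)
  qed (rule p(3))
qed

text \<open>Cells and intervals of the process are both open on the left and closed on the right, so
  a cell is represented by its right end point and not by its left one.\<close>

lemma refines_simple_process: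
  assumes "refines m p n ts" "i < m" "s \<in> {p i<..p (Suc i)}"
  shows "simple_process n ts \<xi> s \<omega> = simple_process n ts \<xi> (p (Suc i)) \<omega>"
  unfolding simple_process_def
proof (rule sum.cong)
  fix a assume "a \<in> {..<n}"
  then have "ts a \<le> p i \<or> p (Suc i) \<le> ts a" "ts (Suc a) \<le> p i \<or> p (Suc i) \<le> ts (Suc a)"
    using assms(1,2) unfolding refines_def by auto
  then have "s \<in> {ts a<..ts (Suc a)} \<longleftrightarrow> p (Suc i) \<in> {ts a<..ts (Suc a)}"
    using assms(3) by auto
  then show "\<xi> a \<omega> * indicator {ts a<..ts (Suc a)} s = \<xi> a \<omega> * indicator {ts a<..ts (Suc a)} (p (Suc i))"
    by (simp only: indicator_def)
qed simp

lemma simple_integrand_nonneg: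
  assumes "simple_integrand M F n ts \<xi>" "a \<le> n"
  shows "0 \<le> ts a"
  using assms(2)
proof (induction a)
  case (Suc a)
  then show ?case
    using assms(1) unfolding simple_integrand_def by (meson Suc_le_eq less_imp_le order_trans Suc_leD)
qed (use assms in \<open>simp add: simple_integrand_def\<close>)

text \<open>Each interval of the integrand contains a given cell or misses it. Hence passing from
  \<open>p i\<close> to \<open>p (Suc i)\<close> adds a single increment of \<open>B\<close>,
  multiplied by the value of the process on the cell.\<close>

lemma refines_simple_integral:
  assumes simple: "simple_integrand M F n ts \<xi>" and ref: "refines m p n ts" and "i \<le> m"
  shows "simple_integral B n ts \<xi> (p i) \<omega> =
    (\<Sum>j<i. simple_process n ts \<xi> (p (Suc j)) \<omega> * (B (p (Suc j)) \<omega> - B (p j) \<omega>))"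
  using \<open>i \<le> m\<close>
proof (induction i)
  case 0
  have "p 0 = 0"
    using ref by (simp add: refines_def)
  then show ?case
    using simple_integrand_nonneg[OF simple] by (simp add: simple_integral_def min_absorb2)
next
  case (Suc i)
  have lt: "p i < p (Suc i)"
    using ref Suc.prems by (simp add: refines_def)
  have "\<xi> a \<omega> * (B (min (ts (Suc a)) (p (Suc i))) \<omega> - B (min (ts a) (p (Suc i))) \<omega>) =
      \<xi> a \<omega> * (B (min (ts (Suc a)) (p i)) \<omega> - B (min (ts a) (p i)) \<omega>) +
      \<xi> a \<omega> * indicator {ts a<..ts (Suc a)} (p (Suc i)) * (B (p (Suc i)) \<omega> - B (p i) \<omega>)" if "a < n" for a
  proof -
    have "ts a < ts (Suc a)"
      using simple that by (simp add: simple_integrand_def)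
    moreover have "ts a \<le> p i \<or> p (Suc i) \<le> ts a" "ts (Suc a) \<le> p i \<or> p (Suc i) \<le> ts (Suc a)"
      using ref Suc.prems that unfolding refines_def by auto
    ultimately consider "ts (Suc a) \<le> p i" | "ts a \<le> p i" "p (Suc i) \<le> ts (Suc a)" | "p (Suc i) \<le> ts a" "p (Suc i) \<le> ts (Suc a)"
      by linarith
    then show ?thesis
      using \<open>ts a < ts (Suc a)\<close> lt
      by cases (simp_all add: min_def indicator_def algebra_simps)
  qed
  then have "simple_integral B n ts \<xi> (p (Suc i)) \<omega> = simple_integral B n ts \<xi> (p i) \<omega> +
      simple_process n ts \<xi> (p (Suc i)) \<omega> * (B (p (Suc i)) \<omega> - B (p i) \<omega>)"
    unfolding simple_integral_def simple_process_def sum_distrib_right sum.distrib[symmetric]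
    by (intro sum.cong) auto
  then show ?case
    using Suc by simp
qed

text \<open>The half-open cells cover everything but the point 0, which is a null set and leaves the
  value of \<open>f\<close> there free.\<close>

lemma has_bochner_integral_step_function:
  fixes f :: "real \<Rightarrow> real"
  assumes p: "p 0 = 0" "\<And>i. i < m \<Longrightarrow> p i < p (Suc i)"
    and f: "\<And>i s. i < m \<Longrightarrow> s \<in> {p i<..p (Suc i)} \<Longrightarrow> f s = c i"
  shows "has_bochner_integral lborel (\<lambda>s. indicator {0..p m} s *\<^sub>R f s) (\<Sum>i<m. c i * (p (Suc i) - p i))"
proof -
  have eq: "(\<Sum>i<k. indicator {p i<..p (Suc i)} s *\<^sub>R c i) = indicator {0<..p k} s *\<^sub>R f s \<and> 0 \<le> p k" if "k \<le> m" for k s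
    using that
  proof (induction k)
    case (Suc k)
    then have IH: "(\<Sum>i<k. indicator {p i<..p (Suc i)} s *\<^sub>R c i) = indicator {0<..p k} s *\<^sub>R f s" "0 \<le> p k"
      by auto
    show ?case
      unfolding sum.lessThan_Suc IH(1)
      using IH(2) p(2)[of k] f[of k s] Suc.prems by (auto simp: indicator_def)
  qed (use p in simp)
  have "has_bochner_integral lborel (\<lambda>s. \<Sum>i<m. indicator {p i<..p (Suc i)} s *\<^sub>R c i) (\<Sum>i<m. (p (Suc i) - p i) *\<^sub>R c i)"
  proof (intro has_bochner_integral_sum)
    fix i assume "i \<in> {..<m}"
    then show "has_bochner_integral lborel (\<lambda>s. indicator {p i<..p (Suc i)} s *\<^sub>R c i) ((p (Suc i) - p i) *\<^sub>R c i)"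
      using has_bochner_integral_indicator[of "{p i<..p (Suc i)}" lborel "c i"] p(2)[of i] by simp
  qed
  then have 1: "has_bochner_integral lborel (\<lambda>s. indicator {0<..p m} s *\<^sub>R f s) (\<Sum>i<m. c i * (p (Suc i) - p i))"
    using eq[of m] by (simp add: mult.commute)
  have ae: "AE s in lborel. indicator {0<..p m} s *\<^sub>R f s = indicator {0..p m} s *\<^sub>R f s"
    using AE_lborel_singleton[of 0] by eventually_elim (auto simp: indicator_def)
  have "(\<lambda>s. indicator {0..p m} s *\<^sub>R f s) = (\<lambda>s. indicator {0<..p m} s *\<^sub>R f s + indicator {0} s *\<^sub>R f 0)"
    using eq[of m 0] by (auto simp: indicator_def fun_eq_iff)
  then have "(\<lambda>s. indicator {0..p m} s *\<^sub>R f s) \<in> borel_measurable lborel"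
    using borel_measurable_has_bochner_integral[OF 1] by simp
  then show ?thesis
    using has_bochner_integral_cong_AE[OF borel_measurable_has_bochner_integral[OF 1] _ ae] 1 by blast
qed

context standard_brownian_motion
begin

text \<open>A coefficient \<open>\<xi> a\<close> is active on the cell only if
  \<open>ts a < p (Suc i)\<close>, and since \<open>ts a\<close> does not cut the cell this means
  \<open>ts a \<le> p i\<close>. So the value read at the right end is known at the left
  end.\<close>

lemma refines_simple_measurable:
  assumes simple: "simple_integrand M \<G> n ts \<xi>" and ref: "refines m p n ts" and "i < m"
  shows "simple_process n ts \<xi> (p (Suc i)) \<in> borel_measurable (\<G> (p i))"
proof -
  have "(\<lambda>\<omega>. \<Sum>a<n. \<xi> a \<omega> * indicator {ts a<..ts (Suc a)} (p (Suc i))) \<in> borel_measurable (\<G> (p i))"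
  proof (rule borel_measurable_sum)
    fix a assume "a \<in> {..<n}"
    then have \<xi>: "\<xi> a \<in> borel_measurable (\<G> (ts a))" and "ts a \<le> p i \<or> p (Suc i) \<le> ts a"
      using simple ref \<open>i < m\<close> by (auto simp: simple_integrand_def refines_def)
    then show "(\<lambda>\<omega>. \<xi> a \<omega> * indicator {ts a<..ts (Suc a)} (p (Suc i))) \<in> borel_measurable (\<G> (p i))"
    proof (elim disjE)
      assume "ts a \<le> p i"
      then have "\<xi> a \<in> borel_measurable (\<G> (p i))"
        using \<xi> by (rule measurable_G_mono[rotated])
      then show ?thesis by simp
    qed simp
  qed
  then show ?thesis
    unfolding simple_process_def[abs_def] .
qed

end

section \<open>Approximation of Ito integrals\<close>

lemma simple_process_borel [measurable]: "(\<lambda>s. simple_process n ts \<xi> s \<omega>) \<in> borel_measurable borel"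
  unfolding simple_process_def by measurable

lemma simple_process_bounded: "\<bar>simple_process n ts \<xi> s \<omega>\<bar> \<le> (\<Sum>i<n. \<bar>\<xi> i \<omega>\<bar>)"
  unfolding simple_process_def
  by (intro order_trans[OF sum_abs] sum_mono) (auto simp: indicator_def)

lemma set_integrable_square_diff:
  fixes f g :: "real \<Rightarrow> real"
  assumes f: "f \<in> borel_measurable borel" "\<And>s. \<bar>f s\<bar> \<le> c" and g: "continuous_on {0..u} g"
  shows "set_integrable lborel {0..u} (\<lambda>s. (f s - g s)\<^sup>2)"
proof -
  have "compact (g ` {0..u})"
    using g by (rule compact_continuous_image) simp
  then obtain b where b: "\<And>s. s \<in> {0..u} \<Longrightarrow> \<bar>g s\<bar> \<le> b"
    using compact_imp_bounded[THEN bounded_iff[THEN iffD1]] by (metis imageI real_norm_def)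
  have gm: "(\<lambda>s. indicator {0..u} s *\<^sub>R g s) \<in> borel_measurable borel"
    using g by (intro borel_measurable_continuous_on_indicator) auto
  have eq: "(\<lambda>s. indicator {0..u} s *\<^sub>R (f s - g s)\<^sup>2) =
      (\<lambda>s. (indicator {0..u} s *\<^sub>R f s - indicator {0..u} s *\<^sub>R g s)\<^sup>2)"
    by (auto simp: indicator_def)
  have m: "(\<lambda>s. indicator {0..u} s *\<^sub>R (f s - g s)\<^sup>2) \<in> borel_measurable lborel"
    unfolding eq using f(1) gm by measurable
  have bound: "norm ((f s - g s)\<^sup>2) \<le> (c + b)\<^sup>2" if "s \<in> {0..u}" for s
  proof -
    have "\<bar>f s - g s\<bar> \<le> c + b"
      using f(2)[of s] b[OF that] by linarith
    then have "\<bar>f s - g s\<bar>\<^sup>2 \<le> (c + b)\<^sup>2"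
      by (rule power_mono) simp
    then show ?thesis by simp
  qed
  show ?thesis
    unfolding set_integrable_def
  proof (rule Bochner_Integration.integrable_bound[OF _ m])
    show "integrable lborel (\<lambda>s. indicator {0..u} s *\<^sub>R (c + b)\<^sup>2)"
      by (intro integrable_scaleR_left integrable_real_indicator) (auto simp: emeasure_lborel_Icc_eq)
    show "AE s in lborel. norm (indicator {0..u} s *\<^sub>R (f s - g s)\<^sup>2) \<le> norm (indicator {0..u} s *\<^sub>R (c + b)\<^sup>2)"
      using bound by (intro AE_I2) (simp split: split_indicator)
  qed
qed

context standard_brownian_motion
begin

lemma increment_moments:
  assumes "0 \<le> s" "s < t"
  shows "integrable M (\<lambda>\<omega>. (B t \<omega> - B s \<omega>)\<^sup>2)" "expectation (\<lambda>\<omega>. B t \<omega> - B s \<omega>) = 0"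
    "expectation (\<lambda>\<omega>. (B t \<omega> - B s \<omega>)\<^sup>2) = t - s"
  using integrable_normal_exp_quadratic[OF normal_increments[OF assms], of 0 0 0 1]
    expectation_normal_exp_quadratic[OF normal_increments[OF assms], of 0 0 1 0]
    expectation_normal_exp_quadratic[OF normal_increments[OF assms], of 0 0 0 1] assms
  by simp_all

lemma simple_integral_measurable:
  assumes simple: "simple_integrand M \<G> n ts \<xi>" and "0 \<le> s"
  shows "simple_integral B n ts \<xi> s \<in> borel_measurable M"
proof -
  have "(\<lambda>\<omega>. \<Sum>i<n. \<xi> i \<omega> * (B (min (ts (Suc i)) s) \<omega> - B (min (ts i) s) \<omega>)) \<in> borel_measurable M"
  proof (intro borel_measurable_sum borel_measurable_times borel_measurable_diff measurable_B)
    fix i assume i: "i \<in> {..<n}"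
    then show "\<xi> i \<in> borel_measurable M"
      using simple by (auto simp: simple_integrand_def intro: measurable_G_M)
    show "0 \<le> min (ts (Suc i)) s" "0 \<le> min (ts i) s"
      using i \<open>0 \<le> s\<close> simple_integrand_nonneg[OF simple] by auto
  qed
  then show ?thesis
    by (simp only: simple_integral_def[abs_def])
qed

text \<open>On a common refinement that contains \<open>P\<close>, the difference of the integrals
  is a sum of Brownian increments with adapted coefficients, and its quadratic sum with the cell
  lengths as weights is the integral of the squared difference. The maximal inequality then gives a
  bound in which \<open>P\<close> no longer occurs.\<close>

lemma simple_integral_difference_maximal:
  assumes H: "simple_integrand M \<G> n ts \<xi>" and H': "simple_integrand M \<G> n' ts' \<xi>'"
    and P: "finite P" "P \<subseteq> {0..u}" and "0 \<le> u" "0 < \<epsilon>" "0 \<le> \<delta>"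
  shows "\<P>(\<omega> in M. \<exists>p\<in>P. \<epsilon> < \<bar>simple_integral B n ts \<xi> p \<omega> - simple_integral B n' ts' \<xi>' p \<omega>\<bar>) \<le>
    \<P>(\<omega> in M. \<delta> < (LBINT s:{0..u}. (simple_process n ts \<xi> s \<omega> - simple_process n' ts' \<xi>' s \<omega>)\<^sup>2)) + \<delta> / \<epsilon>\<^sup>2"
proof -
  let ?h = "\<lambda>s \<omega>. simple_process n ts \<xi> s \<omega> - simple_process n' ts' \<xi>' s \<omega>"
  let ?J = "\<lambda>p \<omega>. simple_integral B n ts \<xi> p \<omega> - simple_integral B n' ts' \<xi>' p \<omega>"
  obtain m p where p: "refines m p n ts" "refines m p n' ts'" "p m = u" "P \<subseteq> p ` {..m}"
    using exists_refinement[OF P \<open>0 \<le> u\<close>] by blast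
  define \<eta> where "\<eta> i \<omega> = simple_process n ts \<xi> (p (Suc i)) \<omega> - simple_process n' ts' \<xi>' (p (Suc i)) \<omega>" for i \<omega>
  have lt: "p i < p (Suc i)" if "i < m" for i
    using p(1) that by (simp add: refines_def)
  have nn: "0 \<le> p i" if "i \<le> m" for i
    using refines_nonneg[OF p(1) that] .
  have \<eta>: "\<eta> i \<in> borel_measurable (\<G> (p i))" if "i < m" for i
    unfolding \<eta>_def[abs_def]
    using refines_simple_measurable[OF H p(1) that] refines_simple_measurable[OF H' p(2) that]
    by (rule borel_measurable_diff)
  have diff: "?J (p i) \<omega> =
      (\<Sum>j<i. \<eta> j \<omega> * (B (p (Suc j)) \<omega> - B (p j) \<omega>))" if "i \<le> m" for i \<omega>
    unfolding refines_simple_integral[OF H p(1) that] refines_simple_integral[OF H' p(2) that] \<eta>_def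
    by (simp add: left_diff_distrib sum_subtractf)
  have int: "(LBINT s:{0..u}. (?h s \<omega>)\<^sup>2) =
      (\<Sum>j<m. (\<eta> j \<omega>)\<^sup>2 * (p (Suc j) - p j))" for \<omega>
  proof -
    have "has_bochner_integral lborel (\<lambda>s. indicator {0..p m} s *\<^sub>R (?h s \<omega>)\<^sup>2)
        (\<Sum>j<m. (\<eta> j \<omega>)\<^sup>2 * (p (Suc j) - p j))"
    proof (rule has_bochner_integral_step_function)
      show "p 0 = 0" using p(1) by (simp add: refines_def)
      fix i s assume "i < m" "s \<in> {p i<..p (Suc i)}"
      then show "(?h s \<omega>)\<^sup>2 = (\<eta> i \<omega>)\<^sup>2"
        unfolding \<eta>_def by (simp only: refines_simple_process[OF p(1)] refines_simple_process[OF p(2)])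
    qed (rule lt)
    then show ?thesis
      unfolding set_lebesgue_integral_def p(3) by (rule has_bochner_integral_integral_eq)
  qed
  have sub: "{\<omega> \<in> space M. \<exists>p\<in>P. \<epsilon> < \<bar>?J p \<omega>\<bar>} \<subseteq>
      {\<omega> \<in> space M. \<exists>i\<le>m. \<epsilon> < \<bar>\<Sum>j<i. \<eta> j \<omega> * (B (p (Suc j)) \<omega> - B (p j) \<omega>)\<bar>}"
  proof clarify
    fix \<omega> q assume "\<omega> \<in> space M" "q \<in> P" and q: "\<epsilon> < \<bar>?J q \<omega>\<bar>"
    then obtain i where "i \<le> m" "q = p i"
      using p(4) by (metis atMost_iff imageE subsetD)
    then show "\<exists>i\<le>m. \<epsilon> < \<bar>\<Sum>j<i. \<eta> j \<omega> * (B (p (Suc j)) \<omega> - B (p j) \<omega>)\<bar>"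
      using q diff by metis
  qed
  have ev: "{\<omega> \<in> space M. \<exists>i\<le>m. \<epsilon> < \<bar>\<Sum>j<i. \<eta> j \<omega> * (B (p (Suc j)) \<omega> - B (p j) \<omega>)\<bar>} \<in> events"
  proof (rule exists_le_events, intro borel_measurable_sum borel_measurable_times borel_measurable_diff measurable_B)
    fix i j assume "i \<le> m" "j \<in> {..<i}"
    then show "\<eta> j \<in> borel_measurable M" "0 \<le> p (Suc j)" "0 \<le> p j"
      using measurable_G_M[OF \<eta>] nn by auto
  qed
  have "\<P>(\<omega> in M. \<exists>p\<in>P. \<epsilon> < \<bar>?J p \<omega>\<bar>) \<le>
      \<P>(\<omega> in M. \<exists>i\<le>m. \<epsilon> < \<bar>\<Sum>j<i. \<eta> j \<omega> * (B (p (Suc j)) \<omega> - B (p j) \<omega>)\<bar>)"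
    using sub ev by (rule finite_measure_mono)
  also have "\<dots> \<le> \<P>(\<omega> in M. \<delta> < (\<Sum>j<m. (\<eta> j \<omega>)\<^sup>2 * (p (Suc j) - p j))) + \<delta> / \<epsilon>\<^sup>2"
  proof (rule martingale_sum_maximal_inequality[where G="\<lambda>i. \<G> (p i)"])
    fix i assume i: "i < m"
    then have pi: "0 \<le> p i" "p i < p (Suc i)"
      using nn lt by auto
    show "(\<lambda>\<omega>. B (p (Suc i)) \<omega> - B (p i) \<omega>) \<in> borel_measurable (\<G> (p (Suc i)))"
      using pi by (intro borel_measurable_diff B_measurable_G) auto
    show "indep_of (\<G> (p i)) (\<lambda>\<omega>. B (p (Suc i)) \<omega> - B (p i) \<omega>)"
      using pi by (rule indep_increment_G)
    show "integrable M (\<lambda>\<omega>. (B (p (Suc i)) \<omega> - B (p i) \<omega>)\<^sup>2)"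
      "expectation (\<lambda>\<omega>. B (p (Suc i)) \<omega> - B (p i) \<omega>) = 0"
      "expectation (\<lambda>\<omega>. (B (p (Suc i)) \<omega> - B (p i) \<omega>)\<^sup>2) \<le> p (Suc i) - p i"
      using increment_moments[OF pi] by auto
    show "0 < p (Suc i) - p i"
      using pi by simp
  qed (use \<eta> \<open>0 < \<epsilon>\<close> \<open>0 \<le> \<delta>\<close> subalgebra_G G_mono[OF refines_mono[OF p(1)]] in auto)
  finally show ?thesis
    unfolding int .
qed

text \<open>A union bound over \<open>P\<close> would make \<open>k0\<close> depend on
  \<open>P\<close>. Instead the approximants number \<open>k\<close> and \<open>l\<close> are
  compared on all of \<open>P\<close> by the maximal inequality, and the union bound is spent only
  on the distance from \<open>l\<close> to \<open>I\<close>, which vanishes as \<open>l\<close>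
  grows while \<open>P\<close> stays fixed. The mesh can therefore be chosen after
  \<open>k\<close>.\<close>

lemma ito_approximation_uniform:
  assumes "0 \<le> u" and cont: "AE \<omega> in M. continuous_on {0..u} (\<lambda>s. H s \<omega>)"
    and ito: "\<And>s. s \<in> {0..u} \<Longrightarrow> is_ito_integral M \<G> B H s (I s)"
    and simple: "\<And>k. simple_integrand M \<G> (n k) (ts k) (\<xi> k)"
    and conv: "converges_in_probability M
        (\<lambda>k \<omega>. LBINT s:{0..u}. (simple_process (n k) (ts k) (\<xi> k) s \<omega> - H s \<omega>)\<^sup>2) (\<lambda>_. 0)"
    and "0 < \<epsilon>" "0 < \<eta>"
  shows "\<exists>k0. \<forall>k\<ge>k0. \<forall>P. finite P \<longrightarrow> P \<subseteq> {0..u} \<longrightarrow>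
    \<P>(\<omega> in M. \<exists>p\<in>P. \<epsilon> < \<bar>simple_integral B (n k) (ts k) (\<xi> k) p \<omega> - I p \<omega>\<bar>) \<le> \<eta>"
proof -
  let ?H = "\<lambda>k. simple_process (n k) (ts k) (\<xi> k)"
  let ?J = "\<lambda>k. simple_integral B (n k) (ts k) (\<xi> k)"
  define D where "D k \<omega> = (LBINT s:{0..u}. (?H k s \<omega> - H s \<omega>)\<^sup>2)" for k \<omega>
  have D_meas: "D k \<in> borel_measurable M" for k
    using conv unfolding converges_in_probability_def D_def[abs_def] by blast
  have D_nonneg: "0 \<le> D k \<omega>" for k \<omega>
    unfolding D_def set_lebesgue_integral_def by (intro Bochner_Integration.integral_nonneg) auto
  have D_lim: "(\<lambda>k. \<P>(\<omega> in M. \<delta> < D k \<omega>)) \<longlonglongrightarrow> 0" if "0 < \<delta>" for \<delta>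
    using conv that D_nonneg unfolding converges_in_probability_def D_def[symmetric] by simp
  have D_ev: "{\<omega> \<in> space M. \<delta> < D k \<omega>} \<in> events" for k \<delta>
    using D_meas[of k] by measurable
  \<comment> \<open>Since (a - b)^2 <= 2 (a - c)^2 + 2 (b - c)^2, a squared distance of two simple
    processes above \<delta> forces one of them to have squared distance above \<delta> / 4 from
    \<open>H\<close>.\<close>
  have compare: "\<P>(\<omega> in M. \<delta> < (LBINT x:{0..s}. (?H k x \<omega> - simple_process n' ts' \<xi>' x \<omega>)\<^sup>2)) \<le>
      \<P>(\<omega> in M. \<delta> / 4 < D k \<omega>) +
      \<P>(\<omega> in M. \<delta> / 4 < (LBINT x:{0..s}. (simple_process n' ts' \<xi>' x \<omega> - H x \<omega>)\<^sup>2))"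
    if s: "s \<in> {0..u}" and meas: "(\<lambda>\<omega>. LBINT x:{0..s}. (simple_process n' ts' \<xi>' x \<omega> - H x \<omega>)\<^sup>2) \<in> borel_measurable M"
    for \<delta> s k n' ts' \<xi>'
  proof (rule prob_mono2_AE)
    show "AE \<omega> in M. \<delta> < (LBINT x:{0..s}. (?H k x \<omega> - simple_process n' ts' \<xi>' x \<omega>)\<^sup>2) \<longrightarrow>
        \<delta> / 4 < D k \<omega> \<or> \<delta> / 4 < (LBINT x:{0..s}. (simple_process n' ts' \<xi>' x \<omega> - H x \<omega>)\<^sup>2)"
      using cont
    proof eventually_elim
      case (elim \<omega>)
      let ?f = "\<lambda>x. ?H k x \<omega>" and ?g = "\<lambda>x. simple_process n' ts' \<xi>' x \<omega>"
      have i1: "set_integrable lborel {0..u} (\<lambda>x. (?f x - H x \<omega>)\<^sup>2)"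
        by (rule set_integrable_square_diff[OF simple_process_borel simple_process_bounded elim])
      have sub: "{0..s} \<subseteq> {0..u}"
        using s by auto
      have i2: "set_integrable lborel {0..s} (\<lambda>x. (?f x - H x \<omega>)\<^sup>2)"
        by (rule set_integrable_square_diff[OF simple_process_borel simple_process_bounded continuous_on_subset[OF elim sub]])
      have i3: "set_integrable lborel {0..s} (\<lambda>x. (?g x - H x \<omega>)\<^sup>2)"
        by (rule set_integrable_square_diff[OF simple_process_borel simple_process_bounded continuous_on_subset[OF elim sub]])
      have i4: "set_integrable lborel {0..s} (\<lambda>x. (?f x - ?g x)\<^sup>2)"
      proof -
        have "set_integrable lborel {0..s} (\<lambda>x. ((?f x - ?g x) - 0)\<^sup>2)"
        proof (rule set_integrable_square_diff)
          show "\<bar>?f x - ?g x\<bar> \<le> (\<Sum>i<n k. \<bar>\<xi> k i \<omega>\<bar>) + (\<Sum>i<n'. \<bar>\<xi>' i \<omega>\<bar>)" for x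
            using simple_process_bounded[of "n k" "ts k" "\<xi> k" x \<omega>] simple_process_bounded[of n' ts' \<xi>' x \<omega>]
            by linarith
        qed auto
        then show ?thesis by simp
      qed
      have le: "(a - b)\<^sup>2 \<le> 2 * (a - c)\<^sup>2 + 2 * (b - c)\<^sup>2" for a b c :: real
        using zero_le_power2[of "a + b - 2 * c"] by (simp add: power2_eq_square algebra_simps)
      have "(LBINT x:{0..s}. (?f x - ?g x)\<^sup>2) \<le>
          (LBINT x:{0..s}. 2 * (?f x - H x \<omega>)\<^sup>2 + 2 * (?g x - H x \<omega>)\<^sup>2)"
        using i2 i3 i4 le by (intro set_integral_mono set_integral_add set_integrable_mult_right) auto
      also have "\<dots> = 2 * (LBINT x:{0..s}. (?f x - H x \<omega>)\<^sup>2) + 2 * (LBINT x:{0..s}. (?g x - H x \<omega>)\<^sup>2)"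
        using i2 i3 by (subst set_integral_add(2)) auto
      also have "(LBINT x:{0..s}. (?f x - H x \<omega>)\<^sup>2) \<le> D k \<omega>"
        unfolding D_def using i1 i2 sub unfolding set_lebesgue_integral_def set_integrable_def
        by (intro integral_mono) (auto simp: indicator_def)
      finally show ?case
        by auto
    qed
    show "{\<omega> \<in> space M. \<delta> / 4 < D k \<omega>} \<in> events" by (rule D_ev)
    show "{\<omega> \<in> space M. \<delta> / 4 < (LBINT x:{0..s}. (simple_process n' ts' \<xi>' x \<omega> - H x \<omega>)\<^sup>2)} \<in> events"
      using meas by measurable
  qed
  have I_meas: "I s \<in> borel_measurable M" if "s \<in> {0..u}" for s
    using ito[OF that] unfolding is_ito_integral_def converges_in_probability_def by blast
  have J_meas: "?J k s \<in> borel_measurable M" if "s \<in> {0..u}" for s k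
    using that by (intro simple_integral_measurable simple) auto
  have pointwise: "\<P>(\<omega> in M. \<epsilon> < \<bar>?J k s \<omega> - I s \<omega>\<bar>) \<le> \<P>(\<omega> in M. \<delta> / 4 < D k \<omega>) + 4 * \<delta> / \<epsilon>\<^sup>2"
    if s: "s \<in> {0..u}" and "0 < \<epsilon>" "0 < \<delta>" for s k \<epsilon> \<delta>
  proof -
    \<comment> \<open>The version \<open>I s\<close> comes with its own approximating sequence,
      unrelated to the given one. Both sequences approximate \<open>H\<close> on the interval up to
      \<open>s\<close>, so the maximal inequality on the single time \<open>s\<close> makes their
      integrals close.\<close>
    obtain n' ts' \<xi>' where simple': "\<And>l. simple_integrand M \<G> (n' l) (ts' l) (\<xi>' l)"
      and conv': "converges_in_probability M
        (\<lambda>l \<omega>. LBINT x:{0..s}. (simple_process (n' l) (ts' l) (\<xi>' l) x \<omega> - H x \<omega>)\<^sup>2) (\<lambda>_. 0)"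
      and convI: "converges_in_probability M (\<lambda>l. simple_integral B (n' l) (ts' l) (\<xi>' l) s) (I s)"
      using ito[OF s] unfolding is_ito_integral_def by blast
    let ?H' = "\<lambda>l. simple_process (n' l) (ts' l) (\<xi>' l)"
    define D' where "D' l \<omega> = (LBINT x:{0..s}. (?H' l x \<omega> - H x \<omega>)\<^sup>2)" for l \<omega>
    define J' where "J' l = simple_integral B (n' l) (ts' l) (\<xi>' l) s" for l
    have J'_meas: "J' l \<in> borel_measurable M" for l
      unfolding J'_def using s by (intro simple_integral_measurable simple') auto
    have D'_meas: "D' l \<in> borel_measurable M" for l
      using conv' unfolding converges_in_probability_def D'_def[abs_def] by blast
    have D'_nonneg: "0 \<le> D' l \<omega>" for l \<omega>
      unfolding D'_def set_lebesgue_integral_def by (intro Bochner_Integration.integral_nonneg) auto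
    have "(\<lambda>l. \<P>(\<omega> in M. \<epsilon> < D' l \<omega>)) \<longlonglongrightarrow> 0" if "0 < \<epsilon>" for \<epsilon>
      using that conv' D'_nonneg unfolding converges_in_probability_def D'_def[symmetric] by simp
    from this[of "\<delta> / 4"] have D'_lim: "(\<lambda>l. \<P>(\<omega> in M. \<delta> / 4 < D' l \<omega>)) \<longlonglongrightarrow> 0"
      using \<open>0 < \<delta>\<close> by simp
    have "(\<lambda>l. \<P>(\<omega> in M. \<epsilon> < \<bar>J' l \<omega> - I s \<omega>\<bar>)) \<longlonglongrightarrow> 0" if "0 < \<epsilon>" for \<epsilon>
      using that convI unfolding converges_in_probability_def J'_def by blast
    from this[of "\<epsilon> / 2"] have J'_lim: "(\<lambda>l. \<P>(\<omega> in M. \<epsilon> / 2 < \<bar>J' l \<omega> - I s \<omega>\<bar>)) \<longlonglongrightarrow> 0"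
      using \<open>0 < \<epsilon>\<close> by simp
    have le: "\<P>(\<omega> in M. \<epsilon> < \<bar>?J k s \<omega> - I s \<omega>\<bar>) \<le>
        (\<P>(\<omega> in M. \<delta> / 4 < D k \<omega>) + \<P>(\<omega> in M. \<delta> / 4 < D' l \<omega>) + \<delta> / (\<epsilon> / 2)\<^sup>2) +
        \<P>(\<omega> in M. \<epsilon> / 2 < \<bar>J' l \<omega> - I s \<omega>\<bar>)" for l
    proof -
      have "\<P>(\<omega> in M. \<epsilon> < \<bar>?J k s \<omega> - I s \<omega>\<bar>) \<le>
          \<P>(\<omega> in M. \<epsilon> / 2 < \<bar>?J k s \<omega> - J' l \<omega>\<bar>) + \<P>(\<omega> in M. \<epsilon> / 2 < \<bar>J' l \<omega> - I s \<omega>\<bar>)"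
      proof (rule prob_mono2_AE)
        show "{\<omega> \<in> space M. \<epsilon> / 2 < \<bar>?J k s \<omega> - J' l \<omega>\<bar>} \<in> events"
          using J_meas[OF s, of k] J'_meas[of l] by measurable
        show "{\<omega> \<in> space M. \<epsilon> / 2 < \<bar>J' l \<omega> - I s \<omega>\<bar>} \<in> events"
          using I_meas[OF s] J'_meas[of l] by measurable
        show "AE \<omega> in M. \<epsilon> < \<bar>?J k s \<omega> - I s \<omega>\<bar> \<longrightarrow>
          \<epsilon> / 2 < \<bar>?J k s \<omega> - J' l \<omega>\<bar> \<or> \<epsilon> / 2 < \<bar>J' l \<omega> - I s \<omega>\<bar>"
          by (intro AE_I2 impI) linarith
      qed
      also have "\<P>(\<omega> in M. \<epsilon> / 2 < \<bar>?J k s \<omega> - J' l \<omega>\<bar>) \<le>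
          \<P>(\<omega> in M. \<delta> < (LBINT x:{0..s}. (?H k x \<omega> - ?H' l x \<omega>)\<^sup>2)) + \<delta> / (\<epsilon> / 2)\<^sup>2"
        using simple_integral_difference_maximal[OF simple simple', of "{s}" s "\<epsilon> / 2" \<delta> k l] s \<open>0 < \<epsilon>\<close> \<open>0 < \<delta>\<close>
        unfolding J'_def by simp
      also have "\<P>(\<omega> in M. \<delta> < (LBINT x:{0..s}. (?H k x \<omega> - ?H' l x \<omega>)\<^sup>2)) \<le>
          \<P>(\<omega> in M. \<delta> / 4 < D k \<omega>) + \<P>(\<omega> in M. \<delta> / 4 < D' l \<omega>)"
        unfolding D'_def using D'_meas[of l, unfolded D'_def[abs_def]] by (rule compare[OF s])
      finally show ?thesis by simp
    qed
    \<comment> \<open>Letting \<open>l\<close> tend to infinity removes both terms that mention the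
      auxiliary sequence.\<close>
    have "\<P>(\<omega> in M. \<epsilon> < \<bar>?J k s \<omega> - I s \<omega>\<bar>) \<le>
        (\<P>(\<omega> in M. \<delta> / 4 < D k \<omega>) + 0 + \<delta> / (\<epsilon> / 2)\<^sup>2) + 0"
    proof (rule LIMSEQ_le_const)
      show "(\<lambda>l. (\<P>(\<omega> in M. \<delta> / 4 < D k \<omega>) + \<P>(\<omega> in M. \<delta> / 4 < D' l \<omega>) + \<delta> / (\<epsilon> / 2)\<^sup>2) +
        \<P>(\<omega> in M. \<epsilon> / 2 < \<bar>J' l \<omega> - I s \<omega>\<bar>)) \<longlonglongrightarrow> (\<P>(\<omega> in M. \<delta> / 4 < D k \<omega>) + 0 + \<delta> / (\<epsilon> / 2)\<^sup>2) + 0"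
        by (intro tendsto_add tendsto_const D'_lim J'_lim)
    qed (use le in blast)
    then show ?thesis
      by (simp add: power_divide mult_ac)
  qed
  have J_lim: "(\<lambda>k. \<P>(\<omega> in M. \<epsilon> / 2 < \<bar>?J k s \<omega> - I s \<omega>\<bar>)) \<longlonglongrightarrow> 0" if s: "s \<in> {0..u}" for s
  proof (rule LIMSEQ_I)
    fix r :: real assume "0 < r"
    define \<delta> where "\<delta> = r * (\<epsilon> / 2)\<^sup>2 / 8"
    have \<delta>: "0 < \<delta>" "4 * \<delta> / (\<epsilon> / 2)\<^sup>2 = r / 2"
      using \<open>0 < r\<close> \<open>0 < \<epsilon>\<close> by (auto simp: \<delta>_def)
    have "eventually (\<lambda>k. \<P>(\<omega> in M. \<delta> / 4 < D k \<omega>) < r / 2) sequentially"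
      using D_lim[of "\<delta> / 4"] \<delta>(1) \<open>0 < r\<close> by (intro order_tendstoD) auto
    then obtain k0 where k0: "\<And>k. k \<ge> k0 \<Longrightarrow> \<P>(\<omega> in M. \<delta> / 4 < D k \<omega>) < r / 2"
      by (auto simp: eventually_sequentially)
    have "norm (\<P>(\<omega> in M. \<epsilon> / 2 < \<bar>?J k s \<omega> - I s \<omega>\<bar>) - 0) < r" if "k \<ge> k0" for k
      using pointwise[OF s _ \<delta>(1), of "\<epsilon> / 2" k] k0[OF that] \<delta>(2) \<open>0 < \<epsilon>\<close> by simp
    then show "\<exists>k0. \<forall>k\<ge>k0. norm (\<P>(\<omega> in M. \<epsilon> / 2 < \<bar>?J k s \<omega> - I s \<omega>\<bar>) - 0) < r"
      by blast
  qed
  define \<delta> where "\<delta> = \<eta> * \<epsilon>\<^sup>2 / 8"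
  have \<delta>: "0 < \<delta>" "\<delta> / (\<epsilon> / 2)\<^sup>2 = \<eta> / 2"
    using \<open>0 < \<eta>\<close> \<open>0 < \<epsilon>\<close> by (auto simp: \<delta>_def power_divide)
  have "eventually (\<lambda>k. \<P>(\<omega> in M. \<delta> / 4 < D k \<omega>) < \<eta> / 2) sequentially"
    using D_lim[of "\<delta> / 4"] \<delta>(1) \<open>0 < \<eta>\<close> by (intro order_tendstoD) auto
  then obtain k0 where k0: "\<And>k. k \<ge> k0 \<Longrightarrow> \<P>(\<omega> in M. \<delta> / 4 < D k \<omega>) < \<eta> / 2"
    by (auto simp: eventually_sequentially)
  have "\<P>(\<omega> in M. \<exists>p\<in>P. \<epsilon> < \<bar>?J k p \<omega> - I p \<omega>\<bar>) \<le> \<eta>"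
    if "k \<ge> k0" and P: "finite P" "P \<subseteq> {0..u}" for k P
  proof -
    have IP: "(\<lambda>\<omega>. ?J l p \<omega> - I p \<omega>) \<in> borel_measurable M" if "p \<in> P" for l p
      using P(2) that by (intro borel_measurable_diff J_meas I_meas) auto
    have JP: "(\<lambda>\<omega>. ?J k p \<omega> - ?J l p \<omega>) \<in> borel_measurable M" if "p \<in> P" for l p
      using P(2) that by (intro borel_measurable_diff J_meas) auto
    \<comment> \<open>The intermediate index \<open>l\<close> separates the estimate uniform in
      \<open>P\<close> from the union bound, whose cost grows with the size of
      \<open>P\<close>.\<close>
    have le: "\<P>(\<omega> in M. \<exists>p\<in>P. \<epsilon> < \<bar>?J k p \<omega> - I p \<omega>\<bar>) \<le>
        (\<P>(\<omega> in M. \<delta> / 4 < D k \<omega>) + \<P>(\<omega> in M. \<delta> / 4 < D l \<omega>) + \<delta> / (\<epsilon> / 2)\<^sup>2) +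
        (\<Sum>p\<in>P. \<P>(\<omega> in M. \<epsilon> / 2 < \<bar>?J l p \<omega> - I p \<omega>\<bar>))" for l
    proof -
      have "\<P>(\<omega> in M. \<exists>p\<in>P. \<epsilon> < \<bar>?J k p \<omega> - I p \<omega>\<bar>) \<le>
          \<P>(\<omega> in M. \<exists>p\<in>P. \<epsilon> / 2 < \<bar>?J k p \<omega> - ?J l p \<omega>\<bar>) +
          \<P>(\<omega> in M. \<exists>p\<in>P. \<epsilon> / 2 < \<bar>?J l p \<omega> - I p \<omega>\<bar>)"
      proof (rule prob_mono2_AE)
        have "\<epsilon> / 2 < \<bar>?J k p \<omega> - ?J l p \<omega>\<bar> \<or> \<epsilon> / 2 < \<bar>?J l p \<omega> - I p \<omega>\<bar>"
          if "\<epsilon> < \<bar>?J k p \<omega> - I p \<omega>\<bar>" for p \<omega>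
          using that by linarith
        then show "AE \<omega> in M. (\<exists>p\<in>P. \<epsilon> < \<bar>?J k p \<omega> - I p \<omega>\<bar>) \<longrightarrow>
          (\<exists>p\<in>P. \<epsilon> / 2 < \<bar>?J k p \<omega> - ?J l p \<omega>\<bar>) \<or> (\<exists>p\<in>P. \<epsilon> / 2 < \<bar>?J l p \<omega> - I p \<omega>\<bar>)"
          by (intro AE_I2) blast
      qed (intro finite_exists_events(1) P(1) JP IP; assumption)+
      also have "\<P>(\<omega> in M. \<exists>p\<in>P. \<epsilon> / 2 < \<bar>?J k p \<omega> - ?J l p \<omega>\<bar>) \<le>
          \<P>(\<omega> in M. \<delta> < (LBINT x:{0..u}. (?H k x \<omega> - ?H l x \<omega>)\<^sup>2)) + \<delta> / (\<epsilon> / 2)\<^sup>2"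
        using \<open>0 < \<epsilon>\<close> \<delta>(1) \<open>0 \<le> u\<close> by (intro simple_integral_difference_maximal simple P) auto
      also have "\<P>(\<omega> in M. \<delta> < (LBINT x:{0..u}. (?H k x \<omega> - ?H l x \<omega>)\<^sup>2)) \<le>
          \<P>(\<omega> in M. \<delta> / 4 < D k \<omega>) + \<P>(\<omega> in M. \<delta> / 4 < D l \<omega>)"
        unfolding D_def[of l] using D_meas[of l, unfolded D_def[abs_def]] \<open>0 \<le> u\<close> by (intro compare) auto
      also have "\<P>(\<omega> in M. \<exists>p\<in>P. \<epsilon> / 2 < \<bar>?J l p \<omega> - I p \<omega>\<bar>) \<le>
          (\<Sum>p\<in>P. \<P>(\<omega> in M. \<epsilon> / 2 < \<bar>?J l p \<omega> - I p \<omega>\<bar>))"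
        by (intro finite_exists_events(2) P(1) IP)
      finally show ?thesis by simp
    qed
    \<comment> \<open>With \<open>P\<close> and \<open>k\<close> fixed, the limit in
      \<open>l\<close> annihilates the finite sum over \<open>P\<close> and the distance of the
      approximant \<open>l\<close> from \<open>H\<close>.\<close>
    have "\<P>(\<omega> in M. \<exists>p\<in>P. \<epsilon> < \<bar>?J k p \<omega> - I p \<omega>\<bar>) \<le>
        (\<P>(\<omega> in M. \<delta> / 4 < D k \<omega>) + 0 + \<delta> / (\<epsilon> / 2)\<^sup>2) + (\<Sum>p\<in>P. 0)"
    proof (rule LIMSEQ_le_const)
      show "(\<lambda>l. (\<P>(\<omega> in M. \<delta> / 4 < D k \<omega>) + \<P>(\<omega> in M. \<delta> / 4 < D l \<omega>) + \<delta> / (\<epsilon> / 2)\<^sup>2) +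
        (\<Sum>p\<in>P. \<P>(\<omega> in M. \<epsilon> / 2 < \<bar>?J l p \<omega> - I p \<omega>\<bar>))) \<longlonglongrightarrow>
        (\<P>(\<omega> in M. \<delta> / 4 < D k \<omega>) + 0 + \<delta> / (\<epsilon> / 2)\<^sup>2) + (\<Sum>p\<in>P. 0)"
        using P(2) \<delta>(1) by (intro tendsto_add tendsto_const tendsto_sum D_lim J_lim) auto
    qed (use le in blast)
    then show ?thesis
      using k0[OF \<open>k \<ge> k0\<close>] \<delta>(2) by simp
  qed
  then show ?thesis
    by blast
qed

end

section \<open>The linear stochastic differential equation\<close>

text \<open>The points of an equidistant grid with spacing at most \<open>h\<close> are forced into
  the refinement.\<close>

lemma exists_fine_refinement:
  assumes "0 < u" "0 < h"
  obtains m p where "refines m p n ts" "p m = u" "\<And>i. i < m \<Longrightarrow> p (Suc i) - p i \<le> h"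
proof -
  obtain N where N: "u / h < real (Suc N)"
    using reals_Archimedean2[of "u / h"] by (meson less_trans lessI of_nat_less_iff)
  have Nh: "u / real (Suc N) \<le> h"
    using N assms by (simp add: field_simps del: of_nat_Suc)
  define P where "P = (\<lambda>j. u * real j / real (Suc N)) ` {..Suc N}"
  have P: "finite P" "P \<subseteq> {0..u}"
    using \<open>0 < u\<close> by (auto simp: P_def divide_le_eq simp del: of_nat_Suc)
  obtain m p where p: "refines m p n ts" "p m = u" "P \<subseteq> p ` {..m}"
    using exists_refinement[OF P, of n ts n ts] \<open>0 < u\<close> by auto
  have "p (Suc i) - p i \<le> h" if i: "i < m" for i
  proof -
    \<comment> \<open>\<open>j\<close> numbers the first grid point at or beyond
      \<open>p (Suc i)\<close>. The preceding grid point is itself a point of \<open>p\<close> and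
      lies before \<open>p (Suc i)\<close>, hence is at most \<open>p i\<close>; so the cell is no
      longer than one grid spacing.\<close>
    define j where "j = (LEAST j. p (Suc i) \<le> u * real j / real (Suc N))"
    have pu: "p (Suc i) \<le> u"
      using refines_mono[OF p(1), of "Suc i" m] i p(2) by simp
    have top: "p (Suc i) \<le> u * real (Suc N) / real (Suc N)"
      using pu by (simp del: of_nat_Suc)
    have j: "p (Suc i) \<le> u * real j / real (Suc N)" and "j \<le> Suc N"
      unfolding j_def using top by (rule LeastI, rule Least_le)
    have pos: "0 < p (Suc i)"
      using refines_nonneg[OF p(1), of i] i p(1) by (simp add: refines_def order_le_less_trans)
    then obtain l where l: "j = Suc l"
      using j by (cases j) auto
    define q where "q = u * real l / real (Suc N)"
    have "\<not> p (Suc i) \<le> q"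
      using not_less_Least[of l "\<lambda>j. p (Suc i) \<le> u * real j / real (Suc N)"] l by (simp add: q_def j_def)
    moreover have "q \<in> P"
      unfolding P_def q_def using \<open>j \<le> Suc N\<close> l by (intro imageI) simp
    then have "q \<in> p ` {..m}"
      using p(3) by blast
    then obtain a where a: "a \<le> m" "q = p a"
      by auto
    ultimately have "\<not> Suc i \<le> a"
      using refines_mono[OF p(1), of "Suc i" a] by auto
    then have "q \<le> p i"
      using refines_mono[OF p(1), of a i] a i by simp
    moreover have "u * real j / real (Suc N) = q + u / real (Suc N)"
      unfolding q_def l by (simp add: add_divide_distrib[symmetric] algebra_simps)
    ultimately show ?thesis
      using j Nh by linarith
  qed
  then show thesis
    using that p by blast
qed

text \<open>A pathwise estimate. \<open>h\<close> approximates \<open>\<sigma> * x\<close>, and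
  \<open>W\<close> uses it both in the drift, with rate \<open>\<theta> * \<sigma>\<close>, and in
  the noise. In \<kappa> the first summand bounds the drift integral of the error and the 1 pays for
  replacing \<open>I\<close> by \<open>J\<close>. For the second claim,
  \<open>\<xi> i - \<sigma> * W i\<close> splits for \<open>s\<close> in cell \<open>i\<close> into
  the error of \<open>h\<close> at \<open>s\<close> and \<sigma> times \<open>x s - W i\<close>,
  which is at most \<open>(1 + \<kappa>) * \<epsilon>\<close> by the oscillation bound.\<close>

lemma euler_scheme_error:
  fixes x h :: "real \<Rightarrow> real" and p \<xi> I J W :: "nat \<Rightarrow> real"
  assumes p: "p 0 = 0" "\<And>i. i < m \<Longrightarrow> p i < p (Suc i)" "p m = u"
    and h: "h \<in> borel_measurable borel" "\<And>s. \<bar>h s\<bar> \<le> b" "\<And>i s. i < m \<Longrightarrow> s \<in> {p i<..p (Suc i)} \<Longrightarrow> h s = \<xi> i"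
    and x: "continuous_on {0..u} x"
    and dist: "(LBINT s:{0..u}. (h s - \<sigma> * x s)\<^sup>2) \<le> \<epsilon>\<^sup>2"
    and eq: "\<And>i. i \<le> m \<Longrightarrow> x (p i) = x0 + (LBINT s:{0..p i}. \<theta> * (\<sigma> * x s)) + I i"
    and JI: "\<And>i. i \<le> m \<Longrightarrow> \<bar>J i - I i\<bar> \<le> \<epsilon>"
    and osc: "\<And>i s. i < m \<Longrightarrow> s \<in> {p i<..p (Suc i)} \<Longrightarrow> \<bar>x s - x (p i)\<bar> \<le> \<epsilon>"
    and W: "\<And>i. i \<le> m \<Longrightarrow> W i = x0 + \<theta> * (\<Sum>j<i. \<xi> j * (p (Suc j) - p j)) + J i"
    and "0 < \<epsilon>" and \<kappa>: "\<kappa> = \<bar>\<theta>\<bar> * (u + 1) / 2 + 1"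
  shows "\<And>i. i \<le> m \<Longrightarrow> \<bar>W i - x (p i)\<bar> \<le> \<kappa> * \<epsilon>"
    and "(\<Sum>i<m. (\<xi> i - \<sigma> * W i)\<^sup>2 * (p (Suc i) - p i)) \<le> (2 + 2 * \<sigma>\<^sup>2 * (1 + \<kappa>)\<^sup>2 * u) * \<epsilon>\<^sup>2"
proof -
  have mono: "p i \<le> p j" if "i \<le> j" "j \<le> m" for i j
    using that
  proof (induction j)
    case (Suc j)
    then show ?case
      using p(2)[of j] by (cases "i = Suc j") auto
  qed simp
  have pi: "0 \<le> p i" "p i \<le> u" if "i \<le> m" for i
    using mono[of 0 i] mono[of i m] that p by auto
  have u: "0 \<le> u"
    using pi[of m] p(3) by simp
  define f where "f s = h s - \<sigma> * x s" for s
  have sx: "continuous_on {0..u} (\<lambda>s. \<sigma> * x s)"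
    by (intro continuous_intros x)
  have f2: "set_integrable lborel {0..u} (\<lambda>s. (f s)\<^sup>2)"
    unfolding f_def by (rule set_integrable_square_diff[OF h(1,2) sx])
  have const: "set_integrable lborel {0..q} (\<lambda>s. c)" for c q :: real
    by (intro borel_integrable_atLeastAtMost' continuous_intros)
  have lbint_const: "(LBINT s:{0..u}. c) = c * u" for c :: real
    using u by (simp add: set_lebesgue_integral_def)
  show Wx: "\<bar>W i - x (p i)\<bar> \<le> \<kappa> * \<epsilon>" if i: "i \<le> m" for i
  proof -
    have step: "has_bochner_integral lborel (\<lambda>s. indicator {0..p i} s *\<^sub>R h s) (\<Sum>j<i. \<xi> j * (p (Suc j) - p j))"
      using i by (intro has_bochner_integral_step_function p h) auto
    have h_int: "set_integrable lborel {0..p i} h"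
      using step unfolding set_integrable_def by (rule integrable.intros)
    have h_eq: "(LBINT s:{0..p i}. h s) = (\<Sum>j<i. \<xi> j * (p (Suc j) - p j))"
      using step unfolding set_lebesgue_integral_def by (rule has_bochner_integral_integral_eq)
    have sub: "{0..p i} \<subseteq> {0..u}"
      using pi[OF i] by auto
    have x_int: "set_integrable lborel {0..p i} (\<lambda>s. \<sigma> * x s)"
      by (intro borel_integrable_atLeastAtMost' continuous_on_subset[OF sx sub])
    have f_int: "set_integrable lborel {0..p i} f"
      unfolding f_def using h_int x_int by (rule set_integral_diff)
    have f2_int: "set_integrable lborel {0..p i} (\<lambda>s. (f s)\<^sup>2)"
      unfolding f_def by (rule set_integrable_square_diff[OF h(1,2) continuous_on_subset[OF sx sub]])
    have f_eq: "(LBINT s:{0..p i}. f s) = (\<Sum>j<i. \<xi> j * (p (Suc j) - p j)) - (LBINT s:{0..p i}. \<sigma> * x s)"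
      unfolding f_def using h_int x_int by (simp add: set_integral_diff h_eq)
    \<comment> \<open>Young's inequality with weight \<epsilon> passes from the integral of |f| to
      that of f^2, and the result is of order \<epsilon> because the latter is at most
      \<epsilon>^2.\<close>
    have young: "\<bar>y\<bar> \<le> \<epsilon> / 2 + 1 / (2 * \<epsilon>) * y\<^sup>2" for y :: real
    proof -
      have "0 \<le> (\<bar>y\<bar> - \<epsilon>)\<^sup>2 / (2 * \<epsilon>)"
        using \<open>0 < \<epsilon>\<close> by simp
      also have "\<dots> = \<epsilon> / 2 + 1 / (2 * \<epsilon>) * y\<^sup>2 - \<bar>y\<bar>"
        using \<open>0 < \<epsilon>\<close> by (simp add: power2_diff field_simps) (simp add: power2_eq_square)
      finally show ?thesis by simp
    qed
    have g_int: "set_integrable lborel {0..q} (\<lambda>s. \<epsilon> / 2 + 1 / (2 * \<epsilon>) * (f s)\<^sup>2)"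
      if "set_integrable lborel {0..q} (\<lambda>s. (f s)\<^sup>2)" for q
      using that by (intro set_integral_add(1) const set_integrable_mult_right) auto
    have "\<bar>LBINT s:{0..p i}. f s\<bar> \<le> (LBINT s:{0..p i}. \<bar>f s\<bar>)"
      using set_integral_norm_bound[OF f_int] by simp
    also have "\<dots> \<le> (LBINT s:{0..p i}. \<epsilon> / 2 + 1 / (2 * \<epsilon>) * (f s)\<^sup>2)"
      using young by (intro set_integral_mono set_integrable_abs f_int g_int f2_int) auto
    also have "\<dots> \<le> (LBINT s:{0..u}. \<epsilon> / 2 + 1 / (2 * \<epsilon>) * (f s)\<^sup>2)"
      using g_int[OF f2_int] g_int[OF f2] sub \<open>0 < \<epsilon>\<close>
      unfolding set_lebesgue_integral_def set_integrable_def
      by (intro integral_mono) (auto simp: indicator_def)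
    also have "\<dots> = (LBINT s:{0..u}. \<epsilon> / 2) + (LBINT s:{0..u}. 1 / (2 * \<epsilon>) * (f s)\<^sup>2)"
      using f2 by (intro set_integral_add(2) const set_integrable_mult_right) auto
    also have "\<dots> = \<epsilon> / 2 * u + 1 / (2 * \<epsilon>) * (LBINT s:{0..u}. (f s)\<^sup>2)"
      by (simp only: lbint_const set_integral_mult_right)
    also have "\<dots> \<le> \<epsilon> / 2 * u + 1 / (2 * \<epsilon>) * \<epsilon>\<^sup>2"
      using dist \<open>0 < \<epsilon>\<close> by (intro add_left_mono mult_left_mono) (simp_all add: f_def)
    also have "\<dots> = (u + 1) / 2 * \<epsilon>"
      using \<open>0 < \<epsilon>\<close> by (simp add: field_simps power2_eq_square)
    finally have fb: "\<bar>LBINT s:{0..p i}. f s\<bar> \<le> (u + 1) / 2 * \<epsilon>" .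
    have "W i - x (p i) = \<theta> * (LBINT s:{0..p i}. f s) + (J i - I i)"
      unfolding W[OF i] eq[OF i] f_eq by (simp add: algebra_simps)
    then have "\<bar>W i - x (p i)\<bar> \<le> \<bar>\<theta>\<bar> * \<bar>LBINT s:{0..p i}. f s\<bar> + \<bar>J i - I i\<bar>"
      by (simp add: abs_mult[symmetric] abs_triangle_ineq)
    also have "\<dots> \<le> \<bar>\<theta>\<bar> * ((u + 1) / 2 * \<epsilon>) + \<epsilon>"
      using fb JI[OF i] by (intro add_mono mult_left_mono) auto
    also have "\<dots> = \<kappa> * \<epsilon>"
      by (simp add: \<kappa> algebra_simps)
    finally show ?thesis .
  qed
  \<comment> \<open>As the integral of a step function, the sum can be compared pointwise with
    \<open>f\<close>, which varies inside the cells.\<close>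
  define g where "g s = (\<Sum>i<m. indicator {p i<..p (Suc i)} s * (\<xi> i - \<sigma> * W i)\<^sup>2)" for s
  have g: "g s = (\<xi> i - \<sigma> * W i)\<^sup>2" if "i < m" "s \<in> {p i<..p (Suc i)}" for i s
  proof -
    have "indicator {p j<..p (Suc j)} s = (if j = i then 1 else 0 :: real)" if "j < m" for j
      using \<open>s \<in> _\<close> mono[of "Suc j" i] mono[of "Suc i" j] \<open>i < m\<close> \<open>j < m\<close>
      by (cases j i rule: linorder_cases) auto
    then have "g s = (\<Sum>j<m. (if j = i then 1 else 0) * (\<xi> j - \<sigma> * W j)\<^sup>2)"
      unfolding g_def by (intro sum.cong) auto
    then show ?thesis
      using \<open>i < m\<close> by (simp add: sum.delta if_distrib[of "\<lambda>a. a * _"] cong: if_cong)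
  qed
  have "has_bochner_integral lborel (\<lambda>s. indicator {0..p m} s *\<^sub>R g s) (\<Sum>i<m. (\<xi> i - \<sigma> * W i)\<^sup>2 * (p (Suc i) - p i))"
    by (intro has_bochner_integral_step_function p g)
  then have g_int: "set_integrable lborel {0..u} g"
    and g_eq: "(LBINT s:{0..u}. g s) = (\<Sum>i<m. (\<xi> i - \<sigma> * W i)\<^sup>2 * (p (Suc i) - p i))"
    unfolding set_integrable_def set_lebesgue_integral_def p(3)
    by (rule integrable.intros, rule has_bochner_integral_integral_eq)
  have covered: "\<exists>i<k. s \<in> {p i<..p (Suc i)}" if "0 < s" "s \<le> p k" for s k
    using that
  proof (induction k)
    case (Suc k)
    then show ?case
      by (cases "s \<le> p k") (auto intro: less_SucI)
  qed (use p in auto)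
  have g_le: "g s \<le> 2 * (f s)\<^sup>2 + 2 * \<sigma>\<^sup>2 * ((1 + \<kappa>) * \<epsilon>)\<^sup>2" if s: "s \<in> {0..u}" for s
  proof (cases "s = 0")
    case True
    have "g s = (\<Sum>i<m. 0)"
      unfolding g_def True
    proof (rule sum.cong)
      fix i assume "i \<in> {..<m}"
      then show "indicator {p i<..p (Suc i)} 0 * (\<xi> i - \<sigma> * W i)\<^sup>2 = 0"
        using pi(1)[of i] by (simp add: indicator_def)
    qed simp
    then show ?thesis by simp
  next
    case False
    then obtain i where i: "i < m" "s \<in> {p i<..p (Suc i)}"
      using covered[of s m] s p(3) by auto
    have "\<bar>x s - W i\<bar> \<le> (1 + \<kappa>) * \<epsilon>"
      using osc[OF i] Wx[of i] i by (simp add: algebra_simps)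
    then have "(x s - W i)\<^sup>2 \<le> ((1 + \<kappa>) * \<epsilon>)\<^sup>2"
      using abs_le_square_iff[of "x s - W i" "(1 + \<kappa>) * \<epsilon>"] by (meson abs_ge_self order_trans)
    then have "2 * \<sigma>\<^sup>2 * (x s - W i)\<^sup>2 \<le> 2 * \<sigma>\<^sup>2 * ((1 + \<kappa>) * \<epsilon>)\<^sup>2"
      by (intro mult_left_mono) auto
    moreover have "(\<xi> i - \<sigma> * W i)\<^sup>2 \<le> 2 * (f s)\<^sup>2 + 2 * \<sigma>\<^sup>2 * (x s - W i)\<^sup>2"
    proof -
      have "(a + b)\<^sup>2 \<le> 2 * a\<^sup>2 + 2 * b\<^sup>2" for a b :: real
        using zero_le_power2[of "a - b"] by (simp add: power2_eq_square algebra_simps)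
      from this[of "f s" "\<sigma> * (x s - W i)"] show ?thesis
        unfolding f_def h(3)[OF i] power_mult_distrib[of \<sigma>] by (simp add: right_diff_distrib mult.assoc)
    qed
    ultimately show ?thesis
      unfolding g[OF i] by linarith
  qed
  have "(LBINT s:{0..u}. g s) \<le> (LBINT s:{0..u}. 2 * (f s)\<^sup>2 + 2 * \<sigma>\<^sup>2 * ((1 + \<kappa>) * \<epsilon>)\<^sup>2)"
    using g_le f2 by (intro set_integral_mono g_int set_integral_add(1) const set_integrable_mult_right) auto
  also have "\<dots> = (LBINT s:{0..u}. 2 * (f s)\<^sup>2) + (LBINT s:{0..u}. 2 * \<sigma>\<^sup>2 * ((1 + \<kappa>) * \<epsilon>)\<^sup>2)"
    using f2 by (intro set_integral_add(2) const set_integrable_mult_right) auto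
  also have "\<dots> = 2 * (LBINT s:{0..u}. (f s)\<^sup>2) + 2 * \<sigma>\<^sup>2 * ((1 + \<kappa>) * \<epsilon>)\<^sup>2 * u"
    by (simp only: lbint_const set_integral_mult_right)
  also have "\<dots> \<le> 2 * \<epsilon>\<^sup>2 + 2 * \<sigma>\<^sup>2 * ((1 + \<kappa>) * \<epsilon>)\<^sup>2 * u"
    using dist by (simp add: f_def)
  also have "\<dots> = (2 + 2 * \<sigma>\<^sup>2 * (1 + \<kappa>)\<^sup>2 * u) * \<epsilon>\<^sup>2"
  proof -
    have "2 * a + 2 * b * (k * a) * u = (2 + 2 * b * k * u) * a" for a b k :: real
      by (simp add: algebra_simps)
    then show ?thesis
      unfolding power_mult_distrib[of "1 + \<kappa>"] .
  qed
  finally show "(\<Sum>i<m. (\<xi> i - \<sigma> * W i)\<^sup>2 * (p (Suc i) - p i)) \<le> (2 + 2 * \<sigma>\<^sup>2 * (1 + \<kappa>)\<^sup>2 * u) * \<epsilon>\<^sup>2"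
    unfolding g_eq .
qed

context standard_brownian_motion
begin

text \<open>The threshold \<open>3 * e\<close> collects the error of the scheme at \<open>u\<close>
  and the two noise sums. The factor 27 is 5 + 11 + 11, for one exceptional event and the two noise
  sums. Since \<eta> can be chosen freely for fixed \<open>e\<close>, the probability is in fact
  0.\<close>

lemma sde_solution_deviation:
  fixes \<mu> \<sigma> x0 :: real
  defines "Z \<equiv> \<lambda>s \<omega>. exp (- (\<mu> - \<sigma>\<^sup>2 / 2) * s - \<sigma> * B s \<omega>)"
  assumes S: "sde_solution M \<G> B T (\<lambda>_ x. \<mu> * x) (\<lambda>_ x. \<sigma> * x) x0 S"
    and "0 < \<sigma>" "0 < u" "u \<le> T" "0 < e" "0 < \<eta>"
  shows "\<P>(\<omega> in M. 3 * e < \<bar>S u \<omega> * Z u \<omega> - x0\<bar>) \<le> 27 * \<eta>"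
proof -
  have S_meas: "S s \<in> borel_measurable M" if "0 \<le> s" "s \<le> u" for s
    using S that \<open>u \<le> T\<close> by (intro measurable_G_M[of _ s]) (auto simp: sde_solution_def)
  have S_cont: "AE \<omega> in M. continuous_on {0..u} (\<lambda>s. S s \<omega>)"
  proof -
    have "AE \<omega> in M. continuous_on {0..T} (\<lambda>s. S s \<omega>)"
      using S by (simp add: sde_solution_def)
    then show ?thesis
      by eventually_elim (erule continuous_on_subset, use \<open>u \<le> T\<close> in auto)
  qed
  have Z_meas: "Z s \<in> borel_measurable (\<G> t)" if "0 \<le> s" "s \<le> t" for s t
    unfolding Z_def using B_measurable_G[OF that] by measurable
  have Z_cont: "AE \<omega> in M. continuous_on {0..u} (\<lambda>s. Z s \<omega>)"
    using continuous_paths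
  proof eventually_elim
    case (elim \<omega>)
    then have "continuous_on {0..u} (\<lambda>s. B s \<omega>)"
      by (rule continuous_on_subset) auto
    then show ?case
      unfolding Z_def by (intro continuous_intros)
  qed
  define H where "H s \<omega> = \<sigma> * S s \<omega>" for s \<omega>
  have H_cont: "AE \<omega> in M. continuous_on {0..u} (\<lambda>s. H s \<omega>)"
    using S_cont by eventually_elim (auto simp: H_def intro!: continuous_intros)
  have "\<forall>s\<in>{0..u}. \<exists>I. is_ito_integral M \<G> B H s I \<and>
      (AE \<omega> in M. S s \<omega> = S 0 \<omega> + (LBINT v:{0..s}. \<mu> * S v \<omega>) + I \<omega>)"
  proof
    fix s assume "s \<in> {0..u}"
    then have "s \<in> {0..T}"
      using \<open>u \<le> T\<close> by simp
    with S[unfolded sde_solution_def, THEN conjunct2, THEN conjunct2, THEN conjunct2, THEN conjunct2]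
    show "\<exists>I. is_ito_integral M \<G> B H s I \<and>
      (AE \<omega> in M. S s \<omega> = S 0 \<omega> + (LBINT v:{0..s}. \<mu> * S v \<omega>) + I \<omega>)"
      unfolding H_def[abs_def] by (rule bspec)
  qed
  \<comment> \<open>One version of the integral is chosen at each time; the resulting family carries
    no regularity in \<open>s\<close>.\<close>
  from bchoice[OF this] obtain I where I': "\<forall>s\<in>{0..u}. is_ito_integral M \<G> B H s (I s) \<and>
      (AE \<omega> in M. S s \<omega> = S 0 \<omega> + (LBINT v:{0..s}. \<mu> * S v \<omega>) + I s \<omega>)"
    by (rule exE)
  have ito: "is_ito_integral M \<G> B H s (I s)" if "s \<in> {0..u}" for s
    by (rule conjunct1[OF bspec[OF I' that]])
  have I: "AE \<omega> in M. S s \<omega> = S 0 \<omega> + (LBINT v:{0..s}. \<mu> * S v \<omega>) + I s \<omega>" if "s \<in> {0..u}" for s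
    by (rule conjunct2[OF bspec[OF I' that]])
  have "u \<in> {0..u}"
    using \<open>0 < u\<close> by simp
  from ito[OF this] obtain n ts \<xi> where simple: "\<And>k. simple_integrand M \<G> (n k) (ts k) (\<xi> k)"
    and conv: "converges_in_probability M
        (\<lambda>k \<omega>. LBINT s:{0..u}. (simple_process (n k) (ts k) (\<xi> k) s \<omega> - H s \<omega>)\<^sup>2) (\<lambda>_. 0)"
    unfolding is_ito_integral_def by blast
  let ?H = "\<lambda>k. simple_process (n k) (ts k) (\<xi> k)"
  let ?J = "\<lambda>k. simple_integral B (n k) (ts k) (\<xi> k)"
  define D where "D k \<omega> = (LBINT s:{0..u}. (?H k s \<omega> - H s \<omega>)\<^sup>2)" for k \<omega>
  have D_meas: "D k \<in> borel_measurable M" for k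
    using conv unfolding converges_in_probability_def D_def[abs_def] by blast
  have D_nonneg: "0 \<le> D k \<omega>" for k \<omega>
    unfolding D_def set_lebesgue_integral_def by (intro Bochner_Integration.integral_nonneg) auto
  have D_lim: "(\<lambda>k. \<P>(\<omega> in M. \<delta> < D k \<omega>)) \<longlonglongrightarrow> 0" if "0 < \<delta>" for \<delta>
    using conv that D_nonneg unfolding converges_in_probability_def D_def[symmetric] by simp
  \<comment> \<open>The drift \<open>\<mu> * S\<close> equals \<theta> times the integrand
    \<open>\<sigma> * S\<close>, so the simple processes that approximate the integrand approximate
    the drift as well.\<close>
  define \<theta> where "\<theta> = \<mu> / \<sigma>"
  have \<theta>\<sigma>: "\<theta> * \<sigma> = \<mu>"
    using \<open>0 < \<sigma>\<close> by (simp add: \<theta>_def)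
  define \<rho> where "\<rho> d x = exp (- (\<mu> - \<sigma>\<^sup>2 / 2) * d - \<sigma> * x)" for d x
  obtain C where "0 < C"
    and noise1: "\<And>d X. 0 < d \<Longrightarrow> d \<le> 1 \<Longrightarrow> distributed M lborel X (normal_density 0 (sqrt d)) \<Longrightarrow>
      integrable M (\<lambda>\<omega>. (\<rho> d (X \<omega>) * (\<theta> * d + X \<omega>))\<^sup>2) \<and>
      \<bar>expectation (\<lambda>\<omega>. \<rho> d (X \<omega>) * (\<theta> * d + X \<omega>))\<bar> \<le> C * d \<and>
      expectation (\<lambda>\<omega>. (\<rho> d (X \<omega>) * (\<theta> * d + X \<omega>))\<^sup>2) \<le> C * d"
    and noise2: "\<And>d X. 0 < d \<Longrightarrow> d \<le> 1 \<Longrightarrow> distributed M lborel X (normal_density 0 (sqrt d)) \<Longrightarrow>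
      integrable M (\<lambda>\<omega>. (\<rho> d (X \<omega>) * (1 + \<mu> * d + \<sigma> * X \<omega>) - 1)\<^sup>2) \<and>
      \<bar>expectation (\<lambda>\<omega>. \<rho> d (X \<omega>) * (1 + \<mu> * d + \<sigma> * X \<omega>) - 1)\<bar> \<le> C * d\<^sup>2 \<and>
      expectation (\<lambda>\<omega>. (\<rho> d (X \<omega>) * (1 + \<mu> * d + \<sigma> * X \<omega>) - 1)\<^sup>2) \<le> C * d\<^sup>2"
    by (rule one_step_noise_bounds[of \<mu> \<sigma> \<theta>]) (rule that, unfold \<rho>_def)

  \<comment> \<open>Choice of the path bounds, the tolerances, the simple integrand and the
    mesh\<close>
  obtain A1 N1 where A1: "A1 \<in> events" "prob (space M - A1) \<le> \<eta>"
    "\<And>\<omega> s. \<omega> \<in> A1 \<Longrightarrow> s \<in> {0..u} \<Longrightarrow> \<bar>Z s \<omega>\<bar> \<le> real N1"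
  proof (rule continuous_paths_uniform[of u Z 1 \<eta>])
    show "Z s \<in> borel_measurable M" if "0 \<le> s" "s \<le> u" for s
      by (rule measurable_G_M[OF Z_meas[OF that(1) order_refl]])
  qed (rule Z_cont, rule zero_less_one, rule \<open>0 < \<eta>\<close>, rule that)
  obtain A2 N2 where A2: "A2 \<in> events" "prob (space M - A2) \<le> \<eta>"
    "\<And>\<omega> s. \<omega> \<in> A2 \<Longrightarrow> s \<in> {0..u} \<Longrightarrow> \<bar>S s \<omega>\<bar> \<le> real N2"
    by (rule continuous_paths_uniform[of u S 1 \<eta>])
      (rule S_meas, assumption, assumption, rule S_cont, rule zero_less_one, rule \<open>0 < \<eta>\<close>, rule that)
  define c where "c = real N1 + real N2 + 1"
  have "1 \<le> c" and Nc: "real N1 \<le> c" "real N2 \<le> c"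
    by (auto simp: c_def)
  define \<kappa> where "\<kappa> = \<bar>\<theta>\<bar> * (u + 1) / 2 + 1"
  have "1 \<le> \<kappa>"
    using \<open>0 < u\<close> by (simp add: \<kappa>_def)
  \<comment> \<open>\<delta> is the admissible quadratic sum in both noise estimates. The first
    entry makes the variance term at most \<eta>, the second provides the smallness condition on the
    drift of the noise.\<close>
  define \<delta> where "\<delta> = min (e\<^sup>2 * \<eta> / (4 * C)) ((e / (2 * C))\<^sup>2 / u)"
  have "0 < \<delta>"
    using \<open>0 < e\<close> \<open>0 < \<eta>\<close> \<open>0 < C\<close> \<open>0 < u\<close> by (simp add: \<delta>_def)
  have \<delta>1: "4 * C * \<delta> / e\<^sup>2 \<le> \<eta>"
  proof -
    have "\<delta> \<le> e\<^sup>2 * \<eta> / (4 * C)"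
      by (simp add: \<delta>_def)
    then show ?thesis
      using \<open>0 < e\<close> \<open>0 < C\<close> by (simp add: field_simps)
  qed
  have \<delta>2: "C * sqrt (\<delta> * u) \<le> e / 2"
  proof -
    have "\<delta> * u \<le> (e / (2 * C))\<^sup>2"
      using \<open>0 < u\<close> by (simp add: \<delta>_def pos_le_divide_eq[symmetric])
    then have "sqrt (\<delta> * u) \<le> e / (2 * C)"
      using \<open>0 < e\<close> \<open>0 < C\<close> by (intro real_le_lsqrt) auto
    then show ?thesis
      using \<open>0 < C\<close> by (simp add: field_simps)
  qed
  \<comment> \<open>\<open>K1 * \<epsilon>\<^sup>2\<close> will bound the quadratic sum of
    \<open>\<eta>1\<close>: c^2 bounds the square of \<open>Z\<close>, the other factor is the
    constant of the Euler estimate.\<close>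
  define K1 where "K1 = c\<^sup>2 * (2 + 2 * \<sigma>\<^sup>2 * (1 + \<kappa>)\<^sup>2 * u)"
  have "0 < K1"
    unfolding K1_def using \<open>1 \<le> c\<close> \<open>0 < u\<close> by (intro mult_pos_pos add_pos_nonneg) auto
  \<comment> \<open>The three entries bring the quadratic sum of \<open>\<eta>1\<close> below
    \<delta>, keep \<open>W\<close> within \<kappa> of \<open>S\<close>, and make the error of
    \<open>W\<close> times the bound for \<open>Z\<close> at most \<open>e\<close>.\<close>
  define \<epsilon> where "\<epsilon> = min (sqrt (\<delta> / K1)) (min 1 (e / (\<kappa> * c)))"
  have "0 < \<epsilon>" "\<epsilon> \<le> 1"
    using \<open>0 < \<delta>\<close> \<open>0 < K1\<close> \<open>0 < e\<close> \<open>1 \<le> \<kappa>\<close> \<open>1 \<le> c\<close> by (auto simp: \<epsilon>_def)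
  have \<epsilon>1: "K1 * \<epsilon>\<^sup>2 \<le> \<delta>"
  proof -
    have "\<epsilon>\<^sup>2 \<le> (sqrt (\<delta> / K1))\<^sup>2"
      using \<open>0 < \<epsilon>\<close> by (intro power_mono) (auto simp: \<epsilon>_def)
    also have "\<dots> = \<delta> / K1"
      using \<open>0 < \<delta>\<close> \<open>0 < K1\<close> by simp
    finally show ?thesis
      using \<open>0 < K1\<close> by (simp add: field_simps)
  qed
  have \<epsilon>2: "\<kappa> * \<epsilon> * c \<le> e"
  proof -
    have "\<epsilon> \<le> e / (\<kappa> * c)"
      by (simp add: \<epsilon>_def)
    then show ?thesis
      using \<open>1 \<le> \<kappa>\<close> \<open>1 \<le> c\<close> by (simp add: field_simps)
  qed
  obtain A3 N3 where A3: "A3 \<in> events" "prob (space M - A3) \<le> \<eta>"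
    "\<And>\<omega> s s'. \<omega> \<in> A3 \<Longrightarrow> s \<in> {0..u} \<Longrightarrow> s' \<in> {0..u} \<Longrightarrow> \<bar>s - s'\<bar> < 1 / real (Suc N3) \<Longrightarrow> \<bar>S s \<omega> - S s' \<omega>\<bar> \<le> \<epsilon>"
    by (rule continuous_paths_uniform[of u S \<epsilon> \<eta>])
      (rule S_meas, assumption, assumption, rule S_cont, rule \<open>0 < \<epsilon>\<close>, rule \<open>0 < \<eta>\<close>, rule that)

  \<comment> \<open>The index is fixed here, before the partition, because the partition has to
    refine \<open>ts k\<close>; the bound for every finite \<open>P\<close> is what permits
    this.\<close>
  obtain k where k1: "\<P>(\<omega> in M. \<epsilon>\<^sup>2 < D k \<omega>) \<le> \<eta>"
    and k2: "\<And>P. finite P \<Longrightarrow> P \<subseteq> {0..u} \<Longrightarrow>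
      \<P>(\<omega> in M. \<exists>p\<in>P. \<epsilon> < \<bar>?J k p \<omega> - I p \<omega>\<bar>) \<le> \<eta>"
  proof -
    have "\<exists>k0. \<forall>k\<ge>k0. \<forall>P. finite P \<longrightarrow> P \<subseteq> {0..u} \<longrightarrow>
      \<P>(\<omega> in M. \<exists>p\<in>P. \<epsilon> < \<bar>?J k p \<omega> - I p \<omega>\<bar>) \<le> \<eta>"
      by (rule ito_approximation_uniform[OF less_imp_le[OF \<open>0 < u\<close>] H_cont ito simple conv \<open>0 < \<epsilon>\<close> \<open>0 < \<eta>\<close>])
    then obtain k0 where k0: "\<And>k P. k \<ge> k0 \<Longrightarrow> finite P \<Longrightarrow> P \<subseteq> {0..u} \<Longrightarrow>
      \<P>(\<omega> in M. \<exists>p\<in>P. \<epsilon> < \<bar>?J k p \<omega> - I p \<omega>\<bar>) \<le> \<eta>"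
      by blast
    have "eventually (\<lambda>k. \<P>(\<omega> in M. \<epsilon>\<^sup>2 < D k \<omega>) < \<eta>) sequentially"
      using D_lim[of "\<epsilon>\<^sup>2"] \<open>0 < \<epsilon>\<close> \<open>0 < \<eta>\<close> by (intro order_tendstoD) auto
    then obtain k1 where "\<And>k. k \<ge> k1 \<Longrightarrow> \<P>(\<omega> in M. \<epsilon>\<^sup>2 < D k \<omega>) < \<eta>"
      by (auto simp: eventually_sequentially)
    then show thesis
      using k0 by (intro that[of "max k0 k1"]) (auto simp: less_imp_le)
  qed
  \<comment> \<open>The entries make the one-step moment bounds applicable, hold the steps below the
    modulus of continuity (strictly, by the factor 2), and bring the quadratic sum of
    \<open>\<eta>2\<close> below \<delta>.\<close>
  define h where "h = min (min 1 (1 / (2 * real (Suc N3)))) (\<delta> / (c\<^sup>2 * (c + \<kappa>)\<^sup>2 * u))"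
  have "0 < h"
    using \<open>0 < \<delta>\<close> \<open>1 \<le> c\<close> \<open>1 \<le> \<kappa>\<close> \<open>0 < u\<close> by (simp add: h_def)
  have "h \<le> 1"
    unfolding h_def by linarith
  have h1: "h < 1 / real (Suc N3)"
  proof -
    have "h \<le> 1 / (2 * real (Suc N3))"
      unfolding h_def by linarith
    also have "\<dots> < 1 / real (Suc N3)"
      by (intro divide_strict_left_mono) auto
    finally show ?thesis .
  qed
  have h2: "h * (c\<^sup>2 * (c + \<kappa>)\<^sup>2 * u) \<le> \<delta>"
  proof -
    have "0 < c\<^sup>2 * (c + \<kappa>)\<^sup>2 * u"
      using \<open>1 \<le> c\<close> \<open>1 \<le> \<kappa>\<close> \<open>0 < u\<close> by (intro mult_pos_pos) auto
    moreover have "h \<le> \<delta> / (c\<^sup>2 * (c + \<kappa>)\<^sup>2 * u)"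
      by (simp add: h_def)
    ultimately show ?thesis
      by (simp only: pos_le_divide_eq)
  qed
  obtain m p where p: "refines m p (n k) (ts k)" "p m = u" and mesh: "\<And>i. i < m \<Longrightarrow> p (Suc i) - p i \<le> h"
    by (rule exists_fine_refinement[OF \<open>0 < u\<close> \<open>0 < h\<close>]) (rule that)
  have lt: "p i < p (Suc i)" if "i < m" for i
    using p(1) that by (auto simp: refines_def)
  have p0: "p 0 = 0"
    using p(1) by (auto simp: refines_def)
  have pi: "0 \<le> p i" "p i \<le> u" if "i \<le> m" for i
    using refines_nonneg[OF p(1) that] refines_mono[OF p(1) that] p(2) by auto

  \<comment> \<open>The Euler scheme and the decomposition of its product with
    \<open>Z\<close>\<close>
  define d where "d i = p (Suc i) - p i" for i
  define b where "b i \<omega> = B (p (Suc i)) \<omega> - B (p i) \<omega>" for i \<omega>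
  define \<zeta> where "\<zeta> i = ?H k (p (Suc i))" for i
  define W where "W i \<omega> = x0 + (\<Sum>j<i. \<zeta> j \<omega> * (\<theta> * d j + b j \<omega>))" for i \<omega>
  define U where "U i \<omega> = \<rho> (d i) (b i \<omega>) * (\<theta> * d i + b i \<omega>)" for i \<omega>
  \<comment> \<open>The raw noise has mean and second moment of order d^2. Division by
    \<open>sqrt h\<close> leaves both at most \<open>C * d i\<close>, as d <= h <= 1, so
    \<open>U\<close> and \<open>V\<close> fit the same inequality. The factor returned to
    \<open>\<eta>2\<close> makes its quadratic sum of order \<open>h\<close>.\<close>
  define V where "V i \<omega> = (\<rho> (d i) (b i \<omega>) * (1 + \<mu> * d i + \<sigma> * b i \<omega>) - 1) / sqrt h" for i \<omega>
  define \<eta>1 where "\<eta>1 i \<omega> = Z (p i) \<omega> * (\<zeta> i \<omega> - \<sigma> * W i \<omega>)" for i \<omega>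
  define \<eta>2 where "\<eta>2 i \<omega> = sqrt h * (Z (p i) \<omega> * W i \<omega>)" for i \<omega>
  have d: "0 < d i" "d i \<le> h" "d i \<le> 1" if "i < m" for i
    using lt[OF that] mesh[OF that] \<open>h \<le> 1\<close> by (auto simp: d_def)
  have sum_d: "(\<Sum>i<m. d i) = u"
    unfolding d_def sum_lessThan_telescope by (simp add: p(2) p0)
  \<comment> \<open>An exact product rule. \<open>Z\<close> is multiplied by \<rho> and
    \<open>W\<close> grows by \<open>\<zeta> i\<close> times \<open>\<theta> * d i + b i\<close>;
    adding and subtracting \<open>\<sigma> * W i\<close> next to \<open>\<zeta> i\<close> separates
    the approximation error from the Euler factor, using
    \<open>\<theta> * \<sigma> = \<mu>\<close>.\<close>
  have scheme: "W i \<omega> * Z (p i) \<omega> = x0 * Z 0 \<omega> + (\<Sum>j<i. \<eta>1 j \<omega> * U j \<omega>) + (\<Sum>j<i. \<eta>2 j \<omega> * V j \<omega>)" for i \<omega>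
  proof (induction i)
    case (Suc i)
    have Z_Suc: "Z (p (Suc i)) \<omega> = Z (p i) \<omega> * \<rho> (d i) (b i \<omega>)"
      unfolding Z_def \<rho>_def exp_add[symmetric] by (simp add: d_def b_def algebra_simps diff_divide_distrib)
    have W_Suc: "W (Suc i) \<omega> = W i \<omega> + \<zeta> i \<omega> * (\<theta> * d i + b i \<omega>)"
      by (simp add: W_def)
    have "\<eta>2 i \<omega> * V i \<omega> = Z (p i) \<omega> * W i \<omega> * (\<rho> (d i) (b i \<omega>) * (1 + \<mu> * d i + \<sigma> * b i \<omega>) - 1)"
      using \<open>0 < h\<close> by (simp add: \<eta>2_def V_def)
    then have "W (Suc i) \<omega> * Z (p (Suc i)) \<omega> = W i \<omega> * Z (p i) \<omega> + \<eta>1 i \<omega> * U i \<omega> + \<eta>2 i \<omega> * V i \<omega>"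
      unfolding W_Suc Z_Suc \<eta>1_def U_def \<theta>\<sigma>[symmetric] by (simp add: algebra_simps)
    then show ?case
      using Suc.IH by simp
  qed (simp add: W_def p0)

  have \<zeta>_meas: "\<zeta> i \<in> borel_measurable (\<G> (p i))" if "i < m" for i
    unfolding \<zeta>_def by (rule refines_simple_measurable[OF simple p(1) that])
  have b_meas: "b i \<in> borel_measurable (\<G> (p (Suc i)))" if "i < m" for i
    unfolding b_def using pi[of i] lt[OF that] that by (intro borel_measurable_diff B_measurable_G) auto
  have W_meas: "W i \<in> borel_measurable (\<G> (p i))" if "i \<le> m" for i
    unfolding W_def
  proof (intro borel_measurable_add borel_measurable_const borel_measurable_sum borel_measurable_times)
    fix j assume "j \<in> {..<i}"
    then have j: "j < m" "p j \<le> p i" "p (Suc j) \<le> p i"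
      using that refines_mono[OF p(1), of j i] refines_mono[OF p(1), of "Suc j" i] by auto
    show "\<zeta> j \<in> borel_measurable (\<G> (p i))"
      by (rule measurable_G_mono[OF \<zeta>_meas j(2)]) (rule j(1))
    show "b j \<in> borel_measurable (\<G> (p i))"
      by (rule measurable_G_mono[OF b_meas j(3)]) (rule j(1))
  qed
  have Zp_meas: "Z (p i) \<in> borel_measurable (\<G> (p i))" if "i \<le> m" for i
    using pi[OF that] by (intro Z_meas) auto
  have \<eta>1_meas: "\<eta>1 i \<in> borel_measurable (\<G> (p i))" if "i < m" for i
    unfolding \<eta>1_def using \<zeta>_meas[OF that] W_meas[of i] Zp_meas[of i] that by simp
  have \<eta>2_meas: "\<eta>2 i \<in> borel_measurable (\<G> (p i))" if "i < m" for i
    unfolding \<eta>2_def using W_meas[of i] Zp_meas[of i] that by simp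
  have b_dist: "distributed M lborel (b i) (normal_density 0 (sqrt (d i)))" if "i < m" for i
    unfolding b_def[abs_def] d_def using pi[of i] lt[OF that] that by (intro normal_increments) auto
  have b_indep: "indep_of (\<G> (p i)) (b i)" if "i < m" for i
    unfolding b_def[abs_def] using pi[of i] lt[OF that] that by (intro indep_increment_G) auto

  \<comment> \<open>The exceptional event and the pathwise estimates outside it\<close>
  let ?L = "{\<omega> \<in> space M. \<exists>i\<le>m. \<epsilon> < \<bar>?J k (p i) \<omega> - I (p i) \<omega>\<bar>}"
  \<comment> \<open>Five events of probability at most \<eta>: failure of the bound for
    \<open>Z\<close>, of the bound for \<open>S\<close>, of the modulus of continuity, of the
    approximation of the integrand, and of the approximation of the integral at the mesh
    points.\<close>
  define Bad where "Bad = ((space M - A1) \<union> (space M - A2)) \<union> ((space M - A3) \<union> {\<omega> \<in> space M. \<epsilon>\<^sup>2 < D k \<omega>}) \<union>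
    ?L"
  have J_ev: "?L \<in> events"
  proof (rule exists_le_events, rule borel_measurable_diff)
    fix i assume "i \<le> m"
    then have pos: "0 \<le> p i" and "p i \<in> {0..u}"
      using pi[of i] by auto
    show "?J k (p i) \<in> borel_measurable M"
      by (rule simple_integral_measurable[OF simple pos])
    show "I (p i) \<in> borel_measurable M"
      using ito[OF \<open>p i \<in> {0..u}\<close>] unfolding is_ito_integral_def converges_in_probability_def by blast
  qed
  have D_ev: "{\<omega> \<in> space M. \<epsilon>\<^sup>2 < D k \<omega>} \<in> events"
    using D_meas[of k] by measurable
  have Bad_ev: "Bad \<in> events"
    unfolding Bad_def by (intro sets.Un sets.compl_sets A1(1) A2(1) A3(1) J_ev D_ev)
  have Bad_prob: "prob Bad \<le> 5 * \<eta>"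
  proof -
    have "?L =
        {\<omega> \<in> space M. \<exists>q\<in>p ` {..m}. \<epsilon> < \<bar>?J k q \<omega> - I q \<omega>\<bar>}"
      by auto
    moreover have p_range: "p ` {..m} \<subseteq> {0..u}"
      using pi by auto
    ultimately have J: "prob ?L \<le> \<eta>"
      using k2[of "p ` {..m}"] p_range by simp
    have ev: "space M - A1 \<in> events" "space M - A2 \<in> events" "space M - A3 \<in> events"
      by (intro sets.compl_sets A1(1) A2(1) A3(1))+
    have "prob Bad \<le> prob ((space M - A1) \<union> (space M - A2)) + prob ((space M - A3) \<union> {\<omega> \<in> space M. \<epsilon>\<^sup>2 < D k \<omega>}) +
        prob ?L"
      unfolding Bad_def using ev D_ev J_ev by (intro order_trans[OF measure_Un_le] add_right_mono measure_Un_le sets.Un)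
    moreover have "prob ((space M - A1) \<union> (space M - A2)) \<le> \<eta> + \<eta>"
      using A1(2) A2(2) ev by (intro order_trans[OF measure_Un_le] add_mono)
    moreover have "prob ((space M - A3) \<union> {\<omega> \<in> space M. \<epsilon>\<^sup>2 < D k \<omega>}) \<le> \<eta> + \<eta>"
      using A3(2) k1 ev D_ev by (intro order_trans[OF measure_Un_le] add_mono)
    ultimately show ?thesis
      using J by linarith
  qed

  have good: "AE \<omega> in M. \<omega> \<notin> Bad \<longrightarrow> Z 0 \<omega> = 1 \<and> \<bar>S u \<omega> * Z u \<omega> - W m \<omega> * Z u \<omega>\<bar> \<le> e \<and>
      (\<Sum>i<m. (\<eta>1 i \<omega>)\<^sup>2 * d i) \<le> \<delta> \<and> (\<Sum>i<m. (\<eta>2 i \<omega>)\<^sup>2 * d i) \<le> \<delta>"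
  proof -
    have "AE \<omega> in M. \<forall>i\<in>{..m}. S (p i) \<omega> = S 0 \<omega> + (LBINT v:{0..p i}. \<mu> * S v \<omega>) + I (p i) \<omega>"
      using pi by (intro AE_finite_allI I) auto
    moreover have "AE \<omega> in M. S 0 \<omega> = x0"
      using S by (simp add: sde_solution_def)
    ultimately show ?thesis
      using S_cont B_0 AE_space
    proof eventually_elim
      case (elim \<omega>)
      show ?case
      proof
        assume "\<omega> \<notin> Bad"
        then have \<omega>: "\<omega> \<in> A1" "\<omega> \<in> A2" "\<omega> \<in> A3" "D k \<omega> \<le> \<epsilon>\<^sup>2"
          and J: "\<And>i. i \<le> m \<Longrightarrow> \<bar>?J k (p i) \<omega> - I (p i) \<omega>\<bar> \<le> \<epsilon>"
          using elim(5) by (auto simp: Bad_def not_less)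
        have osc: "\<bar>S s \<omega> - S (p i) \<omega>\<bar> \<le> \<epsilon>" if i: "i < m" and s: "s \<in> {p i<..p (Suc i)}" for i s
        proof (rule A3(3)[OF \<omega>(3)])
          show "s \<in> {0..u}" "p i \<in> {0..u}"
            using pi[of i] pi[of "Suc i"] i s by auto
          have "\<bar>s - p i\<bar> \<le> h"
            using s mesh[OF i] by auto
          then show "\<bar>s - p i\<bar> < 1 / real (Suc N3)"
            using h1 by linarith
        qed
        have step: "?H k s \<omega> = \<zeta> i \<omega>" if "i < m" "s \<in> {p i<..p (Suc i)}" for i s
          unfolding \<zeta>_def by (rule refines_simple_process[OF p(1) that])
        have dist: "(LBINT s:{0..u}. (?H k s \<omega> - \<sigma> * S s \<omega>)\<^sup>2) \<le> \<epsilon>\<^sup>2"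
          using \<omega>(4) by (simp add: D_def H_def)
        have eqn: "S (p i) \<omega> = x0 + (LBINT s:{0..p i}. \<theta> * (\<sigma> * S s \<omega>)) + I (p i) \<omega>" if "i \<le> m" for i
          using elim(1,2) that by (simp add: mult.assoc[symmetric] \<theta>\<sigma>)
        have Weq: "W i \<omega> = x0 + \<theta> * (\<Sum>j<i. \<zeta> j \<omega> * (p (Suc j) - p j)) + ?J k (p i) \<omega>"
          if "i \<le> m" for i
          unfolding refines_simple_integral[OF simple p(1) that] W_def \<zeta>_def[symmetric] d_def b_def
          by (simp add: sum_distrib_left sum.distrib[symmetric] algebra_simps)
        note facts = p0 lt p(2) simple_process_borel simple_process_bounded step elim(3) dist eqn J osc Weq
          \<open>0 < \<epsilon>\<close> \<kappa>_def
        note euler = euler_scheme_error[where x="\<lambda>s. S s \<omega>" and h="\<lambda>s. ?H k s \<omega>"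
            and p=p and m=m and u=u and \<xi>="\<lambda>i. \<zeta> i \<omega>" and I="\<lambda>i. I (p i) \<omega>"
            and J="\<lambda>i. ?J k (p i) \<omega>" and W="\<lambda>i. W i \<omega>" and \<sigma>=\<sigma> and \<theta>=\<theta>
            and \<epsilon>=\<epsilon> and \<kappa>=\<kappa> and b="\<Sum>i<n k. \<bar>\<xi> k i \<omega>\<bar>"]
        have err: "\<bar>W i \<omega> - S (p i) \<omega>\<bar> \<le> \<kappa> * \<epsilon>" if "i \<le> m" for i
          by (rule euler(1)) (assumption | rule facts | rule that)+
        have quad: "(\<Sum>i<m. (\<zeta> i \<omega> - \<sigma> * W i \<omega>)\<^sup>2 * d i) \<le> (2 + 2 * \<sigma>\<^sup>2 * (1 + \<kappa>)\<^sup>2 * u) * \<epsilon>\<^sup>2"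
          unfolding d_def by (rule euler(2)) (assumption | rule facts)+
        have Zc: "\<bar>Z (p i) \<omega>\<bar> \<le> c" if "i \<le> m" for i
          using A1(3)[OF \<omega>(1), of "p i"] pi[OF that] Nc by auto
        have Wc: "\<bar>W i \<omega>\<bar> \<le> c + \<kappa>" if "i \<le> m" for i
        proof -
          have "\<bar>S (p i) \<omega>\<bar> \<le> c"
            using A2(3)[OF \<omega>(2), of "p i"] pi[OF that] Nc by auto
          moreover have "\<kappa> * \<epsilon> \<le> \<kappa>"
            using \<open>1 \<le> \<kappa>\<close> \<open>\<epsilon> \<le> 1\<close> by (simp add: mult_left_le)
          ultimately show ?thesis
            using err[OF that] by linarith
        qed
        have "Z 0 \<omega> = 1"
          using elim(4) by (simp add: Z_def)
        moreover have "\<bar>S u \<omega> * Z u \<omega> - W m \<omega> * Z u \<omega>\<bar> \<le> e"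
        proof -
          have "\<bar>S u \<omega> * Z u \<omega> - W m \<omega> * Z u \<omega>\<bar> = \<bar>W m \<omega> - S (p m) \<omega>\<bar> * \<bar>Z (p m) \<omega>\<bar>"
            by (simp add: p(2) left_diff_distrib[symmetric] abs_mult abs_minus_commute)
          also have "\<dots> \<le> (\<kappa> * \<epsilon>) * c"
            using err[of m] Zc[of m] \<open>1 \<le> \<kappa>\<close> \<open>0 < \<epsilon>\<close> by (intro mult_mono) auto
          finally show ?thesis
            using \<epsilon>2 by linarith
        qed
        moreover have "(\<Sum>i<m. (\<eta>1 i \<omega>)\<^sup>2 * d i) \<le> \<delta>"
        proof -
          have "(\<Sum>i<m. (\<eta>1 i \<omega>)\<^sup>2 * d i) \<le> (\<Sum>i<m. c\<^sup>2 * ((\<zeta> i \<omega> - \<sigma> * W i \<omega>)\<^sup>2 * d i))"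
          proof (rule sum_mono)
            fix i assume i: "i \<in> {..<m}"
            have "(Z (p i) \<omega>)\<^sup>2 \<le> c\<^sup>2"
              using power_mono[OF Zc[of i] abs_ge_zero, of 2] i by simp
            then have "(Z (p i) \<omega>)\<^sup>2 * ((\<zeta> i \<omega> - \<sigma> * W i \<omega>)\<^sup>2 * d i) \<le> c\<^sup>2 * ((\<zeta> i \<omega> - \<sigma> * W i \<omega>)\<^sup>2 * d i)"
              using d[of i] i by (intro mult_right_mono) auto
            then show "(\<eta>1 i \<omega>)\<^sup>2 * d i \<le> c\<^sup>2 * ((\<zeta> i \<omega> - \<sigma> * W i \<omega>)\<^sup>2 * d i)"
              by (simp add: \<eta>1_def power_mult_distrib mult.assoc)
          qed
          also have "\<dots> \<le> c\<^sup>2 * ((2 + 2 * \<sigma>\<^sup>2 * (1 + \<kappa>)\<^sup>2 * u) * \<epsilon>\<^sup>2)"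
            unfolding sum_distrib_left[symmetric] using quad by (intro mult_left_mono) auto
          also have "\<dots> = K1 * \<epsilon>\<^sup>2"
            by (simp add: K1_def mult.assoc)
          finally show ?thesis
            using \<epsilon>1 by linarith
        qed
        moreover have "(\<Sum>i<m. (\<eta>2 i \<omega>)\<^sup>2 * d i) \<le> \<delta>"
        proof -
          have "(\<Sum>i<m. (\<eta>2 i \<omega>)\<^sup>2 * d i) \<le> (\<Sum>i<m. (h * (c\<^sup>2 * (c + \<kappa>)\<^sup>2)) * d i)"
          proof (rule sum_mono)
            fix i assume i: "i \<in> {..<m}"
            have "(Z (p i) \<omega>)\<^sup>2 \<le> c\<^sup>2" "(W i \<omega>)\<^sup>2 \<le> (c + \<kappa>)\<^sup>2"
              using power_mono[OF Zc[of i] abs_ge_zero, of 2] power_mono[OF Wc[of i] abs_ge_zero, of 2] i by simp_all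
            then have "(Z (p i) \<omega>)\<^sup>2 * (W i \<omega>)\<^sup>2 \<le> c\<^sup>2 * (c + \<kappa>)\<^sup>2"
              by (intro mult_mono) auto
            then have "h * ((Z (p i) \<omega>)\<^sup>2 * (W i \<omega>)\<^sup>2) \<le> h * (c\<^sup>2 * (c + \<kappa>)\<^sup>2)"
              using \<open>0 < h\<close> by (intro mult_left_mono) auto
            moreover have "(\<eta>2 i \<omega>)\<^sup>2 = h * ((Z (p i) \<omega>)\<^sup>2 * (W i \<omega>)\<^sup>2)"
              using \<open>0 < h\<close> by (simp add: \<eta>2_def power_mult_distrib)
            ultimately show "(\<eta>2 i \<omega>)\<^sup>2 * d i \<le> (h * (c\<^sup>2 * (c + \<kappa>)\<^sup>2)) * d i"
              using d[of i] i by (intro mult_right_mono) auto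
          qed
          also have "\<dots> = h * (c\<^sup>2 * (c + \<kappa>)\<^sup>2 * u)"
            by (simp only: sum_distrib_left[symmetric] sum_d mult.assoc)
          finally show ?thesis
            using h2 by linarith
        qed
        ultimately show "Z 0 \<omega> = 1 \<and> \<bar>S u \<omega> * Z u \<omega> - W m \<omega> * Z u \<omega>\<bar> \<le> e \<and>
            (\<Sum>i<m. (\<eta>1 i \<omega>)\<^sup>2 * d i) \<le> \<delta> \<and> (\<Sum>i<m. (\<eta>2 i \<omega>)\<^sup>2 * d i) \<le> \<delta>"
          by blast
      qed
    qed
  qed

  \<comment> \<open>Probability bounds for the two noise sums\<close>
  let ?Q = "\<lambda>f. {\<omega> \<in> space M. \<delta> < (\<Sum>i<m. (f i \<omega>)\<^sup>2 * d i)}"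
  let ?E = "\<lambda>f g. {\<omega> \<in> space M. e < \<bar>\<Sum>i<m. f i \<omega> * g i \<omega>\<bar>}"
  have "prob (?Q \<eta>1) \<le> prob Bad"
    by (rule finite_measure_mono_AE[OF _ Bad_ev]) (use good in \<open>eventually_elim, auto\<close>)
  moreover have "prob (?E \<eta>1 U) \<le>
      2 * prob (?Q \<eta>1) + 4 * C * \<delta> / e\<^sup>2"
  proof (rule noise_sum_inequality[where G="\<lambda>i. \<G> (p i)"])
    show "sets (\<G> (p i)) \<subseteq> sets (\<G> (p j))" if "i \<le> j" "j \<le> m" for i j
      using that by (intro G_mono refines_mono[OF p(1)])
    fix i assume i: "i < m"
    show "U i \<in> borel_measurable (\<G> (p (Suc i)))"
      unfolding U_def \<rho>_def using b_meas[OF i] by measurable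
    show "indep_of (\<G> (p i)) (U i)"
      unfolding U_def \<rho>_def
      by (rule indep_of_compose[OF b_indep[OF i], where f="\<lambda>x. exp (- (\<mu> - \<sigma>\<^sup>2 / 2) * d i - \<sigma> * x) * (\<theta> * d i + x)"]) measurable
    show "integrable M (\<lambda>\<omega>. (U i \<omega>)\<^sup>2)" "\<bar>expectation (U i)\<bar> \<le> C * d i" "expectation (\<lambda>\<omega>. (U i \<omega>)\<^sup>2) \<le> C * d i"
      unfolding U_def using noise1[OF d(1)[OF i] d(3)[OF i] b_dist[OF i]] by auto
    show "\<eta>1 i \<in> borel_measurable (\<G> (p i))" by (rule \<eta>1_meas[OF i])
    show "0 < d i" by (rule d(1)[OF i])
  qed (use \<open>0 < C\<close> \<open>0 < e\<close> \<open>0 < \<delta>\<close> \<delta>2 sum_d subalgebra_G in auto)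
  \<comment> \<open>Outside \<open>Bad\<close> the quadratic sum is almost surely at most \<delta>,
    so its tail costs at most 5 \<eta>. This enters twice, and the choice of \<delta> adds one more
    \<eta>.\<close>
  ultimately have P1: "prob (?E \<eta>1 U) \<le> 11 * \<eta>"
    using Bad_prob \<delta>1 by linarith
  have "prob (?Q \<eta>2) \<le> prob Bad"
    by (rule finite_measure_mono_AE[OF _ Bad_ev]) (use good in \<open>eventually_elim, auto\<close>)
  moreover have "prob (?E \<eta>2 V) \<le>
      2 * prob (?Q \<eta>2) + 4 * C * \<delta> / e\<^sup>2"
  proof (rule noise_sum_inequality[where G="\<lambda>i. \<G> (p i)"])
    show "sets (\<G> (p i)) \<subseteq> sets (\<G> (p j))" if "i \<le> j" "j \<le> m" for i j
      using that by (intro G_mono refines_mono[OF p(1)])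
    fix i assume i: "i < m"
    show "V i \<in> borel_measurable (\<G> (p (Suc i)))"
      unfolding V_def \<rho>_def using b_meas[OF i] by measurable
    show "indep_of (\<G> (p i)) (V i)"
      unfolding V_def \<rho>_def
      by (rule indep_of_compose[OF b_indep[OF i], where
          f="\<lambda>x. (exp (- (\<mu> - \<sigma>\<^sup>2 / 2) * d i - \<sigma> * x) * (1 + \<mu> * d i + \<sigma> * x) - 1) / sqrt h"]) measurable
    note noise = noise2[OF d(1)[OF i] d(3)[OF i] b_dist[OF i]]
    have V2: "(V i \<omega>)\<^sup>2 = (\<rho> (d i) (b i \<omega>) * (1 + \<mu> * d i + \<sigma> * b i \<omega>) - 1)\<^sup>2 / h" for \<omega>
      using \<open>0 < h\<close> by (simp add: V_def power_divide)
    show "integrable M (\<lambda>\<omega>. (V i \<omega>)\<^sup>2)"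
      unfolding V2 using noise by simp
    have sq: "(d i)\<^sup>2 \<le> d i * h"
      using d[OF i] by (simp add: power2_eq_square)
    have "expectation (\<lambda>\<omega>. (V i \<omega>)\<^sup>2) \<le> C * (d i)\<^sup>2 / h"
      unfolding V2 using noise \<open>0 < h\<close> by (simp add: divide_right_mono)
    also have "\<dots> \<le> C * (d i * h) / h"
      using sq \<open>0 < C\<close> \<open>0 < h\<close> by (intro divide_right_mono mult_left_mono) auto
    finally show "expectation (\<lambda>\<omega>. (V i \<omega>)\<^sup>2) \<le> C * d i"
      using \<open>0 < h\<close> by simp
    have hs: "h \<le> sqrt h"
      using \<open>0 < h\<close> \<open>h \<le> 1\<close> by (intro real_le_rsqrt) (simp add: power2_eq_square mult_left_le)
    have "\<bar>expectation (V i)\<bar> = \<bar>expectation (\<lambda>\<omega>. \<rho> (d i) (b i \<omega>) * (1 + \<mu> * d i + \<sigma> * b i \<omega>) - 1)\<bar> / sqrt h"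
      unfolding V_def using \<open>0 < h\<close> by (simp add: abs_divide)
    also have "\<dots> \<le> C * (d i)\<^sup>2 / sqrt h"
      using noise \<open>0 < h\<close> by (intro divide_right_mono) auto
    also have "\<dots> \<le> C * (d i * sqrt h) / sqrt h"
      using sq hs \<open>0 < C\<close> \<open>0 < h\<close> d[OF i]
      by (intro divide_right_mono mult_left_mono order_trans[OF sq]) auto
    finally show "\<bar>expectation (V i)\<bar> \<le> C * d i"
      using \<open>0 < h\<close> by simp
    show "\<eta>2 i \<in> borel_measurable (\<G> (p i))" by (rule \<eta>2_meas[OF i])
    show "0 < d i" by (rule d(1)[OF i])
  qed (use \<open>0 < C\<close> \<open>0 < e\<close> \<open>0 < \<delta>\<close> \<delta>2 sum_d subalgebra_G in auto)
  ultimately have P2: "prob (?E \<eta>2 V) \<le> 11 * \<eta>"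
    using Bad_prob \<delta>1 by linarith

  have bM: "b i \<in> borel_measurable M" if "i < m" for i
    by (rule measurable_G_M[OF b_meas[OF that]])
  have sum_ev: "?E f g \<in> events"
    if "\<And>i. i < m \<Longrightarrow> f i \<in> borel_measurable M" "\<And>i. i < m \<Longrightarrow> g i \<in> borel_measurable M" for f g
  proof -
    have "(\<lambda>\<omega>. \<Sum>i<m. f i \<omega> * g i \<omega>) \<in> borel_measurable M"
      by (intro borel_measurable_sum borel_measurable_times that) simp_all
    then show ?thesis by measurable
  qed
  have U_M: "U i \<in> borel_measurable M" if "i < m" for i
    unfolding U_def \<rho>_def using bM[OF that] by measurable
  have V_M: "V i \<in> borel_measurable M" if "i < m" for i
    unfolding V_def \<rho>_def using bM[OF that] by measurable
  have E1: "?E \<eta>1 U \<in> events"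
    by (rule sum_ev[OF measurable_G_M[OF \<eta>1_meas] U_M])
  have E2: "?E \<eta>2 V \<in> events"
    by (rule sum_ev[OF measurable_G_M[OF \<eta>2_meas] V_M])
  have "\<bar>S u \<omega> * Z u \<omega> - x0\<bar> \<le> 3 * e"
    if "\<bar>S u \<omega> * Z u \<omega> - W m \<omega> * Z u \<omega>\<bar> \<le> e" "Z 0 \<omega> = 1"
      "\<bar>\<Sum>i<m. \<eta>1 i \<omega> * U i \<omega>\<bar> \<le> e" "\<bar>\<Sum>i<m. \<eta>2 i \<omega> * V i \<omega>\<bar> \<le> e" for \<omega>
    using scheme[of m \<omega>] that by (simp add: p(2))
  then have "AE \<omega> in M. \<omega> \<in> {\<omega> \<in> space M. 3 * e < \<bar>S u \<omega> * Z u \<omega> - x0\<bar>} \<longrightarrow>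
      \<omega> \<in> Bad \<union> (?E \<eta>1 U \<union>
        ?E \<eta>2 V)"
    using good by (auto elim!: eventually_mono simp: not_less[symmetric])
  then have "\<P>(\<omega> in M. 3 * e < \<bar>S u \<omega> * Z u \<omega> - x0\<bar>) \<le>
      prob (Bad \<union> (?E \<eta>1 U \<union>
        ?E \<eta>2 V))"
    using Bad_ev E1 E2 by (intro finite_measure_mono_AE) auto
  also have "\<dots> \<le> 5 * \<eta> + (11 * \<eta> + 11 * \<eta>)"
    by (intro order_trans[OF measure_Un_le] add_mono Bad_prob P1 P2 Bad_ev E1 E2 sets.Un)
  finally show ?thesis
    by simp
qed

text \<open>For fixed tolerance the free \<eta> forces probability 0; the tolerances
  \<open>1 / real (Suc j)\<close> form a countable family, so their null sets can be united. Time 0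
  is settled by the initial condition, since the deviation estimate concerns positive times.\<close>

theorem sde_solution_geometric_brownian_motion:
  fixes \<mu> \<sigma> x0 :: real
  assumes S: "sde_solution M \<G> B T (\<lambda>_ x. \<mu> * x) (\<lambda>_ x. \<sigma> * x) x0 S"
    and "0 < \<sigma>" "0 \<le> u" "u \<le> T"
  shows "AE \<omega> in M. S u \<omega> = x0 * exp ((\<mu> - \<sigma>\<^sup>2 / 2) * u + \<sigma> * B u \<omega>)"
proof (cases "u = 0")
  case True
  have "AE \<omega> in M. S 0 \<omega> = x0"
    using S by (simp add: sde_solution_def)
  then show ?thesis
    using B_0 unfolding True by eventually_elim simp
next
  case False
  then have "0 < u"
    using \<open>0 \<le> u\<close> by simp
  define Y where "Y \<omega> = S u \<omega> * exp (- (\<mu> - \<sigma>\<^sup>2 / 2) * u - \<sigma> * B u \<omega>) - x0" for \<omega>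
  have "S u \<in> borel_measurable M"
    using S \<open>0 \<le> u\<close> \<open>u \<le> T\<close> by (intro measurable_G_M[of _ u]) (auto simp: sde_solution_def)
  then have Y: "Y \<in> borel_measurable M"
    unfolding Y_def using measurable_B[OF \<open>0 \<le> u\<close>] by measurable
  have "AE \<omega> in M. \<bar>Y \<omega>\<bar> \<le> 3 * (1 / real (Suc j))" for j
  proof -
    have ev: "{\<omega> \<in> space M. 3 * (1 / real (Suc j)) < \<bar>Y \<omega>\<bar>} \<in> events"
      using Y by measurable
    have "\<P>(\<omega> in M. 3 * (1 / real (Suc j)) < \<bar>Y \<omega>\<bar>) \<le> 27 * \<eta>" if "0 < \<eta>" for \<eta>
      unfolding Y_def using that \<open>0 < u\<close> assms by (intro sde_solution_deviation) auto
    from this[of "\<eta> / 27" for \<eta>] have "\<P>(\<omega> in M. 3 * (1 / real (Suc j)) < \<bar>Y \<omega>\<bar>) \<le> 0 + \<eta>" if "0 < \<eta>" for \<eta>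
      using that by simp
    then have "\<P>(\<omega> in M. 3 * (1 / real (Suc j)) < \<bar>Y \<omega>\<bar>) \<le> 0"
      by (rule field_le_epsilon)
    then have "\<P>(\<omega> in M. 3 * (1 / real (Suc j)) < \<bar>Y \<omega>\<bar>) = 0"
      by (simp add: measure_le_0_iff)
    then have "AE \<omega> in M. \<omega> \<notin> {\<omega> \<in> space M. 3 * (1 / real (Suc j)) < \<bar>Y \<omega>\<bar>}"
      using prob_eq_0[OF ev] by simp
    then show ?thesis
      using AE_space by eventually_elim (auto simp: not_less)
  qed
  then have "AE \<omega> in M. \<forall>j. \<bar>Y \<omega>\<bar> \<le> 3 * (1 / real (Suc j))"
    by (simp add: AE_all_countable)
  then show ?thesis
  proof eventually_elim
    case (elim \<omega>)
    have "(\<lambda>j. 3 * (1 / real (Suc j))) \<longlonglongrightarrow> 3 * 0"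
      using LIMSEQ_inverse_real_of_nat by (intro tendsto_mult tendsto_const) (simp add: inverse_eq_divide)
    then have "\<bar>Y \<omega>\<bar> \<le> 3 * 0"
      using elim by (intro LIMSEQ_le_const) auto
    then have "S u \<omega> * exp (- ((\<mu> - \<sigma>\<^sup>2 / 2) * u + \<sigma> * B u \<omega>)) = x0"
      by (simp add: Y_def algebra_simps)
    then show ?case
      by (simp add: exp_minus field_simps)
  qed
qed

end

section \<open>Valuation of the call\<close>

text \<open>Independence says that the pair of the sample point, seen through \<open>F\<close>, and
  of \<open>U\<close> has a product law. Integrating \<phi> over an event of \<open>F\<close> is
  then an application of Fubini's theorem. Using the sample point itself as first argument lets
  \<phi> depend on the past in any jointly measurable way.\<close>

lemma (in prob_space) real_cond_exp_independent:
  fixes \<phi> :: "'a \<times> real \<Rightarrow> real"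
  assumes indep: "indep_of F U" and \<phi>: "\<phi> \<in> borel_measurable (F \<Otimes>\<^sub>M borel)"
    and int: "integrable M (\<lambda>\<omega>. \<phi> (\<omega>, U \<omega>))"
  shows "AE \<omega> in M. real_cond_exp M F (\<lambda>\<omega>. \<phi> (\<omega>, U \<omega>)) \<omega> = (\<integral>x. \<phi> (\<omega>, x) \<partial>distr M borel U)"
proof -
  have F: "subalgebra M F" and U: "U \<in> borel_measurable M"
    and prod: "\<And>A D. A \<in> sets F \<Longrightarrow> D \<in> sets borel \<Longrightarrow> prob (A \<inter> (U -` D \<inter> space M)) = prob A * prob (U -` D \<inter> space M)"
    using indep by (auto simp: indep_of_def)
  interpret finite_measure_subalgebra M F
    by unfold_locales (rule F)
  define R where "R = restr_to_subalg M F"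
  define L where "L = distr M borel U"
  have sets_R: "sets R = sets F"
    unfolding R_def by (rule sets_restr_to_subalg[OF F])
  have sets_RL: "sets (R \<Otimes>\<^sub>M L) = sets (F \<Otimes>\<^sub>M borel)"
    by (rule sets_pair_measure_cong) (simp_all add: sets_R L_def)
  interpret R: prob_space R
    unfolding R_def by (rule prob_space_restr_to_subalg[OF F]) unfold_locales
  interpret L: prob_space L
    unfolding L_def by (rule prob_space_distr[OF U])
  interpret RL: pair_sigma_finite R L ..
  have id: "(\<lambda>\<omega>. \<omega>) \<in> measurable M F"
    using F by (auto simp: measurable_def subalgebra_def)
  have pair: "(\<lambda>\<omega>. (\<omega>, U \<omega>)) \<in> measurable M (F \<Otimes>\<^sub>M borel)"
    using id U by (rule measurable_Pair)
  have RL_eq: "R \<Otimes>\<^sub>M L = distr M (F \<Otimes>\<^sub>M borel) (\<lambda>\<omega>. (\<omega>, U \<omega>))"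
  proof (rule pair_measure_eqI)
    show "sigma_finite_measure R" "sigma_finite_measure L"
      by unfold_locales
    show "sets (R \<Otimes>\<^sub>M L) = sets (distr M (F \<Otimes>\<^sub>M borel) (\<lambda>\<omega>. (\<omega>, U \<omega>)))"
      using sets_RL by simp
    fix A D assume "A \<in> sets R" "D \<in> sets L"
    then have A: "A \<in> sets F" and D: "D \<in> sets borel"
      by (simp_all add: sets_R L_def)
    have "A \<times> D \<in> sets (F \<Otimes>\<^sub>M borel)"
      using A D by (rule pair_measureI)
    then have "emeasure (distr M (F \<Otimes>\<^sub>M borel) (\<lambda>\<omega>. (\<omega>, U \<omega>))) (A \<times> D) =
        emeasure M ((\<lambda>\<omega>. (\<omega>, U \<omega>)) -` (A \<times> D) \<inter> space M)"
      by (rule emeasure_distr[OF pair])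
    also have "(\<lambda>\<omega>. (\<omega>, U \<omega>)) -` (A \<times> D) \<inter> space M = A \<inter> (U -` D \<inter> space M)"
      by auto
    also have "emeasure M \<dots> = ennreal (prob A * prob (U -` D \<inter> space M))"
      by (simp add: emeasure_eq_measure prod[OF A D])
    also have "\<dots> = emeasure M A * emeasure M (U -` D \<inter> space M)"
      by (simp add: emeasure_eq_measure ennreal_mult)
    also have "\<dots> = emeasure R A * emeasure L D"
      unfolding R_def L_def using emeasure_restr_to_subalg[OF F A] emeasure_distr[OF U D] by simp
    finally show "emeasure R A * emeasure L D = emeasure (distr M (F \<Otimes>\<^sub>M borel) (\<lambda>\<omega>. (\<omega>, U \<omega>))) (A \<times> D)"
      by simp
  qed
  define g where "g \<omega> = (\<integral>x. \<phi> (\<omega>, x) \<partial>L)" for \<omega>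
  have \<phi>RL: "\<phi> \<in> borel_measurable (R \<Otimes>\<^sub>M L)"
    using \<phi> by (simp add: measurable_cong_sets[OF sets_RL refl])
  have \<phi>_int: "integrable (R \<Otimes>\<^sub>M L) \<phi>"
    unfolding RL_eq using integrable_distr_eq[OF pair \<phi>] int by simp
  have g_R: "g \<in> borel_measurable R"
    unfolding g_def[abs_def] using \<phi>RL by measurable
  have g_F: "g \<in> borel_measurable F"
    using g_R by (simp add: measurable_cong_sets[OF sets_R refl])
  have g_int: "integrable R g"
    unfolding g_def[abs_def] by (rule RL.integrable_fst'[OF \<phi>_int])
  have "AE \<omega> in M. real_cond_exp M F (\<lambda>\<omega>. \<phi> (\<omega>, U \<omega>)) \<omega> = g \<omega>"
  proof (rule real_cond_exp_charact)
    show "integrable M g"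
      using g_int unfolding R_def by (rule integrable_from_subalg[OF F])
    fix A assume A: "A \<in> sets F"
    define \<psi> where "\<psi> z = indicator (A \<times> UNIV) z *\<^sub>R \<phi> z" for z
    have A': "A \<times> UNIV \<in> sets (R \<Otimes>\<^sub>M L)"
      using A by (intro pair_measureI) (simp_all add: sets_R L_def)
    have \<psi>_int: "integrable (R \<Otimes>\<^sub>M L) \<psi>"
      unfolding \<psi>_def[abs_def] using A' \<phi>_int by (rule integrable_mult_indicator)
    have \<psi>_eq: "\<psi> (\<omega>, x) = indicator A \<omega> * \<phi> (\<omega>, x)" for \<omega> x
      by (simp add: \<psi>_def indicator_def)
    have \<psi>_F: "\<psi> \<in> borel_measurable (F \<Otimes>\<^sub>M borel)"
      using borel_measurable_integrable[OF \<psi>_int] by (simp add: measurable_cong_sets[OF sets_RL refl])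
    have "(\<integral>\<omega>\<in>A. \<phi> (\<omega>, U \<omega>) \<partial>M) = (\<integral>\<omega>. \<psi> (\<omega>, U \<omega>) \<partial>M)"
      by (simp add: set_lebesgue_integral_def \<psi>_eq)
    also have "\<dots> = integral\<^sup>L (R \<Otimes>\<^sub>M L) \<psi>"
      unfolding RL_eq by (rule integral_distr[OF pair \<psi>_F, symmetric])
    also have "\<dots> = (\<integral>\<omega>. (\<integral>x. \<psi> (\<omega>, x) \<partial>L) \<partial>R)"
      by (rule RL.integral_fst'[OF \<psi>_int, symmetric])
    also have "\<dots> = (\<integral>\<omega>. indicator A \<omega> * g \<omega> \<partial>R)"
      by (simp add: \<psi>_eq g_def)
    also have "\<dots> = (\<integral>\<omega>. indicator A \<omega> * g \<omega> \<partial>M)"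
      unfolding R_def using A g_F
      by (intro integral_subalgebra2[OF F] borel_measurable_times borel_measurable_indicator)
    finally show "(\<integral>\<omega>\<in>A. \<phi> (\<omega>, U \<omega>) \<partial>M) = (\<integral>\<omega>\<in>A. g \<omega> \<partial>M)"
      by (simp add: set_lebesgue_integral_def)
  qed (rule int, rule g_F)
  then show ?thesis
    by (simp only: g_def L_def)
qed

section \<open>Gaussian integrals behind the call price\<close>

lemma std_normal_cdf_eq_integral:
  "std_normal_cdf b = (\<integral>x. std_normal_density x * indicator {..b} x \<partial>lborel)"
proof -
  have "std_normal_cdf b = (\<integral>x. indicator {..b} x \<partial>std_normal_distribution)"
    by (simp add: std_normal_cdf_def cdf_def)
  also have "\<dots> = (\<integral>x. std_normal_density x *\<^sub>R indicator {..b} x \<partial>lborel)"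
    by (rule integral_density) auto
  finally show ?thesis by simp
qed

text \<open>The substitution \<open>x = m - s * z\<close> reverses the line and turns the upper tail
  into a lower one, which is a value of the distribution function. The end point, open on one side
  and closed on the other, is a null set.\<close>

lemma normal_density_tail:
  assumes "0 < s"
  shows "(\<integral>x. normal_density m s x * indicator {a<..} x \<partial>lborel) = std_normal_cdf ((m - a) / s)"
proof -
  have "(\<integral>x. normal_density m s x * indicator {a<..} x \<partial>lborel) =
      \<bar>- s\<bar> *\<^sub>R (\<integral>z. normal_density m s (m + - s * z) * indicator {a<..} (m + - s * z) \<partial>lborel)"
    using assms by (intro lborel_integral_real_affine) simp
  also have "\<dots> = (\<integral>z. s * (normal_density m s (m + - s * z) * indicator {a<..} (m + - s * z)) \<partial>lborel)"
    using assms by simp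
  also have "\<dots> = (\<integral>z. std_normal_density z * indicator {..(m - a) / s} z \<partial>lborel)"
  proof (rule integral_cong_AE)
    have "s * normal_density m s (m + - s * z) = std_normal_density z" for z
      using assms by (simp add: normal_density_def real_sqrt_mult power_mult_distrib)
    moreover have "a < m - s * z \<longleftrightarrow> z < (m - a) / s" for z
      using assms by (auto simp: field_simps)
    ultimately have "s * (normal_density m s (m + - s * z) * indicator {a<..} (m + - s * z)) =
        std_normal_density z * indicator {..<(m - a) / s} z" for z
      by (simp add: mult.assoc[symmetric] indicator_def)
    then show "AE z in lborel. s * (normal_density m s (m + - s * z) * indicator {a<..} (m + - s * z)) =
        std_normal_density z * indicator {..(m - a) / s} z"
      using AE_lborel_singleton[of "(m - a) / s"] by (auto elim!: eventually_mono simp: indicator_def)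
  qed measurable
  finally show ?thesis
    by (simp only: std_normal_cdf_eq_integral)
qed

text \<open>The option is exercised on a half-line. There the exponential tilts the density of the
  asset term to mean \<open>\<sigma> * s\<^sup>2\<close>, which moves the argument from
  \<open>d2\<close> to \<open>d2 + \<sigma> * s\<close>, while the strike term keeps the original
  density.\<close>

lemma lognormal_call_integral:
  fixes a y K \<sigma> s :: real
  assumes "0 < s" "0 < \<sigma>" "0 < y" "0 < K"
  defines "d2 \<equiv> (ln (y / K) + a) / (\<sigma> * s)"
  shows "(\<integral>x. normal_density 0 s x * max 0 (y * exp (a + \<sigma> * x) - K) \<partial>lborel) =
    y * exp (a + \<sigma>\<^sup>2 * s\<^sup>2 / 2) * std_normal_cdf (d2 + \<sigma> * s) - K * std_normal_cdf d2"
proof -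
  \<comment> \<open>\<open>b\<close> is the value of the Gaussian variable at which the terminal
    price equals the strike.\<close>
  define b where "b = - ((ln (y / K) + a) / \<sigma>)"
  have itm: "K < y * exp (a + \<sigma> * x) \<longleftrightarrow> b < x" for x
  proof -
    have "K < y * exp (a + \<sigma> * x) \<longleftrightarrow> ln K < ln (y * exp (a + \<sigma> * x))"
      using assms by (intro ln_less_cancel_iff[symmetric]) auto
    also have "\<dots> \<longleftrightarrow> ln K < ln y + (a + \<sigma> * x)"
      using assms by (simp add: ln_mult)
    also have "\<dots> \<longleftrightarrow> b < x"
      using assms by (simp add: b_def ln_div field_simps)
    finally show ?thesis .
  qed
  have "normal_density 0 s x * max 0 (y * exp (a + \<sigma> * x) - K) =
      (y * exp (a + \<sigma>\<^sup>2 * s\<^sup>2 / 2)) * (normal_density (\<sigma> * s\<^sup>2) s x * indicator {b<..} x) -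
      K * (normal_density 0 s x * indicator {b<..} x)" for x
  proof -
    have "normal_density 0 s x * (y * exp (a + \<sigma> * x)) = y * exp a * (normal_density 0 s x * exp (\<sigma> * x))"
      by (simp add: exp_add)
    also have "\<dots> = (y * exp (a + \<sigma>\<^sup>2 * s\<^sup>2 / 2)) * normal_density (\<sigma> * s\<^sup>2) s x"
      unfolding normal_density_mult_exp[OF \<open>0 < s\<close>] by (simp add: exp_add)
    finally show ?thesis
      using itm[of x] by (auto simp: indicator_def max_def right_diff_distrib not_less)
  qed
  then have "(\<integral>x. normal_density 0 s x * max 0 (y * exp (a + \<sigma> * x) - K) \<partial>lborel) =
      (\<integral>x. (y * exp (a + \<sigma>\<^sup>2 * s\<^sup>2 / 2)) * (normal_density (\<sigma> * s\<^sup>2) s x * indicator {b<..} x) -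
      K * (normal_density 0 s x * indicator {b<..} x) \<partial>lborel)"
    by (simp only:)
  also have "\<dots> = (y * exp (a + \<sigma>\<^sup>2 * s\<^sup>2 / 2)) * (\<integral>x. normal_density (\<sigma> * s\<^sup>2) s x * indicator {b<..} x \<partial>lborel) -
      K * (\<integral>x. normal_density 0 s x * indicator {b<..} x \<partial>lborel)"
  proof -
    have "integrable lborel (\<lambda>x. normal_density m s x * indicator {b<..} x)" for m
      using integrable_mult_indicator[of "{b<..}" lborel "normal_density m s"] integrable_normal_density[OF \<open>0 < s\<close>, of m]
      by (simp add: mult.commute)
    then show ?thesis
      by (subst Bochner_Integration.integral_diff) simp_all
  qed
  also have "\<dots> = y * exp (a + \<sigma>\<^sup>2 * s\<^sup>2 / 2) * std_normal_cdf ((\<sigma> * s\<^sup>2 - b) / s) - K * std_normal_cdf ((0 - b) / s)"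
    by (simp only: normal_density_tail[OF \<open>0 < s\<close>])
  also have "(0 - b) / s = d2"
    using assms(1,2) by (simp add: b_def d2_def)
  also have "(\<sigma> * s\<^sup>2 - b) / s = d2 + \<sigma> * s"
    using assms(1,2) by (simp add: b_def d2_def field_simps power2_eq_square)
  finally show ?thesis .
qed

context standard_brownian_motion
begin

text \<open>The conditional expectation in the value is taken with respect to the generated
  filtration, so independence is needed in this form besides the augmented one.\<close>

lemma indep_of_increment_F:
  assumes "0 \<le> s" "s < t"
  shows "indep_of (\<F> s) (\<lambda>\<omega>. B t \<omega> - B s \<omega>)"
  unfolding indep_of_def
proof (intro conjI ballI subalgebra_F)
  show "(\<lambda>\<omega>. B t \<omega> - B s \<omega>) \<in> borel_measurable M"
    using assms by (intro borel_measurable_diff measurable_B) auto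
qed (rule indep_increment_F[OF assms])

lemma integrable_exp_B:
  assumes "0 < t"
  shows "integrable M (\<lambda>\<omega>. exp (\<sigma> * B t \<omega>))"
proof -
  have B: "B 0 \<in> borel_measurable M" "B t \<in> borel_measurable M"
    using assms by (auto intro: measurable_B)
  have "distributed M lborel (\<lambda>\<omega>. B t \<omega> - B 0 \<omega>) (normal_density 0 (sqrt (t - 0)))"
    using assms by (intro normal_increments) auto
  from integrable_normal_exp_quadratic[OF this, of \<sigma> 1 0 0]
  have "integrable M (\<lambda>\<omega>. exp (\<sigma> * (B t \<omega> - B 0 \<omega>)))"
    using assms by simp
  moreover have "AE \<omega> in M. exp (\<sigma> * (B t \<omega> - B 0 \<omega>)) = exp (\<sigma> * B t \<omega>)"
    using B_0 by eventually_elim simp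
  ultimately show ?thesis
    using B by (subst (asm) integrable_cong_AE) auto
qed

end

theorem proposition2:
  fixes M :: "'a measure" and B S :: "real \<Rightarrow> 'a \<Rightarrow> real"
    and \<nu> r \<sigma> T K \<tau> C\<^sub>\<tau> J S\<^sub>0 t :: real
  assumes "r < \<nu>" and "0 < r" and "0 < \<sigma>" and "0 < T" and "0 < K" and "0 \<le> C\<^sub>\<tau>" and "0 < S\<^sub>0"
    and J: "J = 1 / 2 * (C\<^sub>\<tau> * \<tau> * \<nu> - \<sigma>\<^sup>2)"
    and B: "standard_brownian_motion M B"
    and S: "sde_solution M (augmented M (natural_filtration M B)) B T
              (\<lambda>_ x. (r - J) * x) (\<lambda>_ x. \<sigma> * x) S\<^sub>0 S"
    and "0 \<le> t" and "t < T"
  shows "AE \<omega> in M.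
    (let d\<^sub>1 = (ln (S t \<omega> / K) + (r - J + \<sigma>\<^sup>2 / 2) * (T - t)) / (\<sigma> * sqrt (T - t));
         d\<^sub>2 = d\<^sub>1 - \<sigma> * sqrt (T - t)
     in european_value M (natural_filtration M B) r T (\<lambda>x. max 0 (x - K)) S t \<omega> =
          exp (- J * (T - t)) * S t \<omega> * std_normal_cdf d\<^sub>1
            - K * exp (- r * (T - t)) * std_normal_cdf d\<^sub>2)"
proof -
  interpret standard_brownian_motion M B by (rule B)
  define \<mu> where "\<mu> = r - J"
  define h where "h = T - t"
  have "0 < h"
    using \<open>t < T\<close> by (simp add: h_def)
  define a where "a = (\<mu> - \<sigma>\<^sup>2 / 2) * h"
  define D where "D \<omega> = B T \<omega> - B t \<omega>" for \<omega>
  \<comment> \<open>\<open>S t\<close> is known to be measurable only for the augmented filtration.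
    Its explicit version \<open>Y\<close> is measurable for the generated one and can therefore be
    held fixed in the conditional expectation.\<close>
  define Y where "Y \<omega> = S\<^sub>0 * exp ((\<mu> - \<sigma>\<^sup>2 / 2) * t + \<sigma> * B t \<omega>)" for \<omega>
  define \<phi> where "\<phi> z = max 0 (Y (fst z) * exp (a + \<sigma> * snd z) - K)" for z
  have St: "AE \<omega> in M. S t \<omega> = Y \<omega>"
    unfolding Y_def \<mu>_def using S \<open>0 < \<sigma>\<close> \<open>0 \<le> t\<close> \<open>t < T\<close>
    by (intro sde_solution_geometric_brownian_motion) auto
  have "AE \<omega> in M. S T \<omega> = S\<^sub>0 * exp ((\<mu> - \<sigma>\<^sup>2 / 2) * T + \<sigma> * B T \<omega>)"
    unfolding \<mu>_def using S \<open>0 < \<sigma>\<close> \<open>0 < T\<close>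
    by (intro sde_solution_geometric_brownian_motion) auto
  moreover have ST: "S\<^sub>0 * exp ((\<mu> - \<sigma>\<^sup>2 / 2) * T + \<sigma> * B T \<omega>) = Y \<omega> * exp (a + \<sigma> * D \<omega>)" for \<omega>
  proof -
    have "q * T + \<sigma> * x = (q * t + \<sigma> * y) + (q * (T - t) + \<sigma> * (x - y))" for q x y
      by (simp add: algebra_simps)
    then show ?thesis
      unfolding Y_def a_def h_def D_def mult.assoc exp_add[symmetric] by metis
  qed
  ultimately have payoff: "AE \<omega> in M. max 0 (S T \<omega> - K) = \<phi> (\<omega>, D \<omega>)"
    by (auto simp: \<phi>_def elim!: eventually_mono)
  have D_indep: "indep_of (\<F> t) D"
    unfolding D_def[abs_def] using \<open>0 \<le> t\<close> \<open>t < T\<close> by (rule indep_of_increment_F)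
  have D_dist: "distributed M lborel D (normal_density 0 (sqrt h))"
    unfolding D_def[abs_def] h_def using \<open>0 \<le> t\<close> \<open>t < T\<close> by (rule normal_increments)
  have D_meas: "D \<in> borel_measurable M"
    using D_indep by (simp add: indep_of_def)
  have Bt: "B t \<in> borel_measurable (\<F> t)"
    using \<open>0 \<le> t\<close> by (intro measurable_natural_filtration) auto
  have Y_F: "Y \<in> borel_measurable (\<F> t)"
    unfolding Y_def[abs_def] using Bt by measurable
  have Y_M: "Y \<in> borel_measurable M"
    by (rule measurable_from_subalg[OF subalgebra_F Y_F])
  have \<phi>_meas: "\<phi> \<in> borel_measurable (\<F> t \<Otimes>\<^sub>M borel)"
    unfolding \<phi>_def[abs_def] using Y_F by measurable
  have \<phi>D_meas: "(\<lambda>\<omega>. \<phi> (\<omega>, D \<omega>)) \<in> borel_measurable M"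
    unfolding \<phi>_def using Y_M D_meas by simp
  have \<phi>D_int: "integrable M (\<lambda>\<omega>. \<phi> (\<omega>, D \<omega>))"
  proof (rule Bochner_Integration.integrable_bound[OF _ \<phi>D_meas])
    show "integrable M (\<lambda>\<omega>. S\<^sub>0 * exp ((\<mu> - \<sigma>\<^sup>2 / 2) * T) * exp (\<sigma> * B T \<omega>))"
      using integrable_exp_B[OF \<open>0 < T\<close>] by simp
    \<comment> \<open>A positive strike keeps the payoff below the terminal price, which has an
      integrable lognormal law.\<close>
    have "norm (\<phi> (\<omega>, D \<omega>)) \<le> norm (S\<^sub>0 * exp ((\<mu> - \<sigma>\<^sup>2 / 2) * T) * exp (\<sigma> * B T \<omega>))" for \<omega>
    proof -
      have "\<phi> (\<omega>, D \<omega>) = max 0 (S\<^sub>0 * exp ((\<mu> - \<sigma>\<^sup>2 / 2) * T) * exp (\<sigma> * B T \<omega>) - K)"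
        unfolding \<phi>_def fst_conv snd_conv ST[symmetric] by (simp add: exp_add mult.assoc)
      moreover have "0 \<le> S\<^sub>0 * exp ((\<mu> - \<sigma>\<^sup>2 / 2) * T) * exp (\<sigma> * B T \<omega>)"
        using \<open>0 < S\<^sub>0\<close> by simp
      ultimately show ?thesis
        using \<open>0 < K\<close> by simp
    qed
    then show "AE \<omega> in M. norm (\<phi> (\<omega>, D \<omega>)) \<le> norm (S\<^sub>0 * exp ((\<mu> - \<sigma>\<^sup>2 / 2) * T) * exp (\<sigma> * B T \<omega>))"
      by (intro AE_I2)
  qed
  have ST_meas: "S T \<in> borel_measurable M"
    using S \<open>0 < T\<close> by (intro measurable_G_M[of _ T]) (auto simp: sde_solution_def)
  interpret finite_measure_subalgebra M "\<F> t"
    by unfold_locales (rule subalgebra_F)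
  have cond1: "AE \<omega> in M. real_cond_exp M (\<F> t) (\<lambda>\<omega>. max 0 (S T \<omega> - K)) \<omega> = real_cond_exp M (\<F> t) (\<lambda>\<omega>. \<phi> (\<omega>, D \<omega>)) \<omega>"
    using payoff ST_meas \<phi>D_meas by (intro real_cond_exp_cong) auto
  have cond2: "AE \<omega> in M. real_cond_exp M (\<F> t) (\<lambda>\<omega>. \<phi> (\<omega>, D \<omega>)) \<omega> = (\<integral>x. \<phi> (\<omega>, x) \<partial>distr M borel D)"
    by (rule real_cond_exp_independent[OF D_indep \<phi>_meas \<phi>D_int])
  have price: "(\<integral>x. \<phi> (\<omega>, x) \<partial>distr M borel D) =
      Y \<omega> * exp (\<mu> * h) * std_normal_cdf ((ln (Y \<omega> / K) + a) / (\<sigma> * sqrt h) + \<sigma> * sqrt h) -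
      K * std_normal_cdf ((ln (Y \<omega> / K) + a) / (\<sigma> * sqrt h))" for \<omega>
  proof -
    define g where "g x = max 0 (Y \<omega> * exp (a + \<sigma> * x) - K)" for x
    have g: "g \<in> borel_measurable borel"
      unfolding g_def by measurable
    have "(\<integral>x. \<phi> (\<omega>, x) \<partial>distr M borel D) = expectation (\<lambda>\<omega>'. g (D \<omega>'))"
      using integral_distr[OF D_meas g] by (simp add: \<phi>_def g_def[abs_def])
    also have "\<dots> = (\<integral>x. normal_density 0 (sqrt h) x * g x \<partial>lborel)"
      using distributed_integral[OF D_dist, of g] g by simp
    also have "\<dots> = Y \<omega> * exp (a + \<sigma>\<^sup>2 * (sqrt h)\<^sup>2 / 2) * std_normal_cdf ((ln (Y \<omega> / K) + a) / (\<sigma> * sqrt h) + \<sigma> * sqrt h) -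
        K * std_normal_cdf ((ln (Y \<omega> / K) + a) / (\<sigma> * sqrt h))"
      unfolding g_def using \<open>0 < h\<close> \<open>0 < \<sigma>\<close> \<open>0 < K\<close> \<open>0 < S\<^sub>0\<close>
      by (intro lognormal_call_integral) (auto simp: Y_def)
    \<comment> \<open>The Gaussian exponential moment restores the \<sigma>^2 / 2 removed in
      \<open>a\<close>. The mean growth rate is thus \<open>\<mu> = r - J\<close>, and discounting
      at rate \<open>r\<close> leaves the factor \<open>exp (- J * h)\<close>.\<close>
    also have "a + \<sigma>\<^sup>2 * (sqrt h)\<^sup>2 / 2 = \<mu> * h"
      using \<open>0 < h\<close> by (simp add: a_def algebra_simps)
    finally show ?thesis .
  qed
  show ?thesis
    using cond1 cond2 St
  proof eventually_elim
    case (elim \<omega>)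
    define d1 where "d1 = (ln (Y \<omega> / K) + (\<mu> + \<sigma>\<^sup>2 / 2) * h) / (\<sigma> * sqrt h)"
    have d2: "(ln (Y \<omega> / K) + a) / (\<sigma> * sqrt h) = d1 - \<sigma> * sqrt h"
    proof -
      have "\<sigma>\<^sup>2 * h = (\<sigma> * sqrt h) * (\<sigma> * sqrt h)"
        using \<open>0 < h\<close> by (simp add: power_mult_distrib flip: power2_eq_square)
      then have "\<sigma> * sqrt h = \<sigma>\<^sup>2 * h / (\<sigma> * sqrt h)"
        using \<open>0 < \<sigma>\<close> \<open>0 < h\<close> by simp
      moreover have "ln (Y \<omega> / K) + a = (ln (Y \<omega> / K) + (\<mu> + \<sigma>\<^sup>2 / 2) * h) - \<sigma>\<^sup>2 * h"
        by (simp add: a_def field_simps)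
      then have "(ln (Y \<omega> / K) + a) / (\<sigma> * sqrt h) = d1 - \<sigma>\<^sup>2 * h / (\<sigma> * sqrt h)"
        by (simp only: d1_def diff_divide_distrib)
      ultimately show ?thesis
        by (simp only:)
    qed
    have "european_value M \<F> r T (\<lambda>x. max 0 (x - K)) S t \<omega> =
        exp (- r * h) * (Y \<omega> * exp (\<mu> * h) * std_normal_cdf d1 - K * std_normal_cdf (d1 - \<sigma> * sqrt h))"
      using elim(1,2) price[of \<omega>] by (simp add: european_value_def h_def[symmetric] d2)
    also have "\<dots> = (exp (- r * h) * exp (\<mu> * h)) * Y \<omega> * std_normal_cdf d1 - K * exp (- r * h) * std_normal_cdf (d1 - \<sigma> * sqrt h)"
      by (simp add: algebra_simps)
    also have "exp (- r * h) * exp (\<mu> * h) = exp (- J * h)"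
      by (simp add: \<mu>_def algebra_simps flip: exp_add)
    finally show ?case
      unfolding Let_def elim(3) by (simp only: d1_def \<mu>_def h_def)
  qed
qed

end
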